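(* Let $\Bbbk\in\{\mathbb{R},\mathbb{C}\}$, let $\mathcal{X}\subseteq\Bbbk^n$ be a model given as in (IS) or (ES), let $d=\dim\mathcal{X}$, let $s,p\ge1$, and let $\mu:\mathcal{X}\to\Bbbk^s$ be the restriction to $\mathcal X$ of a map $\Bbbk^n\to\Bbbk^s$ given by $s$ generic polynomials of degree $p$. If $s\ge d+1$, then $\mu$ is generically identifiable. If $\Bbbk=\mathbb{C}$, $d>0$ and $p>1$, then the condition $s\ge d+1$ is also necessary for $\mu$ to be generically identifiable.
   Context: The model is given in one of two ways. (IS): $\mathcal{X}=\{x\in\Bbbk^n: f_1(x)=\dots=f_k(x)=0\}$ for polynomials $f_i\in\Bbbk[x_1,\dots,x_n]$; in this case $\mathcal X$ is assumed irreducible (nonempty and not a union of two proper algebraic subvarieties). (ES): $\mathcal{X}=\phi(\Bbbk^\ell)$ for a polynomial map $\phi:\Bbbk^\ell\to\Bbbk^n$ (the Zariski closure is then automatically irreducible). $\overline{\mathcal{X}}$ is the Zariski closure of $\mathcal{X}$ in $\Bbbk^n$, and $\dim\mathcal{X}=\dim\overline{\mathcal X}$ is its dimension as an algebraic variety over $\Bbbk$ (in (ES): the maximal rank of the Jacobian matrix of $\phi$). The map $\mu$ is identifiable at $x\in\mathcal{X}$ if $\mu^{-1}(\mu(x))=\{x\}$; it is generically identifiable if it is identifiable at all $x\in\mathcal{X}\cap U$ for some nonempty Zariski open subset $U$ of $\overline{\mathcal{X}}$. A property holds for maps given by $s$ generic polynomials of degree $p$ if it holds for all $s$-tuples in some nonempty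 Zariski open subset of the finite-dimensional vector space of $s$-tuples of polynomials in $\Bbbk[x_1,\dots,x_n]$ of degree at most $p$. *)

theory Defs
  imports "HOL-Analysis.Analysis" "HOL-Library.Poly_Mapping"
begin

subsection \<open>Multivariate polynomials\<close>

type_synonym ('v, 'a) mpoly = "('v \<Rightarrow>\<^sub>0 nat) \<Rightarrow>\<^sub>0 'a"

definition monom_eval :: "('v \<Rightarrow> 'a::comm_semiring_1) \<Rightarrow> ('v \<Rightarrow>\<^sub>0 nat) \<Rightarrow> 'a" where
  "monom_eval x m = (\<Prod>v\<in>Poly_Mapping.keys m. x v ^ Poly_Mapping.lookup m v)"

definition peval :: "('v \<Rightarrow> 'a::comm_semiring_1) \<Rightarrow> ('v, 'a) mpoly \<Rightarrow> 'a" where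
  "peval x P = (\<Sum>m\<in>Poly_Mapping.keys P. Poly_Mapping.lookup P m * monom_eval x m)"

definition mdeg :: "('v \<Rightarrow>\<^sub>0 nat) \<Rightarrow> nat" where
  "mdeg m = (\<Sum>v\<in>Poly_Mapping.keys m. Poly_Mapping.lookup m v)"

definition polys :: "'v set \<Rightarrow> ('v, 'a::zero) mpoly set" where
  "polys V = {P. \<forall>m\<in>Poly_Mapping.keys P. Poly_Mapping.keys m \<subseteq> V}"

definition monoms_le :: "'v set \<Rightarrow> nat \<Rightarrow> ('v \<Rightarrow>\<^sub>0 nat) set" where
  "monoms_le V p = {m. Poly_Mapping.keys m \<subseteq> V \<and> mdeg m \<le> p}"

definition polys_le :: "'v set \<Rightarrow> nat \<Rightarrow> ('v, 'a::zero) mpoly set" where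
  "polys_le V p = {P. Poly_Mapping.keys P \<subseteq> monoms_le V p}"

lemma monom_eval_superset:
  assumes "finite A" "Poly_Mapping.keys m \<subseteq> A"
  shows "monom_eval x m = (\<Prod>v\<in>A. x v ^ Poly_Mapping.lookup m v)"
  unfolding monom_eval_def using assms
  by (intro prod.mono_neutral_left) (auto simp: in_keys_iff)

lemma monom_eval_add: "monom_eval x (m + m') = monom_eval x m * monom_eval x m'"
proof -
  let ?A = "Poly_Mapping.keys m \<union> Poly_Mapping.keys m'"
  have "Poly_Mapping.keys (m + m') \<subseteq> ?A" by (rule keys_add)
  then show ?thesis
    by (simp add: monom_eval_superset[of ?A] lookup_add power_add prod.distrib)
qed

lemma peval_superset:
  assumes "finite A" "Poly_Mapping.keys P \<subseteq> A"
  shows "peval x P = (\<Sum>m\<in>A. Poly_Mapping.lookup P m * monom_eval x m)"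
  unfolding peval_def using assms
  by (intro sum.mono_neutral_left) (auto simp: in_keys_iff)

lemma peval_zero [simp]: "peval x 0 = 0"
  by (simp add: peval_def)

lemma peval_one [simp]: "peval x 1 = 1"
  by (simp add: peval_def monom_eval_def)

lemma peval_single [simp]: "peval x (Poly_Mapping.single m c) = c * monom_eval x m"
  by (subst peval_superset[of "{m}"]) auto

lemma peval_add: "peval x (P + Q) = peval x P + peval x Q"
proof -
  let ?A = "Poly_Mapping.keys P \<union> Poly_Mapping.keys Q"
  have "Poly_Mapping.keys (P + Q) \<subseteq> ?A" by (rule keys_add)
  then show ?thesis
    by (simp add: peval_superset[of ?A] lookup_add distrib_right sum.distrib)
qed

lemma peval_sum: "peval x (sum f A) = (\<Sum>a\<in>A. peval x (f a))"
  by (induction A rule: infinite_finite_induct) (simp_all add: peval_add)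

lemma mpoly_sum_single: "(P :: ('v, 'a::comm_monoid_add) mpoly)
    = (\<Sum>m\<in>Poly_Mapping.keys P. Poly_Mapping.single m (Poly_Mapping.lookup P m))"
proof (rule poly_mapping_eqI)
  fix k
  have "Poly_Mapping.lookup (\<Sum>m\<in>Poly_Mapping.keys P. Poly_Mapping.single m (Poly_Mapping.lookup P m)) k
      = (\<Sum>m\<in>Poly_Mapping.keys P. if m = k then Poly_Mapping.lookup P m else 0)"
    by (auto simp: lookup_sum lookup_single when_def intro!: sum.cong)
  also have "\<dots> = Poly_Mapping.lookup P k" by (simp add: in_keys_iff)
  finally show "Poly_Mapping.lookup P k = Poly_Mapping.lookup (\<Sum>m\<in>Poly_Mapping.keys P. Poly_Mapping.single m (Poly_Mapping.lookup P m)) k" by simp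
qed

lemma peval_mult: "peval x (P * Q) = peval x P * peval x Q"
proof -
  have "P * Q = (\<Sum>m\<in>Poly_Mapping.keys P. Poly_Mapping.single m (Poly_Mapping.lookup P m)) *
      (\<Sum>m\<in>Poly_Mapping.keys Q. Poly_Mapping.single m (Poly_Mapping.lookup Q m))"
    by (simp flip: mpoly_sum_single)
  also have "\<dots> = (\<Sum>m\<in>Poly_Mapping.keys P. \<Sum>m'\<in>Poly_Mapping.keys Q.
      Poly_Mapping.single (m + m') (Poly_Mapping.lookup P m * Poly_Mapping.lookup Q m'))"
    by (simp add: sum_product mult_single)
  finally have "peval x (P * Q) = (\<Sum>m\<in>Poly_Mapping.keys P. \<Sum>m'\<in>Poly_Mapping.keys Q.
      (Poly_Mapping.lookup P m * monom_eval x m) * (Poly_Mapping.lookup Q m' * monom_eval x m'))"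
    by (simp add: peval_sum monom_eval_add mult_ac)
  then show ?thesis by (simp add: peval_def sum_product)
qed

lemma polys_mult: "P \<in> polys V \<Longrightarrow> Q \<in> polys V \<Longrightarrow> P * Q \<in> polys V"
  unfolding polys_def
proof clarify
  fix m v
  assume P: "\<forall>m\<in>Poly_Mapping.keys P. Poly_Mapping.keys m \<subseteq> V" and Q: "\<forall>m\<in>Poly_Mapping.keys Q. Poly_Mapping.keys m \<subseteq> V"
    and m: "m \<in> Poly_Mapping.keys (P * Q)" and v: "v \<in> Poly_Mapping.keys m"
  from m keys_mult[of P Q] obtain a b where "m = a + b" "a \<in> Poly_Mapping.keys P" "b \<in> Poly_Mapping.keys Q" by blast
  with P Q v keys_add[of a b] show "v \<in> V" by blast
qed


subsection \<open>Zariski topology\<close>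

text \<open>Affine space with coordinates indexed by a set \<open>V\<close>: \<open>aff {..<n}\<close> is \<open>n\<close>-space, and other
  index sets are used for spaces of coefficients.\<close>

definition aff :: "'v set \<Rightarrow> ('v \<Rightarrow> 'a) set" where
  "aff V = V \<rightarrow>\<^sub>E UNIV"

definition zeros :: "'v set \<Rightarrow> ('v, 'a::comm_semiring_1) mpoly set \<Rightarrow> ('v \<Rightarrow> 'a) set" where
  "zeros V F = {x \<in> aff V. \<forall>P\<in>F. peval x P = 0}"

definition zariski :: "'v set \<Rightarrow> ('v \<Rightarrow> 'a::idom) topology" where
  "zariski V = topology (\<lambda>U. \<exists>F. F \<subseteq> polys V \<and> U = aff V - zeros V F)"

lemma istopology_zariski:
  "istopology (\<lambda>U::('v \<Rightarrow> 'a::idom) set. \<exists>F. F \<subseteq> polys V \<and> U = aff V - zeros V F)"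
  (is "istopology ?L")
proof -
  have "?L (S \<inter> T)" if "?L S" "?L T" for S T
  proof -
    from that obtain F G where F: "F \<subseteq> polys V" "S = aff V - zeros V F"
      and G: "G \<subseteq> polys V" "T = aff V - zeros V G" by blast
    let ?H = "{P * Q | P Q. P \<in> F \<and> Q \<in> G}"
    have "zeros V ?H = zeros V F \<union> zeros V G"
      by (fastforce simp: zeros_def peval_mult)
    then have "S \<inter> T = aff V - zeros V ?H" using F G by blast
    moreover have "?H \<subseteq> polys V" using F G polys_mult by blast
    ultimately show ?thesis by blast
  qed
  moreover have "?L (\<Union>\<K>)" if K: "\<forall>K\<in>\<K>. ?L K" for \<K>
  proof -
    from K obtain F where F: "\<forall>K\<in>\<K>. F K \<subseteq> polys V \<and> K = aff V - zeros V (F K)"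
      by (auto dest!: bchoice)
    have "zeros V (\<Union>(F ` \<K>)) = {x \<in> aff V. \<forall>K\<in>\<K>. x \<in> zeros V (F K)}"
      by (auto simp: zeros_def)
    then have "\<Union>\<K> = aff V - zeros V (\<Union>(F ` \<K>))" using F by blast
    moreover have "\<Union>(F ` \<K>) \<subseteq> polys V" using F by blast
    ultimately show ?thesis by blast
  qed
  ultimately show ?thesis unfolding istopology_def by blast
qed

lemma openin_zariski:
  "openin (zariski V) U \<longleftrightarrow> (\<exists>F. F \<subseteq> polys V \<and> U = aff V - zeros V F)"
  unfolding zariski_def by (simp only: topology_inverse'[OF istopology_zariski])

lemma topspace_zariski [simp]: "topspace (zariski V :: ('v \<Rightarrow> 'a::idom) topology) = aff V"
proof -
  have "openin (zariski V) (aff V :: ('v \<Rightarrow> 'a) set)"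
    unfolding openin_zariski
    by (rule exI[of _ "{1}"]) (auto simp: zeros_def polys_def)
  then show ?thesis
    by (metis Diff_subset openin_subset openin_topspace openin_zariski subset_antisym)
qed

lemma closedin_zariski:
  fixes Z :: "('v \<Rightarrow> 'a::idom) set"
  shows "closedin (zariski V) Z \<longleftrightarrow> (\<exists>F. F \<subseteq> polys V \<and> Z = zeros V F)"
proof -
  have "zeros V F \<subseteq> aff V" for F :: "('v, 'a) mpoly set" by (auto simp: zeros_def)
  then have "Z \<subseteq> aff V \<and> aff V - Z = aff V - zeros V F \<longleftrightarrow> Z = zeros V F"
    for F :: "('v, 'a) mpoly set"
    by blast
  then show ?thesis unfolding closedin_def openin_zariski topspace_zariski by blast
qed


subsection \<open>Models and their dimension\<close>

definition poly_map :: "nat \<Rightarrow> (nat \<Rightarrow> ('v, 'a::comm_semiring_1) mpoly) \<Rightarrow> ('v \<Rightarrow> 'a) \<Rightarrow> nat \<Rightarrow> 'a" where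
  "poly_map s f x = (\<lambda>i\<in>{..<s}. peval x (f i))"

definition irreducible_variety :: "nat \<Rightarrow> (nat \<Rightarrow> 'a::idom) set \<Rightarrow> bool" where
  "irreducible_variety n X \<longleftrightarrow> closedin (zariski {..<n}) X \<and> X \<noteq> {} \<and>
     \<not> (\<exists>A B. closedin (zariski {..<n}) A \<and> closedin (zariski {..<n}) B \<and>
           A \<subset> X \<and> B \<subset> X \<and> X = A \<union> B)"

definition implicit_model :: "nat \<Rightarrow> (nat \<Rightarrow> 'a::idom) set \<Rightarrow> bool" where
  "implicit_model n X \<longleftrightarrow>
     (\<exists>k f. (\<forall>i<k. f i \<in> polys {..<n}) \<and>
        X = {x \<in> aff {..<n}. \<forall>i<k::nat. peval x (f i) = 0}) \<and>
     irreducible_variety n X"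

definition explicit_model :: "nat \<Rightarrow> (nat \<Rightarrow> 'a::idom) set \<Rightarrow> bool" where
  "explicit_model n X \<longleftrightarrow>
     (\<exists>l \<phi>. (\<forall>i<n. \<phi> i \<in> polys {..<l::nat}) \<and> X = poly_map n \<phi> ` aff {..<l})"

definition is_model :: "nat \<Rightarrow> (nat \<Rightarrow> 'a::idom) set \<Rightarrow> bool" where
  "is_model n X \<longleftrightarrow> implicit_model n X \<or> explicit_model n X"

text \<open>Polynomials in \<open>n\<close> variables are equal in the coordinate ring of \<open>Z\<close> iff they agree at all
  points of \<open>Z\<close>.  Hence the classes of \<open>g 0, \<dots>, g (d - 1)\<close> are algebraically independent over the
  ground field iff no nonzero polynomial in \<open>d\<close> variables, evaluated at them, vanishes on all
  of \<open>Z\<close>.\<close>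

definition alg_indep_on ::
    "(nat \<Rightarrow> 'a::idom) set \<Rightarrow> nat \<Rightarrow> (nat \<Rightarrow> (nat, 'a) mpoly) \<Rightarrow> bool" where
  "alg_indep_on Z d g \<longleftrightarrow>
     (\<forall>P \<in> polys {..<d}. P \<noteq> 0 \<longrightarrow> (\<exists>x\<in>Z. peval (poly_map d g x) P \<noteq> 0))"

text \<open>The dimension of an irreducible variety is the transcendence degree of its coordinate ring
  (equivalently, of its function field); the maximum exists and is at most \<open>n\<close>.  A model is given
  the dimension of its Zariski closure.\<close>

definition variety_dim :: "nat \<Rightarrow> (nat \<Rightarrow> 'a::idom) set \<Rightarrow> nat" where
  "variety_dim n Z = Max {d. \<exists>g. (\<forall>i<d. g i \<in> polys {..<n}) \<and> alg_indep_on Z d g}"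

definition model_dim :: "nat \<Rightarrow> (nat \<Rightarrow> 'a::idom) set \<Rightarrow> nat" where
  "model_dim n X = variety_dim n (zariski {..<n} closure_of X)"


subsection \<open>Identifiability and genericity\<close>

definition identifiable_at :: "'x set \<Rightarrow> ('x \<Rightarrow> 'y) \<Rightarrow> 'x \<Rightarrow> bool" where
  "identifiable_at X \<mu> x \<longleftrightarrow> {y \<in> X. \<mu> y = \<mu> x} = {x}"

definition generically_identifiable ::
    "nat \<Rightarrow> (nat \<Rightarrow> 'a::idom) set \<Rightarrow> ((nat \<Rightarrow> 'a) \<Rightarrow> 'y) \<Rightarrow> bool" where
  "generically_identifiable n X \<mu> \<longleftrightarrow>
     (\<exists>U. openin (subtopology (zariski {..<n}) (zariski {..<n} closure_of X)) U \<and> U \<noteq> {} \<and>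
        (\<forall>x \<in> X \<inter> U. identifiable_at X \<mu> x))"

text \<open>The space of \<open>s\<close>-tuples of polynomials of degree at most \<open>p\<close> in \<open>n\<close> variables is identified
  with affine space via coefficients: coordinate \<open>(i, m)\<close> is the coefficient of the monomial \<open>m\<close>
  in the \<open>i\<close>-th polynomial.\<close>

definition coeff_index :: "nat \<Rightarrow> nat \<Rightarrow> nat \<Rightarrow> (nat \<times> (nat \<Rightarrow>\<^sub>0 nat)) set" where
  "coeff_index n s p = {..<s} \<times> monoms_le {..<n} p"

definition coeff_vec ::
    "nat \<Rightarrow> nat \<Rightarrow> nat \<Rightarrow> (nat \<Rightarrow> (nat, 'a::zero) mpoly) \<Rightarrow> nat \<times> (nat \<Rightarrow>\<^sub>0 nat) \<Rightarrow> 'a" where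
  "coeff_vec n s p f = restrict (\<lambda>(i, m). Poly_Mapping.lookup (f i) m) (coeff_index n s p)"

definition for_generic_polys ::
    "nat \<Rightarrow> nat \<Rightarrow> nat \<Rightarrow> ((nat \<Rightarrow> (nat, 'a::idom) mpoly) \<Rightarrow> bool) \<Rightarrow> bool" where
  "for_generic_polys n s p Q \<longleftrightarrow>
     (\<exists>W. openin (zariski (coeff_index n s p)) W \<and> W \<noteq> {} \<and>
        (\<forall>f \<in> {..<s} \<rightarrow>\<^sub>E polys_le {..<n} p. coeff_vec n s p f \<in> W \<longrightarrow> Q f))"

end

theory Submission
  imports Defs "HOL-Computational_Algebra.Fundamental_Theorem_Algebra"
begin

text \<open>
  Write \<open>K\<close> for the ground field, \<open>N\<close> for the number of coefficients of an \<open>s\<close>-tuple of polynomials, \<open>f\<^sub>c\<close> for the tuple with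
  coefficient vector \<open>c\<close>, and \<open>d\<close> for the dimension of \<open>X\<close>.  Both halves treat \<open>c\<close> as a variable point
  and argue on products of \<open>K\<^sup>N\<close> with irreducible sets, so that the open set of good coefficient vectors
  comes out as the nonvanishing locus of a single polynomial.

  \<^bold>\<open>The case \<open>s > d\<close>.\<close>  The functions on \<open>K\<^sup>N \<times> X\<close> have transcendence degree \<open>N + d\<close>, so the \<open>N + s\<close>
  functions given by the coefficients and by the entries of \<open>f\<^sub>c(x)\<close> satisfy a nontrivial relation
  \<open>P(c, f\<^sub>c(x)) = 0\<close>.  Differentiating it with respect to the coefficient of the monomial \<open>m\<close> in the
  \<open>i\<close>-th polynomial gives \<open>\<partial>P/\<partial>c\<^sub>i\<^sub>m + x\<^sup>m \<partial>P/\<partial>t\<^sub>i = 0\<close>  (\<open>differentiated_relation\<close>).  For \<open>m = x\<^sub>j\<close> this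
  writes the coordinate \<open>x\<^sub>j\<close> as a rational function of \<open>(c, f\<^sub>c(x))\<close>: the point is recovered from its image
  wherever \<open>\<partial>P/\<partial>t\<^sub>i\<close> does not vanish.  Taking \<open>P\<close> of minimal degree makes some \<open>\<partial>P/\<partial>t\<^sub>i\<close> not
  identically zero (\<open>minimal_relation\<close>).

  \<^bold>\<open>The case \<open>s \<le> d\<close>.\<close>  The triples \<open>(c, x, y)\<close> with \<open>f\<^sub>c(x) = f\<^sub>c(y)\<close> and \<open>x\<^sub>j \<noteq> y\<^sub>j\<close>, for a nonconstant
  coordinate \<open>j\<close>, are parametrised by \<open>collide\<close> with \<open>N - s\<close> free parameters for given \<open>x\<close> and \<open>y\<close>.  The
  crucial point is that already for fixed \<open>x\<close> the vectors \<open>c\<close> that occur are Zariski dense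
  (\<open>collide_independent\<close>).  Differentiating a relation between them along the parameters would, as \<open>p \<ge> 2\<close>,
  determine \<open>y\<close> and then the parameters rationally from \<open>c\<close>; but these have transcendence degree
  \<open>N - s + d \<ge> N\<close>, and the relation leaves less than \<open>N\<close> for \<open>c\<close>.  Hence an equation between
  \<open>c\<close> and \<open>x\<close> that holds for all the triples holds on all of \<open>K\<^sup>N \<times> X\<close>, and over an algebraically closed
  field a generic pair \<open>(c, x)\<close> can be completed to a triple by an actual point \<open>y\<close> of the model (\<open>extend_specialisation\<close>).

  Transcendence degrees enter through the growth, as a function of \<open>k\<close>, of the dimension of the
  space of polynomials of degree at most \<open>k\<close> in a given set of functions: adjoining an algebraic function does
  not change the order of growth (\<open>growth_insert_algebraic\<close>), and a set of growth of order \<open>r\<close> has no more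
  than \<open>r\<close> algebraically independent polynomials (\<open>alg_indep_le_growth\<close>).
\<close>

section \<open>Rings of functions\<close>

definition function_ring :: "('w \<Rightarrow> 'a::comm_ring_1) set \<Rightarrow> bool" where
  "function_ring R \<longleftrightarrow> (\<forall>a. (\<lambda>_. a) \<in> R) \<and> (\<forall>f\<in>R. \<forall>g\<in>R. (\<lambda>w. f w + g w) \<in> R \<and> (\<lambda>w. f w * g w) \<in> R)"

lemma fring_const: "function_ring R \<Longrightarrow> (\<lambda>_. a) \<in> R"
  and fring_add: "function_ring R \<Longrightarrow> f \<in> R \<Longrightarrow> g \<in> R \<Longrightarrow> (\<lambda>w. f w + g w) \<in> R"
  and fring_mult: "function_ring R \<Longrightarrow> f \<in> R \<Longrightarrow> g \<in> R \<Longrightarrow> (\<lambda>w. f w * g w) \<in> R"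
  by (auto simp: function_ring_def)

lemma fring_diff: "function_ring R \<Longrightarrow> f \<in> R \<Longrightarrow> g \<in> R \<Longrightarrow> (\<lambda>w. f w - g w) \<in> R"
  using fring_add[of R f "\<lambda>w. (-1) * g w"] fring_mult[of R "\<lambda>_. -1" g] fring_const[of R "-1"] by simp

lemma fring_uminus: "function_ring R \<Longrightarrow> f \<in> R \<Longrightarrow> (\<lambda>w. - f w) \<in> R"
  using fring_mult[of R "\<lambda>_. -1" f] fring_const[of R "-1"] by simp

lemma fring_sum: "function_ring R \<Longrightarrow> (\<And>i. i \<in> A \<Longrightarrow> f i \<in> R) \<Longrightarrow> (\<lambda>w. \<Sum>i\<in>A. f i w) \<in> R"
  by (induction A rule: infinite_finite_induct) (auto intro: fring_const fring_add)

lemma fring_prod: "function_ring R \<Longrightarrow> (\<And>i. i \<in> A \<Longrightarrow> f i \<in> R) \<Longrightarrow> (\<lambda>w. \<Prod>i\<in>A. f i w) \<in> R"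
  by (induction A rule: infinite_finite_induct) (auto intro: fring_const fring_mult)

lemma fring_power: "function_ring R \<Longrightarrow> f \<in> R \<Longrightarrow> (\<lambda>w. f w ^ k) \<in> R"
  by (induction k) (auto intro: fring_const fring_mult)

lemma fring_peval:
  assumes R: "function_ring R" and P: "P \<in> polys V" and h: "\<And>v. v \<in> V \<Longrightarrow> h v \<in> R"
  shows "(\<lambda>w. peval (\<lambda>v. h v w) P) \<in> R"
proof -
  have "(\<lambda>w. \<Sum>m\<in>Poly_Mapping.keys P. Poly_Mapping.lookup P m *
      (\<Prod>v\<in>Poly_Mapping.keys m. h v w ^ Poly_Mapping.lookup m v)) \<in> R"
    using P h unfolding polys_def
    by (intro fring_sum[OF R] fring_mult[OF R] fring_const[OF R] fring_prod[OF R] fring_power[OF R]) auto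
  then show ?thesis by (simp add: peval_def monom_eval_def)
qed

lemma peval_cong:
  assumes "P \<in> polys V" "\<And>v. v \<in> V \<Longrightarrow> x v = y v"
  shows "peval x P = peval y P"
  using assms unfolding peval_def monom_eval_def polys_def
  by (intro sum.cong prod.cong arg_cong2[where f = "(*)"] refl) (auto simp: subset_iff)

definition polyfuns :: "'v set \<Rightarrow> (('v \<Rightarrow> 'a::comm_ring_1) \<Rightarrow> 'a) set" where
  "polyfuns V = {\<lambda>x. peval x P |P. P \<in> polys V}"

lemma polys_single: "Poly_Mapping.keys m \<subseteq> V \<Longrightarrow> Poly_Mapping.single m c \<in> polys V"
  by (auto simp: polys_def)

lemma polys_zero: "0 \<in> polys V"
  by (auto simp: polys_def)

lemma polys_add: "P \<in> polys V \<Longrightarrow> Q \<in> polys V \<Longrightarrow> P + Q \<in> polys V"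
  using keys_add[of P Q] by (fastforce simp: polys_def)

lemma polys_sum: "(\<And>i. i \<in> A \<Longrightarrow> f i \<in> polys V) \<Longrightarrow> sum f A \<in> polys V"
  by (induction A rule: infinite_finite_induct) (auto intro: polys_zero polys_add)

lemma polys_mono: "V \<subseteq> W \<Longrightarrow> polys V \<subseteq> polys W"
  by (fastforce simp: polys_def)

lemma polyfunsI: "P \<in> polys V \<Longrightarrow> (\<lambda>x. peval x P) \<in> polyfuns V"
  by (auto simp: polyfuns_def)

lemma polyfunsE: "F \<in> polyfuns V \<Longrightarrow> (\<And>P. P \<in> polys V \<Longrightarrow> F = (\<lambda>x. peval x P) \<Longrightarrow> thesis) \<Longrightarrow> thesis"
  by (auto simp: polyfuns_def)

lemma fring_polyfuns: "function_ring (polyfuns V :: (('v \<Rightarrow> 'a::comm_ring_1) \<Rightarrow> 'a) set)"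
proof -
  have "(\<lambda>_. a) \<in> polyfuns V" for a :: 'a
    using polyfunsI[OF polys_single[of 0 V a]] by (simp add: monom_eval_def)
  moreover have "(\<lambda>w. f w + g w) \<in> polyfuns V" "(\<lambda>w. f w * g w) \<in> polyfuns V"
    if fg: "f \<in> polyfuns V" "g \<in> polyfuns V" for f g :: "('v \<Rightarrow> 'a) \<Rightarrow> 'a"
  proof -
    obtain P Q where *: "P \<in> polys V" "f = (\<lambda>x. peval x P)" "Q \<in> polys V" "g = (\<lambda>x. peval x Q)"
      using fg by (auto simp: polyfuns_def)
    then show "(\<lambda>w. f w + g w) \<in> polyfuns V" "(\<lambda>w. f w * g w) \<in> polyfuns V"
      using polyfunsI[OF polys_add[of P V Q]] polyfunsI[OF polys_mult[of P V Q]]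
      by (auto simp: peval_add peval_mult)
  qed
  ultimately show ?thesis by (auto simp: function_ring_def)
qed

lemma monom_eval_single: "monom_eval x (Poly_Mapping.single v k) = x v ^ k"
  by (cases "k = 0") (simp_all add: monom_eval_def)

lemma polyfuns_var: "v \<in> V \<Longrightarrow> (\<lambda>x. x v) \<in> polyfuns V"
  using polyfunsI[OF polys_single[of "Poly_Mapping.single v 1" V 1]]
  by (simp add: monom_eval_single)

lemma fring_polyfun_comp:
  assumes "function_ring R" "F \<in> polyfuns V" "\<And>v. v \<in> V \<Longrightarrow> h v \<in> R"
  shows "(\<lambda>w. F (\<lambda>v. h v w)) \<in> R"
  using assms(2) fring_peval[OF assms(1) _ assms(3)] by (auto simp: polyfuns_def)

lemma polyfuns_cong:
  assumes "F \<in> polyfuns V" "\<And>v. v \<in> V \<Longrightarrow> x v = y v"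
  shows "F x = F y"
  using assms(1) by (rule polyfunsE) (use peval_cong[OF _ assms(2)] in auto)

lemma polyfuns_monom: "Poly_Mapping.keys m \<subseteq> V \<Longrightarrow> (\<lambda>x. monom_eval x m) \<in> polyfuns V"
  using polyfunsI[OF polys_single[of m V 1]] by simp

section \<open>Function rings without zero divisors\<close>

text \<open>For polynomial functions this says that \<open>\<Omega>\<close> is irreducible: two nonempty open subsets meet.\<close>

definition function_domain :: "'w set \<Rightarrow> ('w \<Rightarrow> 'a::field) set \<Rightarrow> bool" where
  "function_domain \<Omega> R \<longleftrightarrow> function_ring R \<and> \<Omega> \<noteq> {} \<and>
     (\<forall>f\<in>R. \<forall>g\<in>R. (\<exists>w\<in>\<Omega>. f w \<noteq> 0) \<longrightarrow> (\<exists>w\<in>\<Omega>. g w \<noteq> 0) \<longrightarrow> (\<exists>w\<in>\<Omega>. f w \<noteq> 0 \<and> g w \<noteq> 0))"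

lemma fdom_fring: "function_domain \<Omega> R \<Longrightarrow> function_ring R"
  by (simp add: function_domain_def)

lemma fdom_ne: "function_domain \<Omega> R \<Longrightarrow> \<Omega> \<noteq> {}"
  by (simp add: function_domain_def)

lemma fdom_both:
  "function_domain \<Omega> R \<Longrightarrow> f \<in> R \<Longrightarrow> g \<in> R \<Longrightarrow> \<exists>w\<in>\<Omega>. f w \<noteq> 0 \<Longrightarrow> \<exists>w\<in>\<Omega>. g w \<noteq> 0 \<Longrightarrow>
    \<exists>w\<in>\<Omega>. f w \<noteq> 0 \<and> g w \<noteq> 0"
  unfolding function_domain_def by blast

lemma fdom_cancel:
  assumes "function_domain \<Omega> R" "q \<in> R" "f \<in> R" "\<exists>w\<in>\<Omega>. q w \<noteq> 0" "\<And>w. w \<in> \<Omega> \<Longrightarrow> q w * f w = 0" "w \<in> \<Omega>"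
  shows "f w = 0"
  using fdom_both[OF assms(1-4)] assms(5,6) by fastforce

lemma fdom_power_nonzero:
  fixes q :: "'w \<Rightarrow> 'a::field"
  assumes "\<exists>w\<in>\<Omega>. q w \<noteq> 0"
  shows "\<exists>w\<in>\<Omega>. q w ^ k \<noteq> 0"
proof -
  obtain w where "w \<in> \<Omega>" "q w \<noteq> 0" using assms by blast
  then have "q w ^ k \<noteq> 0" by simp
  then show ?thesis using \<open>w \<in> \<Omega>\<close> by blast
qed

text \<open>Functions that are admissible in each variable separately suffice, because a common point of
nonvanishing can be found first for one coordinate and then for the other.  For polynomial functions
this is the irreducibility of a product of irreducible sets.\<close>

lemma fdom_Times:
  assumes 1: "function_domain \<Omega>1 R1" and 2: "function_domain \<Omega>2 R2"
  shows "function_domain (\<Omega>1 \<times> \<Omega>2) {F. (\<forall>y\<in>\<Omega>2. (\<lambda>x. F (x, y)) \<in> R1) \<and> (\<forall>x\<in>\<Omega>1. (\<lambda>y. F (x, y)) \<in> R2)}"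
    (is "function_domain _ ?R")
  unfolding function_domain_def
proof (intro conjI ballI impI)
  show "function_ring ?R" using fdom_fring[OF 1] fdom_fring[OF 2] by (auto simp: function_ring_def)
  show "\<Omega>1 \<times> \<Omega>2 \<noteq> {}" using fdom_ne[OF 1] fdom_ne[OF 2] by auto
next
  fix F G assume F: "F \<in> ?R" and G: "G \<in> ?R"
    and "\<exists>w\<in>\<Omega>1 \<times> \<Omega>2. F w \<noteq> 0" "\<exists>w\<in>\<Omega>1 \<times> \<Omega>2. G w \<noteq> 0"
  then obtain x y x' y' where xy: "x \<in> \<Omega>1" "y \<in> \<Omega>2" "F (x, y) \<noteq> 0" "x' \<in> \<Omega>1" "y' \<in> \<Omega>2" "G (x', y') \<noteq> 0"
    by auto
  have "\<exists>w\<in>\<Omega>2. F (x, w) \<noteq> 0 \<and> G (x', w) \<noteq> 0"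
    by (rule fdom_both[OF 2]) (use F G xy in auto)
  then obtain w where w: "w \<in> \<Omega>2" "F (x, w) \<noteq> 0" "G (x', w) \<noteq> 0" by blast
  have "\<exists>z\<in>\<Omega>1. F (z, w) \<noteq> 0 \<and> G (z, w) \<noteq> 0"
    by (rule fdom_both[OF 1]) (use F G xy w in auto)
  then show "\<exists>w\<in>\<Omega>1 \<times> \<Omega>2. F w \<noteq> 0 \<and> G w \<noteq> 0" using w by auto
qed

lemma fdom_affine: "function_domain (UNIV :: ('v \<Rightarrow> 'a::field_char_0) set) (polyfuns V)"
  unfolding function_domain_def
proof (intro conjI ballI impI)
  fix F G :: "('v \<Rightarrow> 'a) \<Rightarrow> 'a" assume F: "F \<in> polyfuns V" and G: "G \<in> polyfuns V"
    and "\<exists>w\<in>UNIV. F w \<noteq> 0" "\<exists>w\<in>UNIV. G w \<noteq> 0"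
  then obtain a b where ab: "F a \<noteq> 0" "G b \<noteq> 0" by blast
  \<comment> \<open>On the line through the two points both functions are nonzero polynomials in one variable.\<close>
  let ?l = "\<lambda>t v. a v + t * (b v - a v)"
  have R: "function_ring (range poly :: ('a \<Rightarrow> 'a) set)"
  proof -
    have "(\<lambda>_. c) = poly [:c:]" for c :: 'a by auto
    moreover have "(\<lambda>w. poly p w + poly q w) = poly (p + q)" "(\<lambda>w. poly p w * poly q w) = poly (p * q)"
      for p q :: "'a poly" by auto
    ultimately show ?thesis unfolding function_ring_def by blast
  qed
  have "(\<lambda>t. ?l t v) = poly [:a v, b v - a v:]" for v by auto
  then have l: "(\<lambda>t. ?l t v) \<in> range poly" for v by blast
  have "(\<lambda>t. F (?l t)) \<in> range poly" "(\<lambda>t. G (?l t)) \<in> range poly"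
    using fring_polyfun_comp[OF R F, of "\<lambda>v t. ?l t v"] fring_polyfun_comp[OF R G, of "\<lambda>v t. ?l t v"] l by auto
  then obtain p q where p: "(\<lambda>t. F (?l t)) = poly p" and q: "(\<lambda>t. G (?l t)) = poly q"
    by auto
  have "poly p 0 \<noteq> 0" "poly q 1 \<noteq> 0"
    using ab fun_cong[OF p, of 0] fun_cong[OF q, of 1] by auto
  then have "p * q \<noteq> 0" by auto
  then have "finite {t. poly (p * q) t = 0}" by (rule poly_roots_finite)
  then obtain t where "poly (p * q) t \<noteq> 0"
    using infinite_UNIV_char_0[where 'a = 'a] by (metis (mono_tags, lifting) UNIV_eq_I mem_Collect_eq)
  then have "F (?l t) \<noteq> 0" "G (?l t) \<noteq> 0" using fun_cong[OF p, of t] fun_cong[OF q, of t] by auto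
  then show "\<exists>w\<in>UNIV. F w \<noteq> 0 \<and> G w \<noteq> 0" by blast
qed (simp_all add: fring_polyfuns)

section \<open>Formal partial derivatives\<close>

definition pdiff :: "'v \<Rightarrow> ('v, 'a::comm_semiring_1) mpoly \<Rightarrow> ('v, 'a) mpoly" where
  "pdiff v P = (\<Sum>m\<in>Poly_Mapping.keys P. Poly_Mapping.single (m - Poly_Mapping.single v 1)
      (of_nat (Poly_Mapping.lookup m v) * Poly_Mapping.lookup P m))"

lemma lookup_pdiff:
  "Poly_Mapping.lookup (pdiff v P) m =
     of_nat (Suc (Poly_Mapping.lookup m v)) * Poly_Mapping.lookup P (m + Poly_Mapping.single v 1)"
proof -
  let ?m = "m + Poly_Mapping.single v 1"
  have *: "m' - Poly_Mapping.single v 1 = m \<longleftrightarrow> m' = ?m" if "Poly_Mapping.lookup m' v \<noteq> 0" for m'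
  proof
    assume "m' - Poly_Mapping.single v 1 = m"
    then have st: "Poly_Mapping.lookup (m' - Poly_Mapping.single v 1) x = Poly_Mapping.lookup m x" for x by simp
    have *: "Poly_Mapping.lookup m' x - (if v = x then 1 else 0) = Poly_Mapping.lookup m x" for x
      by (rule st[unfolded lookup_minus lookup_single when_def])
    have "Poly_Mapping.lookup m' x = Poly_Mapping.lookup ?m x" for x
      unfolding lookup_add lookup_single when_def using that *[of x] by (cases "v = x") auto
    then show "m' = ?m" by (intro poly_mapping_eqI)
  qed simp
  have "Poly_Mapping.lookup (pdiff v P) m = (\<Sum>m'\<in>Poly_Mapping.keys P.
      if m' = ?m then of_nat (Poly_Mapping.lookup m' v) * Poly_Mapping.lookup P m' else 0)"
    unfolding pdiff_def lookup_sum
  proof (intro sum.cong refl)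
    fix m'
    show "Poly_Mapping.lookup (Poly_Mapping.single (m' - Poly_Mapping.single v 1)
        (of_nat (Poly_Mapping.lookup m' v) * Poly_Mapping.lookup P m')) m
      = (if m' = ?m then of_nat (Poly_Mapping.lookup m' v) * Poly_Mapping.lookup P m' else 0)"
      unfolding lookup_single when_def using *[of m'] by (cases "Poly_Mapping.lookup m' v = 0") auto
  qed
  also have "\<dots> = of_nat (Suc (Poly_Mapping.lookup m v)) * Poly_Mapping.lookup P ?m"
    by (simp add: lookup_add in_keys_iff)
  finally show ?thesis .
qed

lemma keys_pdiff: "m \<in> Poly_Mapping.keys (pdiff v P) \<Longrightarrow> m + Poly_Mapping.single v 1 \<in> Poly_Mapping.keys P"
  by (auto simp: in_keys_iff lookup_pdiff)

lemma mdeg_superset: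
  assumes "finite A" "Poly_Mapping.keys m \<subseteq> A"
  shows "mdeg m = (\<Sum>v\<in>A. Poly_Mapping.lookup m v)"
  unfolding mdeg_def using assms by (intro sum.mono_neutral_left) (auto simp: in_keys_iff)

lemma mdeg_add: "mdeg (m + m') = mdeg m + mdeg m'"
proof -
  let ?A = "Poly_Mapping.keys m \<union> Poly_Mapping.keys m'"
  have "Poly_Mapping.keys (m + m') \<subseteq> ?A" by (rule keys_add)
  then show ?thesis by (simp add: mdeg_superset[of ?A] lookup_add sum.distrib)
qed

lemma mdeg_single [simp]: "mdeg (Poly_Mapping.single v k) = k"
  by (cases "k = 0") (simp_all add: mdeg_def)

lemma keys_add_nat: "Poly_Mapping.keys (m + m' :: 'v \<Rightarrow>\<^sub>0 nat) = Poly_Mapping.keys m \<union> Poly_Mapping.keys m'"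
  by (auto simp: in_keys_iff lookup_add)

lemma polys_pdiff: "P \<in> polys V \<Longrightarrow> pdiff v P \<in> polys V"
  using keys_pdiff[of _ v P] keys_add_nat by (fastforce simp: polys_def)

lemma pdiff_all_zero:
  fixes P :: "('v, 'a::{comm_semiring_1,semiring_char_0,semiring_no_zero_divisors}) mpoly"
  assumes "P \<in> polys V" "\<And>v. v \<in> V \<Longrightarrow> pdiff v P = 0"
  shows "Poly_Mapping.keys P \<subseteq> {0}"
proof (rule ccontr)
  assume "\<not> ?thesis"
  then obtain m where m: "m \<in> Poly_Mapping.keys P" "m \<noteq> 0" by auto
  then obtain v where v: "v \<in> Poly_Mapping.keys m" by (metis all_not_in_conv keys_eq_empty)
  then have "v \<in> V" using m assms(1) by (auto simp: polys_def)
  define m' where "m' = m - Poly_Mapping.single v 1"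
  have "m' + Poly_Mapping.single v 1 = m"
    unfolding m'_def using v
    by (auto simp: poly_mapping_eq_iff fun_eq_iff lookup_add lookup_minus lookup_single when_def in_keys_iff)
  then have "Poly_Mapping.lookup (pdiff v P) m' \<noteq> 0"
    using m by (simp add: lookup_pdiff in_keys_iff del: of_nat_Suc)
  then show False using assms(2)[OF \<open>v \<in> V\<close>] by simp
qed

text \<open>Partial derivatives have smaller degree, so in a relation of least degree those that vanish on
\<open>\<Omega>\<close> vanish identically; in characteristic zero they cannot all do so.\<close>

lemma minimal_relation:
  fixes h :: "'v \<Rightarrow> 'w \<Rightarrow> 'a::field_char_0"
  assumes "\<Omega> \<noteq> {}" "P \<in> polys V" "P \<noteq> 0" "\<And>w. w \<in> \<Omega> \<Longrightarrow> peval (\<lambda>v. h v w) P = 0"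
  obtains Q v where "Q \<in> polys V" "\<And>w. w \<in> \<Omega> \<Longrightarrow> peval (\<lambda>v. h v w) Q = 0"
    "v \<in> V" "\<exists>w\<in>\<Omega>. peval (\<lambda>v. h v w) (pdiff v Q) \<noteq> 0"
proof -
  define rel where "rel k Q \<longleftrightarrow> Q \<in> polys V \<and> Q \<noteq> 0 \<and> (\<forall>w\<in>\<Omega>. peval (\<lambda>v. h v w) Q = 0)
      \<and> (\<forall>m\<in>Poly_Mapping.keys Q. mdeg m \<le> k)" for k Q
  have "rel (Max (insert 0 (mdeg ` Poly_Mapping.keys P))) P"
    using assms by (auto simp: rel_def)
  then have ex: "\<exists>k Q. rel k Q" by blast
  define k where "k = (LEAST k. \<exists>Q. rel k Q)"
  obtain Q where Q: "rel k Q" using LeastI_ex[OF ex] unfolding k_def by blast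
  have min: "\<not> rel j Q'" if "j < k" for j Q'
    using not_less_Least that unfolding k_def by blast
  have "\<exists>v\<in>V. \<exists>w\<in>\<Omega>. peval (\<lambda>v. h v w) (pdiff v Q) \<noteq> 0"
  proof (rule ccontr)
    assume neg: "\<not> ?thesis"
    have "pdiff v Q = 0" if v: "v \<in> V" for v
    proof (rule ccontr)
      assume nz: "pdiff v Q \<noteq> 0"
      have deg: "mdeg m < k" if "m \<in> Poly_Mapping.keys (pdiff v Q)" for m
        using keys_pdiff[OF that] Q by (auto simp: rel_def mdeg_add dest!: bspec)
      obtain m where "m \<in> Poly_Mapping.keys (pdiff v Q)" using nz by (metis all_not_in_conv keys_eq_empty)
      from deg[OF this] have "k > 0" by simp
      have "rel (k - 1) (pdiff v Q)"
        using Q neg v nz deg by (fastforce simp: rel_def polys_pdiff)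
      with min \<open>k > 0\<close> show False by simp
    qed
    then have "Poly_Mapping.keys Q \<subseteq> {0}" using pdiff_all_zero[of Q V] Q by (simp add: rel_def)
    then have "peval x Q = Poly_Mapping.lookup Q 0" for x
      by (subst peval_superset[of "{0}"]) (auto simp: monom_eval_def)
    moreover have "Poly_Mapping.lookup Q 0 \<noteq> 0"
      using \<open>Poly_Mapping.keys Q \<subseteq> {0}\<close> Q by (metis in_keys_iff keys_eq_empty rel_def subset_singletonD singletonI)
    ultimately show False using Q assms(1) by (auto simp: rel_def)
  qed
  then show thesis using that Q by (auto simp: rel_def)
qed

lemma DERIV_monom_eval:
  fixes a d :: "'v \<Rightarrow> 'a::real_normed_field"
  assumes "finite V" "Poly_Mapping.keys m \<subseteq> V"
  shows "((\<lambda>e. monom_eval (\<lambda>v. a v + e * d v) m) has_field_derivative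
      (\<Sum>v\<in>V. d v * (of_nat (Poly_Mapping.lookup m v) * monom_eval a (m - Poly_Mapping.single v 1)))) (at 0)"
proof -
  have "((\<lambda>e. \<Prod>v\<in>V. (a v + e * d v) ^ Poly_Mapping.lookup m v) has_field_derivative
      (\<Sum>v\<in>V. (of_nat (Poly_Mapping.lookup m v) * ((a v + 0 * d v) ^ (Poly_Mapping.lookup m v - 1) * d v)) *
        (\<Prod>u\<in>V - {v}. (a u + 0 * d u) ^ Poly_Mapping.lookup m u))) (at 0)"
    by (rule has_field_derivative_prod) (auto intro!: derivative_eq_intros)
  also have "(\<Sum>v\<in>V. (of_nat (Poly_Mapping.lookup m v) * ((a v + 0 * d v) ^ (Poly_Mapping.lookup m v - 1) * d v)) *
        (\<Prod>u\<in>V - {v}. (a u + 0 * d u) ^ Poly_Mapping.lookup m u)) =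
      (\<Sum>v\<in>V. d v * (of_nat (Poly_Mapping.lookup m v) * monom_eval a (m - Poly_Mapping.single v 1)))"
  proof (intro sum.cong refl)
    fix v assume v: "v \<in> V"
    have "Poly_Mapping.keys (m - Poly_Mapping.single v 1) \<subseteq> V"
      using assms(2) by (auto simp: in_keys_iff lookup_minus subset_iff)
    then have "monom_eval a (m - Poly_Mapping.single v 1)
        = a v ^ (Poly_Mapping.lookup m v - 1) * (\<Prod>u\<in>V - {v}. a u ^ Poly_Mapping.lookup m u)"
      using v assms(1)
      by (subst monom_eval_superset[of V])
         (auto simp: prod.remove[of V v] lookup_minus lookup_single when_def intro!: prod.cong arg_cong2[where f = "(*)"])
    then show "(of_nat (Poly_Mapping.lookup m v) * ((a v + 0 * d v) ^ (Poly_Mapping.lookup m v - 1) * d v)) *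
        (\<Prod>u\<in>V - {v}. (a u + 0 * d u) ^ Poly_Mapping.lookup m u) =
        d v * (of_nat (Poly_Mapping.lookup m v) * monom_eval a (m - Poly_Mapping.single v 1))"
      by (simp add: mult_ac)
  qed
  finally show ?thesis by (simp add: monom_eval_superset[OF assms])
qed

lemma DERIV_peval:
  fixes a d :: "'v \<Rightarrow> 'a::real_normed_field"
  assumes "finite V" "P \<in> polys V"
  shows "((\<lambda>e. peval (\<lambda>v. a v + e * d v) P) has_field_derivative
      (\<Sum>v\<in>V. d v * peval a (pdiff v P))) (at 0)"
proof -
  let ?L = "Poly_Mapping.lookup"
  have "((\<lambda>e. \<Sum>m\<in>Poly_Mapping.keys P. ?L P m * monom_eval (\<lambda>v. a v + e * d v) m) has_field_derivative
      (\<Sum>m\<in>Poly_Mapping.keys P. ?L P m *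
        (\<Sum>v\<in>V. d v * (of_nat (?L m v) * monom_eval a (m - Poly_Mapping.single v 1))))) (at 0)"
    using assms unfolding polys_def
    by (intro DERIV_sum DERIV_cmult DERIV_monom_eval) auto
  also have "(\<Sum>m\<in>Poly_Mapping.keys P. ?L P m *
        (\<Sum>v\<in>V. d v * (of_nat (?L m v) * monom_eval a (m - Poly_Mapping.single v 1)))) =
      (\<Sum>v\<in>V. d v * peval a (pdiff v P))"
    unfolding pdiff_def peval_sum peval_single sum_distrib_left
    by (subst sum.swap) (simp add: mult_ac)
  finally show ?thesis by (simp add: peval_def)
qed

lemma vanishing_derivative:
  fixes a d :: "'v \<Rightarrow> 'a::real_normed_field"
  assumes "finite V" "P \<in> polys V" "\<And>e. peval (\<lambda>v. a v + e * d v) P = 0"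
  shows "(\<Sum>v\<in>V. d v * peval a (pdiff v P)) = 0"
  using DERIV_unique[OF DERIV_peval[OF assms(1,2), of a d], of 0] assms(3) by simp

text \<open>A polynomial that vanishes everywhere would have a minimal relation with a nonvanishing derivative,
but derivatives of the zero function vanish.\<close>

lemma nonzero_poly_point:
  fixes P :: "('v, 'a::real_normed_field) mpoly"
  assumes "finite V" "P \<in> polys V" "P \<noteq> 0"
  obtains x where "peval x P \<noteq> 0"
proof (rule ccontr)
  assume "\<not> thesis"
  then have z: "peval x P = 0" for x using that by blast
  obtain Q :: "('v, 'a) mpoly" and v where Q: "Q \<in> polys V" "\<And>w. w \<in> UNIV \<Longrightarrow> peval (\<lambda>v. w v) Q = 0"
    and v: "v \<in> V" "\<exists>w\<in>UNIV. peval (\<lambda>v. w v) (pdiff v Q) \<noteq> 0"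
    by (rule minimal_relation[of UNIV P V "\<lambda>v w. w v"]) (use assms(2,3) z in auto)
  then obtain w where w: "peval w (pdiff v Q) \<noteq> 0" by auto
  have "(\<Sum>u\<in>V. (if u = v then 1 else 0) * peval w (pdiff u Q)) = 0"
    by (rule vanishing_derivative) (use assms Q in auto)
  moreover have "(\<Sum>u\<in>V. (if u = v then 1 else 0) * peval w (pdiff u Q)) = peval w (pdiff v Q)"
    using assms(1) v(1) by (simp add: sum.remove[of V v])
  ultimately show False using w by simp
qed

section \<open>Polynomials in given functions and their growth\<close>

definition alg_indep :: "'w set \<Rightarrow> 'i set \<Rightarrow> ('i \<Rightarrow> 'w \<Rightarrow> 'a::comm_ring_1) \<Rightarrow> bool" where
  "alg_indep \<Omega> V h \<longleftrightarrow> (\<forall>P\<in>polys V. P \<noteq> 0 \<longrightarrow> (\<exists>w\<in>\<Omega>. peval (\<lambda>v. h v w) P \<noteq> 0))"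

lemma alg_indepD: "alg_indep \<Omega> V h \<Longrightarrow> P \<in> polys V \<Longrightarrow> P \<noteq> 0 \<Longrightarrow> \<exists>w\<in>\<Omega>. peval (\<lambda>v. h v w) P \<noteq> 0"
  by (simp add: alg_indep_def)

lemma alg_depE:
  assumes "\<not> alg_indep \<Omega> V h"
  obtains P where "P \<in> polys V" "P \<noteq> 0" "\<And>w. w \<in> \<Omega> \<Longrightarrow> peval (\<lambda>v. h v w) P = 0"
  using assms by (auto simp: alg_indep_def)

text \<open>The polynomial expressions of degree at most \<open>k\<close> in the functions of \<open>H\<close>.  Products are built one
generator at a time, which gives inductions a single multiplicative case.\<close>

inductive pdeg :: "('w \<Rightarrow> 'a::comm_ring_1) set \<Rightarrow> nat \<Rightarrow> ('w \<Rightarrow> 'a) \<Rightarrow> bool" for H where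
  const: "pdeg H k (\<lambda>_. a)"
| add: "pdeg H k f \<Longrightarrow> pdeg H k g \<Longrightarrow> pdeg H k (\<lambda>w. f w + g w)"
| gen: "pdeg H k f \<Longrightarrow> h \<in> H \<Longrightarrow> pdeg H (Suc k) (\<lambda>w. h w * f w)"
| lift: "pdeg H k f \<Longrightarrow> pdeg H (Suc k) f"

lemma pdeg_mono: "pdeg H k f \<Longrightarrow> k \<le> k' \<Longrightarrow> pdeg H k' f"
  by (rotate_tac, induction k' rule: dec_induct) (auto intro: pdeg.lift)

lemma pdeg_subset: "pdeg H k f \<Longrightarrow> H \<subseteq> H' \<Longrightarrow> pdeg H' k f"
  by (induction rule: pdeg.induct) (auto intro: pdeg.intros)

lemma pdeg_mem: "h \<in> H \<Longrightarrow> pdeg H (Suc 0) h"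
  using pdeg.gen[OF pdeg.const[of H 0 1], of h] by simp

lemma pdeg_mult: "pdeg H k f \<Longrightarrow> pdeg H k' g \<Longrightarrow> pdeg H (k + k') (\<lambda>w. f w * g w)"
proof (induction rule: pdeg.induct)
  case (const k a)
  have *: "pdeg H j (\<lambda>w. a * g w)" if "pdeg H j g" for j g
    using that
  proof (induction rule: pdeg.induct)
    case (add k f g) then show ?case by (simp add: distrib_left pdeg.add)
  next
    case (gen k f h) then show ?case using pdeg.gen[of H k "\<lambda>w. a * f w" h] by (simp add: mult_ac)
  qed (auto intro: pdeg.intros)
  show ?case using pdeg_mono[OF *[OF const.prems]] by simp
next
  case (add k f g')
  then show ?case by (simp add: distrib_right pdeg.add)
next
  case (gen k f h)
  then show ?case using pdeg.gen[of H "k + k'" "\<lambda>w. f w * g w" h] by (simp add: mult_ac)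
next
  case (lift k f)
  then show ?case by (auto intro: pdeg.lift)
qed

lemma pdeg_power: "pdeg H k f \<Longrightarrow> pdeg H (k * n) (\<lambda>w. f w ^ n)"
  by (induction n) (auto intro: pdeg.const dest: pdeg_mult simp: add.commute)

lemma pdeg_prod:
  "finite J \<Longrightarrow> (\<And>j. j \<in> J \<Longrightarrow> pdeg H (k j) (f j)) \<Longrightarrow> pdeg H (\<Sum>j\<in>J. k j) (\<lambda>w. \<Prod>j\<in>J. f j w)"
  by (induction J rule: finite_induct) (auto intro: pdeg.const pdeg_mult)

lemma fring_pdeg: "function_ring {f. \<exists>k. pdeg H k f}"
proof -
  have "\<exists>k. pdeg H k (\<lambda>w. f w + g w)" if "pdeg H j f" "pdeg H j' g" for f g j j'
    using pdeg.add[OF pdeg_mono[OF that(1), of "j + j'"] pdeg_mono[OF that(2)]] by auto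
  then show ?thesis unfolding function_ring_def by (auto intro: pdeg.const pdeg_mult)
qed

lemma pdeg_peval:
  assumes "P \<in> polys V"
  obtains k where "pdeg (h ` V) k (\<lambda>w. peval (\<lambda>v. h v w) P)"
proof -
  have "(\<lambda>w. peval (\<lambda>v. h v w) P) \<in> {f. \<exists>k. pdeg (h ` V) k f}"
    by (rule fring_peval[OF fring_pdeg assms]) (auto intro: pdeg_mem)
  then show thesis using that by auto
qed

lemma pdeg_fring: "pdeg H k f \<Longrightarrow> function_ring R \<Longrightarrow> H \<subseteq> R \<Longrightarrow> f \<in> R"
  by (induction rule: pdeg.induct) (auto intro: fring_const fring_add fring_mult)

definition lincomb :: "'w set \<Rightarrow> ('w \<Rightarrow> 'a::comm_ring_1) set \<Rightarrow> ('w \<Rightarrow> 'a) \<Rightarrow> bool" where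
  "lincomb \<Omega> E f \<longleftrightarrow> (\<exists>\<alpha>. \<forall>w\<in>\<Omega>. f w = (\<Sum>e\<in>E. \<alpha> e * e w))"

lemma lincomb_zero: "lincomb \<Omega> E (\<lambda>_. 0)"
  unfolding lincomb_def by (rule exI[of _ "\<lambda>_. 0"]) simp

lemma lincomb_add: "lincomb \<Omega> E f \<Longrightarrow> lincomb \<Omega> E g \<Longrightarrow> lincomb \<Omega> E (\<lambda>w. f w + g w)"
proof -
  assume "lincomb \<Omega> E f" "lincomb \<Omega> E g"
  then obtain \<alpha> \<beta> where "\<forall>w\<in>\<Omega>. f w = (\<Sum>e\<in>E. \<alpha> e * e w)" "\<forall>w\<in>\<Omega>. g w = (\<Sum>e\<in>E. \<beta> e * e w)"
    by (auto simp: lincomb_def)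
  then show ?thesis unfolding lincomb_def
    by (intro exI[of _ "\<lambda>e. \<alpha> e + \<beta> e"]) (simp add: distrib_right sum.distrib)
qed

lemma lincomb_scale: "lincomb \<Omega> E f \<Longrightarrow> lincomb \<Omega> E (\<lambda>w. c * f w)"
proof -
  assume "lincomb \<Omega> E f"
  then obtain \<alpha> where "\<forall>w\<in>\<Omega>. f w = (\<Sum>e\<in>E. \<alpha> e * e w)"
    by (auto simp: lincomb_def)
  then show ?thesis unfolding lincomb_def
    by (intro exI[of _ "\<lambda>e. c * \<alpha> e"]) (simp add: sum_distrib_left mult_ac)
qed

lemma lincomb_sum: "(\<And>i. i \<in> A \<Longrightarrow> lincomb \<Omega> E (f i)) \<Longrightarrow> lincomb \<Omega> E (\<lambda>w. \<Sum>i\<in>A. f i w)"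
  by (induction A rule: infinite_finite_induct) (auto intro: lincomb_zero lincomb_add)

lemma lincomb_mem: "finite E \<Longrightarrow> e \<in> E \<Longrightarrow> lincomb \<Omega> E e"
  unfolding lincomb_def
  by (intro exI[of _ "\<lambda>e'. if e' = e then 1 else 0"]) (simp add: sum.remove[of E e])

lemma lincomb_cong: "lincomb \<Omega> E f \<Longrightarrow> (\<And>w. w \<in> \<Omega> \<Longrightarrow> f w = g w) \<Longrightarrow> lincomb \<Omega> E g"
  by (auto simp: lincomb_def)

text \<open>Up to a common denominator \<open>q\<close>, which may depend on \<open>k\<close>, the polynomials of degree at most \<open>k\<close> in \<open>H\<close>
span a space of dimension \<open>O(k\<^sup>r)\<close>.  This bounds the Gelfand-Kirillov dimension, hence the
transcendence degree, by \<open>r\<close>.  Denominators are admitted so that functions algebraic, and not only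
integral, over \<open>H\<close> can be adjoined.\<close>

definition growth :: "'w set \<Rightarrow> ('w \<Rightarrow> 'a::comm_ring_1) set \<Rightarrow> ('w \<Rightarrow> 'a) set \<Rightarrow> nat \<Rightarrow> bool" where
  "growth \<Omega> R H r \<longleftrightarrow> (\<exists>C. \<forall>k\<ge>1. \<exists>q E. q \<in> R \<and> (\<exists>w\<in>\<Omega>. q w \<noteq> 0) \<and> finite E \<and> card E \<le> C * k ^ r \<and>
     (\<forall>f. pdeg H k f \<longrightarrow> lincomb \<Omega> E (\<lambda>w. q w * f w)))"

lemma growth_empty:
  assumes "function_domain \<Omega> R"
  shows "growth \<Omega> R {} 0"
proof -
  have *: "lincomb \<Omega> {\<lambda>_. 1} f" if "pdeg {} k f" for k f
    using that
  proof (induction rule: pdeg.induct)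
    case (const k a)
    then show ?case by (auto simp: lincomb_def)
  qed (auto intro: lincomb_add)
  show ?thesis unfolding growth_def
    by (intro exI[of _ 1] allI impI exI[of _ "\<lambda>_. 1"] exI[of _ "{\<lambda>_. 1}"])
       (use * fdom_ne[OF assms] fring_const[OF fdom_fring[OF assms]] in auto)
qed

text \<open>A polynomial of degree at most \<open>k\<close> in one further function \<open>h\<close> has \<open>k + 1\<close> coefficients with respect
to \<open>h\<close>.\<close>

lemma growth_insert:
  assumes "growth \<Omega> R H r"
  shows "growth \<Omega> R (insert h H) (Suc r)"
proof -
  have nf: "\<exists>g. (\<forall>i\<le>k. pdeg H k (g i)) \<and> f = (\<lambda>w. \<Sum>i\<le>k. g i w * h w ^ i)"
    if "pdeg (insert h H) k f" for k f
    using that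
  proof (induction rule: pdeg.induct)
    case (const k a)
    show ?case
      by (rule exI[of _ "\<lambda>i w. if i = 0 then a else 0"])
         (auto intro: pdeg.const simp: if_distrib[of "\<lambda>x. x * _"] sum.delta cong: if_cong)
  next
    case (add k f f')
    then obtain g g' where "\<forall>i\<le>k. pdeg H k (g i)" "f = (\<lambda>w. \<Sum>i\<le>k. g i w * h w ^ i)"
      "\<forall>i\<le>k. pdeg H k (g' i)" "f' = (\<lambda>w. \<Sum>i\<le>k. g' i w * h w ^ i)" by auto
    then show ?case
      by (intro exI[of _ "\<lambda>i w. g i w + g' i w"]) (auto intro: pdeg.add simp: distrib_right sum.distrib)
  next
    case (gen k f u)
    then obtain g where g: "\<forall>i\<le>k. pdeg H k (g i)" "f = (\<lambda>w. \<Sum>i\<le>k. g i w * h w ^ i)" by auto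
    show ?case
    proof (cases "u = h")
      case True
      define g' where "g' i = (case i of 0 \<Rightarrow> (\<lambda>_. 0) | Suc j \<Rightarrow> g j)" for i
      have "(\<lambda>w. u w * f w) = (\<lambda>w. \<Sum>i\<le>Suc k. g' i w * h w ^ i)"
        unfolding g(2) True sum.atMost_Suc_shift by (simp add: g'_def sum_distrib_left mult_ac)
      moreover have "pdeg H (Suc k) (g' i)" if "i \<le> Suc k" for i
        using that g(1) by (cases i) (auto simp: g'_def intro: pdeg.const pdeg.lift)
      ultimately show ?thesis by blast
    next
      case False
      then have u: "u \<in> H" using gen by auto
      define g' where "g' i = (if i \<le> k then (\<lambda>w. u w * g i w) else (\<lambda>_. 0))" for i
      have "(\<lambda>w. u w * f w) = (\<lambda>w. \<Sum>i\<le>Suc k. g' i w * h w ^ i)"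
        unfolding g(2) by (simp add: g'_def sum_distrib_left mult_ac)
      moreover have "pdeg H (Suc k) (g' i)" for i
        using u g(1) by (auto simp: g'_def intro: pdeg.const pdeg.gen)
      ultimately show ?thesis by blast
    qed
  next
    case (lift k f)
    then obtain g where g: "\<forall>i\<le>k. pdeg H k (g i)" "f = (\<lambda>w. \<Sum>i\<le>k. g i w * h w ^ i)" by auto
    define g' where "g' i = (if i \<le> k then g i else (\<lambda>_. 0))" for i
    have "(\<forall>i\<le>Suc k. pdeg H (Suc k) (g' i)) \<and> f = (\<lambda>w. \<Sum>i\<le>Suc k. g' i w * h w ^ i)"
      unfolding g(2) using g(1) by (auto simp: g'_def intro: pdeg.const pdeg.lift)
    then show ?case by blast
  qed
  obtain C where C: "\<And>k. k \<ge> 1 \<Longrightarrow> \<exists>q E. q \<in> R \<and> (\<exists>w\<in>\<Omega>. q w \<noteq> 0) \<and> finite E \<and> card E \<le> C * k ^ r \<and>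
     (\<forall>f. pdeg H k f \<longrightarrow> lincomb \<Omega> E (\<lambda>w. q w * f w))"
    using assms unfolding growth_def by blast
  show ?thesis unfolding growth_def
  proof (intro exI[of _ "2 * C"] allI impI)
    fix k :: nat assume k: "k \<ge> 1"
    obtain q E where q: "q \<in> R" "\<exists>w\<in>\<Omega>. q w \<noteq> 0" and E: "finite E" "card E \<le> C * k ^ r"
      and qE: "\<And>f. pdeg H k f \<Longrightarrow> lincomb \<Omega> E (\<lambda>w. q w * f w)"
      using C[OF k] by blast
    let ?E = "(\<lambda>(i, e) w. e w * h w ^ i) ` ({..k} \<times> E)"
    have "card ?E \<le> card ({..k} \<times> E)" by (rule card_image_le) (use E in auto)
    also have "\<dots> \<le> Suc k * (C * k ^ r)"
      using mult_le_mono2[OF E(2), of "Suc k"] by (simp add: card_cartesian_product)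
    also have "\<dots> \<le> (2 * k) * (C * k ^ r)" by (rule mult_right_mono) (use k in auto)
    finally have card: "card ?E \<le> 2 * C * k ^ Suc r" by (simp add: mult_ac)
    have "lincomb \<Omega> ?E (\<lambda>w. q w * f w)" if f: "pdeg (insert h H) k f" for f
    proof -
      obtain g where g: "\<forall>i\<le>k. pdeg H k (g i)" "f = (\<lambda>w. \<Sum>i\<le>k. g i w * h w ^ i)"
        using nf[OF f] by blast
      have "lincomb \<Omega> ?E (\<lambda>w. q w * g i w * h w ^ i)" if i: "i \<le> k" for i
      proof -
        obtain \<alpha> where \<alpha>: "\<forall>w\<in>\<Omega>. q w * g i w = (\<Sum>e\<in>E. \<alpha> e * e w)"
          using qE[of "g i"] g(1) i by (auto simp: lincomb_def)
        have "lincomb \<Omega> ?E (\<lambda>w. \<Sum>e\<in>E. \<alpha> e * (e w * h w ^ i))"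
        proof (rule lincomb_sum, rule lincomb_scale, rule lincomb_mem)
          show "finite ?E" using E by auto
        next
          fix e assume "e \<in> E"
          then show "(\<lambda>w. e w * h w ^ i) \<in> ?E"
            using i by (intro image_eqI[of _ _ "(i, e)"]) auto
        qed
        then show ?thesis
          by (rule lincomb_cong) (use \<alpha> in \<open>auto simp: sum_distrib_left sum_distrib_right mult_ac\<close>)
      qed
      then have "lincomb \<Omega> ?E (\<lambda>w. \<Sum>i\<le>k. q w * g i w * h w ^ i)"
        by (intro lincomb_sum) auto
      then show ?thesis by (simp add: g(2) sum_distrib_left mult_ac)
    qed
    then show "\<exists>q E. q \<in> R \<and> (\<exists>w\<in>\<Omega>. q w \<noteq> 0) \<and> finite E \<and> card E \<le> 2 * C * k ^ Suc r \<and>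
       (\<forall>f. pdeg (insert h H) k f \<longrightarrow> lincomb \<Omega> E (\<lambda>w. q w * f w))"
      using q E card by (intro exI[of _ q] exI[of _ ?E]) auto
  qed
qed

text \<open>Each multiplication by \<open>h\<close> can be followed by a reduction modulo the equation of \<open>h\<close> at the cost of one
factor \<open>q\<close>.  So \<open>q\<^sup>k\<close> times a polynomial of degree at most \<open>k\<close> has only \<open>e\<close> coefficients with respect to
\<open>h\<close>, of degree at most \<open>(D + 1) k\<close> in \<open>H\<close>; the factor \<open>(D + 1)\<^sup>r\<close> is absorbed in the constant.\<close>

lemma growth_insert_algebraic:
  assumes dom: "function_domain \<Omega> R" and gr: "growth \<Omega> R H r" and e: "e \<ge> 1"
    and q: "q \<in> R" "\<exists>w\<in>\<Omega>. q w \<noteq> 0" "pdeg H D q" and a: "\<And>i. i < e \<Longrightarrow> pdeg H D (a i)"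
    and rel: "\<And>w. w \<in> \<Omega> \<Longrightarrow> q w * h w ^ e = (\<Sum>i<e. a i w * h w ^ i)"
  shows "growth \<Omega> R (insert h H) r"
proof -
  have nf: "\<exists>b. (\<forall>i<e. pdeg H (Suc D * k) (b i)) \<and> (\<forall>w\<in>\<Omega>. q w ^ k * f w = (\<Sum>i<e. b i w * h w ^ i))"
    if "pdeg (insert h H) k f" for k f
    using that
  proof (induction rule: pdeg.induct)
    case (const k c)
    have "pdeg H (Suc D * k) (\<lambda>w. q w ^ k * c)"
      using pdeg_mono[OF pdeg_mult[OF pdeg_power[OF q(3), of k] pdeg.const[of H 0 c]]] by simp
    then have "pdeg H (Suc D * k) (\<lambda>w. if i = 0 then q w ^ k * c else 0)" for i :: nat
      by (cases "i = 0") (auto intro: pdeg.const)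
    then show ?case using e
      by (intro exI[of _ "\<lambda>i w. if i = 0 then q w ^ k * c else 0"])
         (auto simp: if_distrib[of "\<lambda>x. x * _"] sum.delta cong: if_cong)
  next
    case (add k f f')
    then obtain b b' where "\<forall>i<e. pdeg H (Suc D * k) (b i)" "\<forall>w\<in>\<Omega>. q w ^ k * f w = (\<Sum>i<e. b i w * h w ^ i)"
      "\<forall>i<e. pdeg H (Suc D * k) (b' i)" "\<forall>w\<in>\<Omega>. q w ^ k * f' w = (\<Sum>i<e. b' i w * h w ^ i)" by blast
    then show ?case
      by (intro exI[of _ "\<lambda>i w. b i w + b' i w"])
         (auto intro: pdeg.add simp: distrib_right distrib_left sum.distrib)
  next
    case (gen k f u)
    then obtain b where b: "\<forall>i<e. pdeg H (Suc D * k) (b i)"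
      "\<forall>w\<in>\<Omega>. q w ^ k * f w = (\<Sum>i<e. b i w * h w ^ i)" by blast
    show ?case
    proof (cases "u = h")
      case True
      define b' where "b' i w = (if i = 0 then 0 else q w * b (i - 1) w) + b (e - 1) w * a i w" for i w
      have "pdeg H (Suc D * Suc k) (b' i)" if i: "i < e" for i
      proof -
        have "pdeg H (D + Suc D * k) (\<lambda>w. if i = 0 then 0 else q w * b (i - 1) w)"
          using b(1) i by (cases "i = 0") (auto intro!: pdeg.const pdeg_mult[OF q(3)])
        moreover have "pdeg H (Suc D * k + D) (\<lambda>w. b (e - 1) w * a i w)"
          by (rule pdeg_mult) (use b a i e in auto)
        ultimately have "pdeg H (D + Suc D * k) (b' i)"
          using pdeg.add unfolding b'_def by (fastforce simp: add.commute)
        then show ?thesis by (rule pdeg_mono) simp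
      qed
      moreover have "q w ^ Suc k * (u w * f w) = (\<Sum>i<e. b' i w * h w ^ i)" if w: "w \<in> \<Omega>" for w
      proof -
        obtain n where n: "e = Suc n" using e by (cases e) auto
        have "q w ^ Suc k * (u w * f w) = q w * h w * (q w ^ k * f w)" by (simp add: True mult_ac)
        also have "\<dots> = q w * h w * (\<Sum>i<e. b i w * h w ^ i)" using b(2) w by simp
        also have "\<dots> = (\<Sum>i<n. q w * b i w * h w ^ Suc i) + b n w * (q w * h w ^ e)"
          by (simp add: n sum_distrib_left mult_ac distrib_left)
        also have "q w * h w ^ e = (\<Sum>i<e. a i w * h w ^ i)" using rel w by simp
        also have "(\<Sum>i<n. q w * b i w * h w ^ Suc i) = (\<Sum>i<e. (if i = 0 then 0 else q w * b (i - 1) w) * h w ^ i)"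
          unfolding n sum.lessThan_Suc_shift by simp
        finally show ?thesis
          using n by (simp add: b'_def distrib_left distrib_right sum.distrib sum_distrib_left mult_ac del: sum.lessThan_Suc)
      qed
      ultimately show ?thesis by blast
    next
      case False
      then have u: "u \<in> H" using gen by auto
      have "pdeg H (Suc D * Suc k) (\<lambda>w. u w * (q w * b i w))" if "i < e" for i
        using pdeg.gen[OF pdeg_mult[OF q(3)] u, of "Suc D * k" "b i"] b(1) that by (simp add: add_ac)
      moreover have "q w ^ Suc k * (u w * f w) = (\<Sum>i<e. u w * (q w * b i w) * h w ^ i)" if "w \<in> \<Omega>" for w
      proof -
        have "q w ^ Suc k * (u w * f w) = u w * q w * (q w ^ k * f w)" by (simp add: mult_ac)
        also have "\<dots> = u w * q w * (\<Sum>i<e. b i w * h w ^ i)" using b(2) that by simp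
        finally show ?thesis by (simp add: sum_distrib_left mult_ac)
      qed
      ultimately show ?thesis by (intro exI[of _ "\<lambda>i w. u w * (q w * b i w)"]) blast
    qed
  next
    case (lift k f)
    then obtain b where b: "\<forall>i<e. pdeg H (Suc D * k) (b i)"
      "\<forall>w\<in>\<Omega>. q w ^ k * f w = (\<Sum>i<e. b i w * h w ^ i)" by blast
    have "pdeg H (Suc D * Suc k) (\<lambda>w. q w * b i w)" if "i < e" for i
      using pdeg_mono[OF pdeg_mult[OF q(3)], of "Suc D * k" "b i"] b(1) that by simp
    moreover have "q w ^ Suc k * f w = (\<Sum>i<e. (q w * b i w) * h w ^ i)" if "w \<in> \<Omega>" for w
    proof -
      have "q w ^ Suc k * f w = q w * (q w ^ k * f w)" by (simp add: mult_ac)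
      also have "\<dots> = q w * (\<Sum>i<e. b i w * h w ^ i)" using b(2) that by simp
      finally show ?thesis by (simp add: sum_distrib_left mult_ac)
    qed
    ultimately show ?case by (intro exI[of _ "\<lambda>i w. q w * b i w"]) blast
  qed
  obtain C where C: "\<And>k. k \<ge> 1 \<Longrightarrow> \<exists>q E. q \<in> R \<and> (\<exists>w\<in>\<Omega>. q w \<noteq> 0) \<and> finite E \<and> card E \<le> C * k ^ r \<and>
     (\<forall>f. pdeg H k f \<longrightarrow> lincomb \<Omega> E (\<lambda>w. q w * f w))"
    using gr unfolding growth_def by blast
  show ?thesis unfolding growth_def
  proof (intro exI[of _ "e * C * Suc D ^ r"] allI impI)
    fix k :: nat assume k: "k \<ge> 1"
    obtain q' E where q': "q' \<in> R" "\<exists>w\<in>\<Omega>. q' w \<noteq> 0" and E: "finite E" "card E \<le> C * (Suc D * k) ^ r"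
      and qE: "\<And>f. pdeg H (Suc D * k) f \<Longrightarrow> lincomb \<Omega> E (\<lambda>w. q' w * f w)"
      using C[of "Suc D * k"] k by auto
    let ?E = "(\<lambda>(i, e) w. e w * h w ^ i) ` ({..<e} \<times> E)"
    have "card ?E \<le> card ({..<e} \<times> E)" by (rule card_image_le) (use E in auto)
    also have "\<dots> \<le> e * (C * (Suc D * k) ^ r)" using E by (simp add: card_cartesian_product)
    finally have card: "card ?E \<le> e * C * Suc D ^ r * k ^ r" by (simp only: power_mult_distrib mult_ac)
    have "lincomb \<Omega> ?E (\<lambda>w. (q' w * q w ^ k) * f w)" if f: "pdeg (insert h H) k f" for f
    proof -
      obtain b where b: "\<forall>i<e. pdeg H (Suc D * k) (b i)" "\<forall>w\<in>\<Omega>. q w ^ k * f w = (\<Sum>i<e. b i w * h w ^ i)"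
        using nf[OF f] by blast
      have "lincomb \<Omega> ?E (\<lambda>w. q' w * b i w * h w ^ i)" if i: "i < e" for i
      proof -
        obtain \<alpha> where \<alpha>: "\<forall>w\<in>\<Omega>. q' w * b i w = (\<Sum>e\<in>E. \<alpha> e * e w)"
          using qE[of "b i"] b(1) i by (auto simp: lincomb_def)
        have "lincomb \<Omega> ?E (\<lambda>w. \<Sum>e\<in>E. \<alpha> e * (e w * h w ^ i))"
        proof (rule lincomb_sum, rule lincomb_scale, rule lincomb_mem)
          show "finite ?E" using E by auto
        next
          fix e' assume "e' \<in> E"
          then show "(\<lambda>w. e' w * h w ^ i) \<in> ?E"
            using i by (intro image_eqI[of _ _ "(i, e')"]) auto
        qed
        then show ?thesis
          by (rule lincomb_cong) (use \<alpha> in \<open>auto simp: sum_distrib_left sum_distrib_right mult_ac\<close>)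
      qed
      then have "lincomb \<Omega> ?E (\<lambda>w. \<Sum>i<e. q' w * b i w * h w ^ i)"
        by (intro lincomb_sum) auto
      then show ?thesis
        by (rule lincomb_cong) (use b(2) in \<open>simp add: mult.assoc sum_distrib_left[symmetric]\<close>)
    qed
    moreover have "(\<lambda>w. q' w * q w ^ k) \<in> R"
      using q q' fdom_fring[OF dom] by (intro fring_mult fring_power)
    moreover have "\<exists>w\<in>\<Omega>. q' w * q w ^ k \<noteq> 0"
      using fdom_both[OF dom q'(1) _ q'(2) fdom_power_nonzero[OF q(2)]] fring_power[OF fdom_fring[OF dom] q(1)]
      by fastforce
    ultimately show "\<exists>q E. q \<in> R \<and> (\<exists>w\<in>\<Omega>. q w \<noteq> 0) \<and> finite E \<and> card E \<le> e * C * Suc D ^ r * k ^ r \<and>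
       (\<forall>f. pdeg (insert h H) k f \<longrightarrow> lincomb \<Omega> E (\<lambda>w. q w * f w))"
      using E card by (intro exI[of _ "\<lambda>w. q' w * q w ^ k"] exI[of _ ?E]) auto
  qed
qed

section \<open>Independent functions and order of growth\<close>

lemma growth_insert_rational:
  assumes "function_domain \<Omega> R" "growth \<Omega> R H r"
    and "q \<in> R" "\<exists>w\<in>\<Omega>. q w \<noteq> 0" "pdeg H D q" "pdeg H D a"
    and "\<And>w. w \<in> \<Omega> \<Longrightarrow> q w * h w = a w"
  shows "growth \<Omega> R (insert h H) r"
  by (rule growth_insert_algebraic[where e = 1 and q = q and D = D and a = "\<lambda>_. a"])
     (use assms in auto)

text \<open>A homogeneous linear system with more unknowns than equations has a nonzero solution, by elimination
of one equation and one unknown at a time.\<close>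

lemma homogeneous_system:
  fixes a :: "'g \<Rightarrow> 'e \<Rightarrow> 'a::field"
  assumes "finite E" "finite G" "card E < card G"
  obtains l where "\<exists>g\<in>G. l g \<noteq> 0" "\<And>e. e \<in> E \<Longrightarrow> (\<Sum>g\<in>G. l g * a g e) = 0"
proof -
  have "\<exists>l. (\<exists>g\<in>G. l g \<noteq> 0) \<and> (\<forall>e\<in>E. (\<Sum>g\<in>G. l g * a g e) = 0)"
    using assms
  proof (induction E arbitrary: G a rule: finite_induct)
    case empty
    then have "\<exists>g. g \<in> G" by (metis card.empty less_numeral_extra(3) all_not_in_conv)
    then show ?case by (intro exI[of _ "\<lambda>_. 1"]) auto
  next
    case (insert x E)
    show ?case
    proof (cases "\<forall>g\<in>G. a g x = 0")
      case True
      have "card E < card G" using insert by simp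
      from insert.IH[OF insert.prems(1) this, of a] show ?thesis using True by auto
    next
      case False
      then obtain g0 where g0: "g0 \<in> G" "a g0 x \<noteq> 0" by blast
      define a' where "a' g e = a g e - a g x / a g0 x * a g0 e" for g e
      have "card E < card (G - {g0})" using insert g0 by simp
      from insert.IH[OF _ this, of a'] insert.prems(1)
      obtain l where l: "\<exists>g\<in>G - {g0}. l g \<noteq> 0" "\<forall>e\<in>E. (\<Sum>g\<in>G - {g0}. l g * a' g e) = 0"
        by auto
      define l' where "l' g = (if g = g0 then - (\<Sum>g\<in>G - {g0}. l g * (a g x / a g0 x)) else l g)" for g
      have eq: "(\<Sum>g\<in>G. l' g * a g e) = (\<Sum>g\<in>G - {g0}. l g * a' g e)" for e
      proof -
        have "(\<Sum>g\<in>G. l' g * a g e) = l' g0 * a g0 e + (\<Sum>g\<in>G - {g0}. l g * a g e)"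
          using insert.prems(1) g0 by (subst sum.remove[of G g0]) (auto simp: l'_def intro!: sum.cong)
        also have "l' g0 * a g0 e = - (\<Sum>g\<in>G - {g0}. l g * (a g x / a g0 x * a g0 e))"
          by (simp add: l'_def sum_distrib_right mult.assoc)
        finally show ?thesis by (simp add: a'_def right_diff_distrib sum_subtractf)
      qed
      have "a' g x = 0" for g using g0 by (simp add: a'_def)
      then have "\<forall>e\<in>insert x E. (\<Sum>g\<in>G. l' g * a g e) = 0" using l(2) by (auto simp: eq)
      moreover have "\<exists>g\<in>G. l' g \<noteq> 0" using l(1) by (auto simp: l'_def)
      ultimately show ?thesis by blast
    qed
  qed
  then show thesis using that by blast
qed

text \<open>The number of monomials in the \<open>g\<^sub>j\<close> with all exponents at most \<open>\<rho>\<close> is \<open>(\<rho> + 1)\<close> to the power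
\<open>card J\<close>, while they lie in a space of dimension \<open>O(\<rho>\<^sup>r)\<close>.  If \<open>card J > r\<close>, they are linearly
dependent for large \<open>\<rho>\<close>, and a linear dependence is a polynomial relation.\<close>

lemma alg_indep_le_growth:
  fixes g :: "'j \<Rightarrow> 'w \<Rightarrow> 'a::field"
  assumes dom: "function_domain \<Omega> R" and gr: "growth \<Omega> R H r" and H: "H \<subseteq> R" and J: "finite J"
    and g: "\<And>j. j \<in> J \<Longrightarrow> \<exists>k. pdeg H k (g j)" and ind: "alg_indep \<Omega> J g"
  shows "card J \<le> r"
proof (rule ccontr)
  assume "\<not> ?thesis"
  then have r: "Suc r \<le> card J" by simp
  obtain k where k: "\<And>j. j \<in> J \<Longrightarrow> pdeg H (k j) (g j)" using g by metis
  define \<delta> where "\<delta> = Suc (\<Sum>j\<in>J. k j)"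
  obtain C where C: "\<And>k. k \<ge> 1 \<Longrightarrow> \<exists>q E. q \<in> R \<and> (\<exists>w\<in>\<Omega>. q w \<noteq> 0) \<and> finite E \<and> card E \<le> C * k ^ r \<and>
     (\<forall>f. pdeg H k f \<longrightarrow> lincomb \<Omega> E (\<lambda>w. q w * f w))"
    using gr unfolding growth_def by blast
  \<comment> \<open>large enough for \<open>C (\<delta> \<rho>)\<^sup>r < (\<rho> + 1)\<^sup>r\<^sup>+\<^sup>1\<close>\<close>
  define \<rho> where "\<rho> = Suc (C * \<delta> ^ r)"
  obtain q E where q: "q \<in> R" "\<exists>w\<in>\<Omega>. q w \<noteq> 0" and E: "finite E" "card E \<le> C * (\<delta> * \<rho>) ^ r"
    and qE: "\<And>f. pdeg H (\<delta> * \<rho>) f \<Longrightarrow> lincomb \<Omega> E (\<lambda>w. q w * f w)"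
    using C[of "\<delta> * \<rho>"] by (auto simp: \<delta>_def \<rho>_def)
  define G where "G = (J \<rightarrow>\<^sub>E {..\<rho>})"
  have fin: "finite G" using J by (auto simp: G_def intro: finite_PiE)
  have "card E \<le> C * \<delta> ^ r * \<rho> ^ r" using E by (simp add: power_mult_distrib mult_ac)
  also have "\<dots> < Suc \<rho> * Suc \<rho> ^ r"
    by (rule mult_less_le_imp_less) (auto simp: \<rho>_def intro!: power_mono)
  also have "\<dots> = Suc \<rho> ^ Suc r" by simp
  also have "\<dots> \<le> Suc \<rho> ^ card J" using r by (intro power_increasing) auto
  also have "\<dots> = card G" using J by (simp add: G_def card_PiE)
  finally have card: "card E < card G" .
  define mon where "mon \<gamma> = (\<Sum>j\<in>J. Poly_Mapping.single j (\<gamma> j))" for \<gamma> :: "'j \<Rightarrow> nat"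
  have lookup_mon: "Poly_Mapping.lookup (mon \<gamma>) j = (if j \<in> J then \<gamma> j else 0)" for \<gamma> j
    unfolding mon_def lookup_sum lookup_single when_def using J by (simp add: sum.delta')
  have keys_mon: "Poly_Mapping.keys (mon \<gamma>) \<subseteq> J" for \<gamma>
    by (auto simp: in_keys_iff lookup_mon split: if_splits)
  have inj: "inj_on mon G"
  proof (rule inj_onI)
    fix \<gamma> \<gamma>' assume *: "\<gamma> \<in> G" "\<gamma>' \<in> G" "mon \<gamma> = mon \<gamma>'"
    then have "\<gamma> j = \<gamma>' j" if "j \<in> J" for j using lookup_mon[of \<gamma> j] lookup_mon[of \<gamma>' j] that by simp
    then show "\<gamma> = \<gamma>'" using * unfolding G_def by (intro PiE_ext) auto
  qed
  have val: "monom_eval (\<lambda>j. g j w) (mon \<gamma>) = (\<Prod>j\<in>J. g j w ^ \<gamma> j)" for \<gamma> w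
    by (simp add: monom_eval_superset[OF J keys_mon] lookup_mon)
  have "pdeg H (\<delta> * \<rho>) (\<lambda>w. monom_eval (\<lambda>j. g j w) (mon \<gamma>))" if \<gamma>: "\<gamma> \<in> G" for \<gamma>
  proof -
    have "pdeg H (\<Sum>j\<in>J. k j * \<gamma> j) (\<lambda>w. \<Prod>j\<in>J. g j w ^ \<gamma> j)"
      by (rule pdeg_prod[OF J]) (auto intro: pdeg_power k)
    moreover have "(\<Sum>j\<in>J. k j * \<gamma> j) \<le> \<delta> * \<rho>"
    proof -
      have "(\<Sum>j\<in>J. k j * \<gamma> j) \<le> (\<Sum>j\<in>J. k j * \<rho>)"
        using \<gamma> by (intro sum_mono mult_left_mono) (auto simp: G_def PiE_iff)
      also have "\<dots> \<le> \<delta> * \<rho>" by (simp add: \<delta>_def sum_distrib_right)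
      finally show ?thesis .
    qed
    ultimately show ?thesis unfolding val by (rule pdeg_mono)
  qed
  then have "\<forall>\<gamma>\<in>G. \<exists>\<alpha>. \<forall>w\<in>\<Omega>. q w * monom_eval (\<lambda>j. g j w) (mon \<gamma>) = (\<Sum>e\<in>E. \<alpha> e * e w)"
    using qE unfolding lincomb_def by blast
  then obtain \<alpha> where \<alpha>: "\<And>\<gamma> w. \<gamma> \<in> G \<Longrightarrow> w \<in> \<Omega> \<Longrightarrow>
      q w * monom_eval (\<lambda>j. g j w) (mon \<gamma>) = (\<Sum>e\<in>E. \<alpha> \<gamma> e * e w)"
    using bchoice[of G "\<lambda>\<gamma> \<alpha>. \<forall>w\<in>\<Omega>. q w * monom_eval (\<lambda>j. g j w) (mon \<gamma>) = (\<Sum>e\<in>E. \<alpha> e * e w)"]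
    by blast
  obtain l where l: "\<exists>\<gamma>\<in>G. l \<gamma> \<noteq> 0" "\<And>e. e \<in> E \<Longrightarrow> (\<Sum>\<gamma>\<in>G. l \<gamma> * \<alpha> \<gamma> e) = 0"
    by (rule homogeneous_system[OF E(1) fin card]) (rule that)
  define P where "P = (\<Sum>\<gamma>\<in>G. Poly_Mapping.single (mon \<gamma>) (l \<gamma>))"
  have "P \<in> polys J" unfolding P_def using keys_mon by (intro polys_sum polys_single) auto
  moreover have "P \<noteq> 0"
  proof -
    obtain \<gamma> where \<gamma>: "\<gamma> \<in> G" "l \<gamma> \<noteq> 0" using l by blast
    have "Poly_Mapping.lookup P (mon \<gamma>) = (\<Sum>\<gamma>'\<in>G. if \<gamma>' = \<gamma> then l \<gamma>' else 0)"
      unfolding P_def lookup_sum lookup_single when_def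
      by (intro sum.cong refl) (use inj \<gamma> in \<open>auto dest: inj_onD\<close>)
    then have "Poly_Mapping.lookup P (mon \<gamma>) = l \<gamma>" using fin \<gamma> by simp
    then show ?thesis using \<gamma> by auto
  qed
  ultimately obtain w where w: "w \<in> \<Omega>" "peval (\<lambda>j. g j w) P \<noteq> 0"
    using alg_indepD[OF ind] by blast
  have "peval (\<lambda>j. g j w') P = 0" if "w' \<in> \<Omega>" for w'
  proof (rule fdom_cancel[OF dom q(1) _ q(2) _ that])
    have "g j \<in> R" if "j \<in> J" for j using pdeg_fring[OF k[OF that] fdom_fring[OF dom] H] .
    then show "(\<lambda>w. peval (\<lambda>j. g j w) P) \<in> R"
      using fring_peval[OF fdom_fring[OF dom] \<open>P \<in> polys J\<close>] by blast
  next
    fix w assume "w \<in> \<Omega>"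
    then have "q w * peval (\<lambda>j. g j w) P = (\<Sum>\<gamma>\<in>G. l \<gamma> * (\<Sum>e\<in>E. \<alpha> \<gamma> e * e w))"
      unfolding P_def peval_sum peval_single sum_distrib_left[of "q w"]
      by (intro sum.cong refl) (subst \<alpha>[symmetric]; simp add: mult_ac)
    also have "\<dots> = (\<Sum>e\<in>E. (\<Sum>\<gamma>\<in>G. l \<gamma> * \<alpha> \<gamma> e) * e w)"
      unfolding sum_distrib_left sum_distrib_right by (subst sum.swap) (simp add: mult_ac)
    also have "\<dots> = 0" using l(2) by simp
    finally show "q w * peval (\<lambda>j. g j w) P = 0" .
  qed
  with w show False by blast
qed

lemma poly_coeffs:
  assumes P: "P \<in> polys (insert k V)"
  obtains D p where "\<And>i. p i \<in> polys V" "\<And>a. peval a P = (\<Sum>i\<le>D. peval a (p i) * a k ^ i)"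
proof -
  let ?K = "Poly_Mapping.keys P"
  let ?l = "\<lambda>m. Poly_Mapping.lookup m k"
  let ?r = "\<lambda>m. m - Poly_Mapping.single k (?l m)"
  define D where "D = Max (insert 0 (?l ` ?K))"
  define p where "p i = (\<Sum>m\<in>{m \<in> ?K. ?l m = i}. Poly_Mapping.single (?r m) (Poly_Mapping.lookup P m))" for i
  have dec: "?r m + Poly_Mapping.single k (?l m) = m" for m :: "'a \<Rightarrow>\<^sub>0 nat"
    by (rule poly_mapping_eqI) (auto simp: lookup_add lookup_minus lookup_single when_def)
  have "Poly_Mapping.keys (?r m) \<subseteq> V" if "m \<in> ?K" for m
  proof -
    have "Poly_Mapping.keys m \<subseteq> insert k V" using P that unfolding polys_def by blast
    then show ?thesis
      by (auto simp: in_keys_iff lookup_minus lookup_single when_def subset_iff split: if_splits)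
  qed
  then have "p i \<in> polys V" for i unfolding p_def by (intro polys_sum polys_single) auto
  moreover have "peval a P = (\<Sum>i\<le>D. peval a (p i) * a k ^ i)" for a
  proof -
    have me: "monom_eval a m = monom_eval a (?r m) * a k ^ ?l m" for m
      by (subst dec[of m, symmetric], subst monom_eval_add) (simp add: monom_eval_single)
    have "peval a P = (\<Sum>m\<in>?K. Poly_Mapping.lookup P m * monom_eval a (?r m) * a k ^ ?l m)"
      unfolding peval_def by (subst me) (simp add: mult_ac)
    also have "\<dots> = (\<Sum>i\<le>D. \<Sum>m\<in>{m \<in> ?K. ?l m = i}. Poly_Mapping.lookup P m * monom_eval a (?r m) * a k ^ ?l m)"
      by (rule sum.group[symmetric]) (auto simp: D_def)
    also have "\<dots> = (\<Sum>i\<le>D. peval a (p i) * a k ^ i)"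
      unfolding p_def peval_sum peval_single sum_distrib_right by (intro sum.cong refl) auto
    finally show ?thesis .
  qed
  ultimately show thesis using that by blast
qed

lemma poly_coeffs_nonzero:
  fixes P :: "('v, 'a::real_normed_field) mpoly"
  assumes P: "P \<in> polys (insert k V)" "P \<noteq> 0" and V: "finite V"
  obtains D p j where "\<And>i. p i \<in> polys V" "\<And>a. peval a P = (\<Sum>i\<le>D. peval a (p i) * a k ^ i)"
    "j \<le> D" "p j \<noteq> 0"
proof -
  obtain D p where p: "\<And>i. p i \<in> polys V" "\<And>a. peval a P = (\<Sum>i\<le>D. peval a (p i) * a k ^ i)"
    by (rule poly_coeffs[OF P(1)]) (rule that)
  have "\<exists>j\<le>D. p j \<noteq> 0"
  proof (rule ccontr)
    assume "\<not> ?thesis"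
    then have "peval a P = 0" for a using p(2)[of a] by simp
    then show False using nonzero_poly_point[of "insert k V" P] P V by blast
  qed
  then show thesis using that p by blast
qed

text \<open>Coefficients that vanish on \<open>\<Omega>\<close> are dropped from the top.  The remaining relation is not a constant,
since its leading coefficient does not vanish.\<close>

lemma truncate_relation:
  fixes c :: "nat \<Rightarrow> 'w \<Rightarrow> 'a::field"
  assumes "\<And>w. w \<in> \<Omega> \<Longrightarrow> (\<Sum>i\<le>D. c i w * h w ^ i) = 0" "j \<le> D" "\<exists>w\<in>\<Omega>. c j w \<noteq> 0"
  obtains e where "1 \<le> e" "e \<le> D" "\<exists>w\<in>\<Omega>. c e w \<noteq> 0" "\<And>w. w \<in> \<Omega> \<Longrightarrow> (\<Sum>i\<le>e. c i w * h w ^ i) = 0"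
proof -
  define e where "e = Max {i. i \<le> D \<and> (\<exists>w\<in>\<Omega>. c i w \<noteq> 0)}"
  have fin: "finite {i. i \<le> D \<and> (\<exists>w\<in>\<Omega>. c i w \<noteq> 0)}" by simp
  have "e \<in> {i. i \<le> D \<and> (\<exists>w\<in>\<Omega>. c i w \<noteq> 0)}"
    unfolding e_def using assms(2,3) by (intro Max_in fin) blast
  then have e: "e \<le> D" "\<exists>w\<in>\<Omega>. c e w \<noteq> 0" by auto
  have z: "c i w = 0" if "e < i" "i \<le> D" "w \<in> \<Omega>" for i w
    using Max_ge[OF fin, of i] that unfolding e_def[symmetric] by force
  have rel: "(\<Sum>i\<le>e. c i w * h w ^ i) = 0" if "w \<in> \<Omega>" for w
  proof -
    have "(\<Sum>i\<le>e. c i w * h w ^ i) = (\<Sum>i\<le>D. c i w * h w ^ i)"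
      by (rule sum.mono_neutral_left) (use e z that in auto)
    then show ?thesis using assms(1) that by simp
  qed
  have "e \<noteq> 0"
  proof
    assume "e = 0"
    with rel have "c e w = 0" if "w \<in> \<Omega>" for w using that by fastforce
    with e(2) show False by blast
  qed
  then show thesis by (intro that[OF _ e rel]) simp_all
qed

lemma growth_insert_relation:
  fixes c :: "nat \<Rightarrow> 'w \<Rightarrow> 'a::field"
  assumes dom: "function_domain \<Omega> R" and gr: "growth \<Omega> R H r" and H: "H \<subseteq> R"
    and c: "\<And>i. \<exists>k. pdeg H k (c i)" and rel: "\<And>w. w \<in> \<Omega> \<Longrightarrow> (\<Sum>i\<le>e. c i w * h w ^ i) = 0"
    and e: "e \<ge> 1" "\<exists>w\<in>\<Omega>. c e w \<noteq> 0"
  shows "growth \<Omega> R (insert h H) r"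
proof -
  obtain k where k: "\<And>i. pdeg H (k i) (c i)" using c by metis
  define D where "D = (\<Sum>i\<le>e. k i)"
  have kD: "k i \<le> D" if "i \<le> e" for i
    unfolding D_def using that by (intro member_le_sum) auto
  have cD: "pdeg H D (c i)" if "i \<le> e" for i using pdeg_mono[OF k kD[OF that]] .
  show ?thesis
  proof (rule growth_insert_algebraic[OF dom gr e(1) _ e(2) cD[OF order_refl]])
    show "c e \<in> R" using pdeg_fring[OF k fdom_fring[OF dom] H] .
  next
    fix i assume "i < e"
    then show "pdeg H D (\<lambda>w. - c i w)"
      using pdeg_mult[OF pdeg.const[of H 0 "-1"] cD[of i]] by simp
  next
    fix w assume "w \<in> \<Omega>"
    from rel[OF this] have "(\<Sum>i<e. c i w * h w ^ i) + c e w * h w ^ e = 0"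
      unfolding lessThan_Suc_atMost[symmetric] sum.lessThan_Suc .
    then show "c e w * h w ^ e = (\<Sum>i<e. - c i w * h w ^ i)"
      by (simp add: sum_negf add_eq_0_iff)
  qed
qed

text \<open>A maximal independent subfamily chosen greedily: each further member raises the order of growth by one
if it is independent of those chosen before, and otherwise is algebraic over them.\<close>

lemma independent_subfamily:
  fixes h :: "'v \<Rightarrow> 'w \<Rightarrow> 'a::real_normed_field"
  assumes dom: "function_domain \<Omega> R" and V: "finite V" and h: "\<And>v. v \<in> V \<Longrightarrow> h v \<in> R"
  shows "\<exists>S\<subseteq>V. alg_indep \<Omega> S h \<and> growth \<Omega> R (h ` V) (card S)"
  using V h
proof (induction V rule: finite_induct)
  case empty
  have "alg_indep \<Omega> {} h"
  proof (unfold alg_indep_def, intro ballI impI)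
    fix P :: "('v, 'a) mpoly" assume P: "P \<in> polys {}" "P \<noteq> 0"
    obtain x where "peval x P \<noteq> 0" by (rule nonzero_poly_point[OF finite.emptyI P]) (rule that)
    then have "peval (\<lambda>v. h v w) P \<noteq> 0" for w
      using peval_cong[OF P(1), of x "\<lambda>v. h v w"] by simp
    then show "\<exists>w\<in>\<Omega>. peval (\<lambda>v. h v w) P \<noteq> 0" using fdom_ne[OF dom] by auto
  qed
  moreover have "growth \<Omega> R (h ` {}) (card {})" using growth_empty[OF dom] by simp
  ultimately show ?case by blast
next
  case (insert k V)
  have "\<exists>S\<subseteq>V. alg_indep \<Omega> S h \<and> growth \<Omega> R (h ` V) (card S)"
    using insert.IH insert.prems by simp
  then obtain S where S: "S \<subseteq> V" "alg_indep \<Omega> S h" "growth \<Omega> R (h ` V) (card S)" by blast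
  have fS: "finite S" "k \<notin> S" using finite_subset[OF S(1)] S(1) insert.hyps by auto
  show ?case
  proof (cases "alg_indep \<Omega> (insert k S) h")
    case True
    moreover have "growth \<Omega> R (h ` insert k V) (card (insert k S))"
      using fS growth_insert[OF S(3), of "h k"] by simp
    ultimately show ?thesis using S(1) by (intro exI[of _ "insert k S"]) blast
  next
    case False
    obtain P where P: "P \<in> polys (insert k S)" "P \<noteq> 0" "\<And>w. w \<in> \<Omega> \<Longrightarrow> peval (\<lambda>v. h v w) P = 0"
      by (rule alg_depE[OF False]) (rule that)
    obtain D p j where p: "\<And>i. p i \<in> polys S" "\<And>a. peval a P = (\<Sum>i\<le>D. peval a (p i) * a k ^ i)"
      "j \<le> D" "p j \<noteq> 0"
      by (rule poly_coeffs_nonzero[OF P(1,2) fS(1)]) (rule that)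
    define c where "c i w = peval (\<lambda>v. h v w) (p i)" for i w
    have rel: "(\<Sum>i\<le>D. c i w * h k w ^ i) = 0" if "w \<in> \<Omega>" for w
      using P(3)[OF that] p(2)[of "\<lambda>v. h v w"] by (simp add: c_def)
    have cj: "\<exists>w\<in>\<Omega>. c j w \<noteq> 0" using alg_indepD[OF S(2) p(1,4)] by (simp add: c_def)
    obtain e where e: "1 \<le> e" "e \<le> D" "\<exists>w\<in>\<Omega>. c e w \<noteq> 0"
      "\<And>w. w \<in> \<Omega> \<Longrightarrow> (\<Sum>i\<le>e. c i w * h k w ^ i) = 0"
      by (rule truncate_relation[where \<Omega> = \<Omega> and D = D and c = c and h = "h k" and j = j]) (erule rel | rule p(3) cj | rule that; assumption)+
    have "growth \<Omega> R (insert (h k) (h ` V)) (card S)"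
    proof (rule growth_insert_relation[OF dom S(3) _ _ e(4,1,3)])
      show "h ` V \<subseteq> R" using insert.prems by blast
      show "\<exists>n. pdeg (h ` V) n (c i)" for i
        unfolding c_def by (rule pdeg_peval[OF subsetD[OF polys_mono[OF S(1)] p(1)[of i]], of h]) (rule exI)
    qed
    then have "growth \<Omega> R (h ` insert k V) (card S)" by simp
    then show ?thesis using S(1,2) by blast
  qed
qed

section \<open>Extending specialisations\<close>

text \<open>Equivalently, \<open>a\<close> lies in the Zariski closure of the image of \<open>\<Omega>\<close> under \<open>h\<close>, as far as the coordinates
in \<open>V\<close> are concerned.\<close>

definition specialisation :: "'w set \<Rightarrow> 'i set \<Rightarrow> ('i \<Rightarrow> 'w \<Rightarrow> 'a::comm_ring_1) \<Rightarrow> ('i \<Rightarrow> 'a) \<Rightarrow> bool" where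
  "specialisation \<Omega> V h a \<longleftrightarrow> (\<forall>P\<in>polys V. (\<forall>w\<in>\<Omega>. peval (\<lambda>v. h v w) P = 0) \<longrightarrow> peval a P = 0)"

lemma specialisationD:
  "specialisation \<Omega> V h a \<Longrightarrow> P \<in> polys V \<Longrightarrow> (\<And>w. w \<in> \<Omega> \<Longrightarrow> peval (\<lambda>v. h v w) P = 0) \<Longrightarrow> peval a P = 0"
  unfolding specialisation_def by blast

lemma peval_diff: "peval x (P - Q) = peval x P - peval x (Q :: ('v, 'a::comm_ring_1) mpoly)"
  using peval_add[of x "P - Q" Q] by simp

lemma polys_diff: "P \<in> polys V \<Longrightarrow> Q \<in> polys V \<Longrightarrow> P - Q \<in> polys V"
  for P :: "('v, 'a::ab_group_add) mpoly"
  using keys_diff[of P Q] by (fastforce simp: polys_def)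

lemma shifted_sum:
  fixes c :: "nat \<Rightarrow> 'a::comm_semiring_1"
  assumes "e \<le> D"
  shows "(\<Sum>i\<le>D. (if D - e \<le> i then c (i - (D - e)) else 0) * t ^ i) = t ^ (D - e) * (\<Sum>j\<le>e. c j * t ^ j)"
proof -
  have "(\<Sum>i\<le>D. (if D - e \<le> i then c (i - (D - e)) else 0) * t ^ i) = (\<Sum>i\<in>{D - e..D}. c (i - (D - e)) * t ^ i)"
    by (rule sum.mono_neutral_cong_right) auto
  also have "\<dots> = (\<Sum>j\<le>e. c j * t ^ (j + (D - e)))"
    by (rule sum.reindex_bij_witness[of _ "\<lambda>j. j + (D - e)" "\<lambda>i. i - (D - e)"]) (use assms in auto)
  finally show ?thesis by (simp add: sum_distrib_left power_add mult_ac)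
qed

lemma specialisation_fun_upd:
  assumes k: "k \<notin> V" and vanish: "\<And>D g. (\<And>i. g i \<in> polys V) \<Longrightarrow>
      (\<And>w. w \<in> \<Omega> \<Longrightarrow> (\<Sum>i\<le>D. peval (\<lambda>v. h v w) (g i) * h k w ^ i) = 0) \<Longrightarrow> (\<Sum>i\<le>D. peval a (g i) * t ^ i) = 0"
  shows "specialisation \<Omega> (insert k V) h (a(k := t))"
  unfolding specialisation_def
proof (intro ballI impI)
  fix P assume P: "P \<in> polys (insert k V)" "\<forall>w\<in>\<Omega>. peval (\<lambda>v. h v w) P = 0"
  obtain D g where g: "\<And>i. g i \<in> polys V" "\<And>a. peval a P = (\<Sum>i\<le>D. peval a (g i) * a k ^ i)"
    by (rule poly_coeffs[OF P(1)]) (rule that)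
  have "(\<Sum>i\<le>D. peval a (g i) * t ^ i) = 0"
    using P(2) g(2) by (intro vanish g(1)) auto
  moreover have "peval (a(k := t)) (g i) = peval a (g i)" for i
    using k by (intro peval_cong[OF g(1)]) auto
  ultimately show "peval (a(k := t)) P = 0" by (simp add: g(2))
qed

text \<open>If \<open>h\<^sub>k\<close> satisfies an equation of least degree \<open>e\<close> over the other functions, every relation involving \<open>h\<^sub>k\<close>
reduces modulo this equation to one of degree less than \<open>e\<close>, whose coefficients vanish on \<open>\<Omega>\<close> by
minimality.  So at a point where the leading coefficient is nonzero, any root of the specialised
equation extends the specialisation.\<close>

lemma algebraic_specialisation:
  fixes h :: "'v \<Rightarrow> 'w \<Rightarrow> 'a::field"
  assumes k: "k \<notin> V" and p: "\<And>i. p i \<in> polys V"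
    and rel: "\<And>w. w \<in> \<Omega> \<Longrightarrow> (\<Sum>i\<le>e. peval (\<lambda>v. h v w) (p i) * h k w ^ i) = 0"
    and e: "1 \<le> e"
    and minimal: "\<And>e' g. e' < e \<Longrightarrow> 1 \<le> e' \<Longrightarrow> (\<And>i. g i \<in> polys V) \<Longrightarrow> (\<exists>w\<in>\<Omega>. peval (\<lambda>v. h v w) (g e') \<noteq> 0) \<Longrightarrow>
       (\<And>w. w \<in> \<Omega> \<Longrightarrow> (\<Sum>i\<le>e'. peval (\<lambda>v. h v w) (g i) * h k w ^ i) = 0) \<Longrightarrow> False"
    and a: "specialisation \<Omega> V h a" "peval a (p e) \<noteq> 0" and t: "(\<Sum>i\<le>e. peval a (p i) * t ^ i) = 0"
  shows "specialisation \<Omega> (insert k V) h (a(k := t))"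
proof (rule specialisation_fun_upd[OF k])
  fix D g assume "\<And>i. g i \<in> polys V"
      "\<And>w. w \<in> \<Omega> \<Longrightarrow> (\<Sum>i\<le>D. peval (\<lambda>v. h v w) (g i) * h k w ^ i) = 0"
  then show "(\<Sum>i\<le>D. peval a (g i) * t ^ i) = 0"
  proof (induction D arbitrary: g rule: less_induct)
    case (less D)
    show ?case
    proof (cases "D < e")
      case True
      have "peval (\<lambda>v. h v w) (g j) = 0" if j: "j \<le> D" "w \<in> \<Omega>" for j w
      proof (rule ccontr)
        assume "peval (\<lambda>v. h v w) (g j) \<noteq> 0"
        then have nz: "\<exists>w\<in>\<Omega>. peval (\<lambda>v. h v w) (g j) \<noteq> 0" using j by blast
        show False
        proof (rule truncate_relation[where \<Omega> = \<Omega> and D = D and h = "h k" and j = j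
              and c = "\<lambda>i w. peval (\<lambda>v. h v w) (g i)"])
          fix e' assume *: "1 \<le> e'" "e' \<le> D" "\<exists>w\<in>\<Omega>. peval (\<lambda>v. h v w) (g e') \<noteq> 0"
            "\<And>w. w \<in> \<Omega> \<Longrightarrow> (\<Sum>i\<le>e'. peval (\<lambda>v. h v w) (g i) * h k w ^ i) = 0"
          have "e' < e" using *(2) True by simp
          from minimal[OF this *(1) less.prems(1) *(3,4)] show False .
        qed (use less.prems(2) j nz in auto)
      qed
      then have "peval a (g j) = 0" if "j \<le> D" for j
        using specialisationD[OF a(1) less.prems(1)] that by blast
      then show ?thesis by simp
    next
      case False
      then have D: "e \<le> D" "D - 1 < D" "{..D} = insert D {..D - 1}" using e by auto
      define g' where "g' i = p e * g i - g D * (if D - e \<le> i then p (i - (D - e)) else 0)" for i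
      have g': "g' i \<in> polys V" for i
        unfolding g'_def using less.prems(1) p by (intro polys_diff polys_mult) (auto simp: polys_zero)
      have ev: "(\<Sum>i\<le>D - 1. peval x (g' i) * s ^ i) =
          peval x (p e) * (\<Sum>i\<le>D. peval x (g i) * s ^ i) - peval x (g D) * (s ^ (D - e) * (\<Sum>j\<le>e. peval x (p j) * s ^ j))"
        for x s
      proof -
        have "peval x (g' D) = 0" using D(1) by (simp add: g'_def peval_diff peval_mult)
        then have "(\<Sum>i\<le>D - 1. peval x (g' i) * s ^ i) = (\<Sum>i\<le>D. peval x (g' i) * s ^ i)"
          using D(2) by (simp add: D(3))
        also have "\<dots> = (\<Sum>i\<le>D. peval x (p e) * (peval x (g i) * s ^ i) -
            peval x (g D) * ((if D - e \<le> i then peval x (p (i - (D - e))) else 0) * s ^ i))"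
          by (intro sum.cong refl) (auto simp: g'_def peval_diff peval_mult algebra_simps)
        finally show ?thesis
          using shifted_sum[OF D(1), of "\<lambda>j. peval x (p j)" s]
          by (simp add: sum_subtractf sum_distrib_left[symmetric])
      qed
      have "(\<Sum>i\<le>D - 1. peval a (g' i) * t ^ i) = 0"
        by (rule less.IH[OF D(2) g']) (subst ev, use less.prems(2) rel in simp)
      then show ?thesis using ev[of a t] t a(2) by simp
    qed
  qed
qed

text \<open>If \<open>h\<^sub>k\<close> is algebraic over the other functions, so is any polynomial \<open>Q\<close> in them.  Its equation can be
divided by a power of \<open>Q\<close> until the constant coefficient is nonzero.  This coefficient plays the role of
the norm of \<open>Q\<close>: where it does not vanish, neither does \<open>Q\<close>.\<close>

lemma norm_relation:
  fixes h :: "'v \<Rightarrow> 'w \<Rightarrow> 'a::real_normed_field"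
  assumes dom: "function_domain \<Omega> R" and V: "finite V" "k \<notin> V" and h: "\<And>v. v \<in> insert k V \<Longrightarrow> h v \<in> R"
    and p: "\<And>i. p i \<in> polys V"
    and rel: "\<And>w. w \<in> \<Omega> \<Longrightarrow> (\<Sum>i\<le>e. peval (\<lambda>v. h v w) (p i) * h k w ^ i) = 0"
    and e: "1 \<le> e" "\<exists>w\<in>\<Omega>. peval (\<lambda>v. h v w) (p e) \<noteq> 0"
    and Q: "Q \<in> polys (insert k V)" "\<exists>w\<in>\<Omega>. peval (\<lambda>v. h v w) Q \<noteq> 0"
  obtains n c where "\<And>i. c i \<in> polys V" "\<exists>w\<in>\<Omega>. peval (\<lambda>v. h v w) (c 0) \<noteq> 0"
    "\<And>w. w \<in> \<Omega> \<Longrightarrow> (\<Sum>i\<le>n. peval (\<lambda>v. h v w) (c i) * peval (\<lambda>v. h v w) Q ^ i) = 0"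
proof -
  obtain S where S: "S \<subseteq> V" "alg_indep \<Omega> S h" "growth \<Omega> R (h ` V) (card S)"
    using independent_subfamily[OF dom V(1), of h] h by blast
  have fS: "finite S" "k \<notin> S" using finite_subset[OF S(1) V(1)] S(1) V(2) by auto
  have HR: "h ` V \<subseteq> R" "h ` insert k V \<subseteq> R" using h by auto
  have gr: "growth \<Omega> R (h ` insert k V) (card S)"
    unfolding image_insert
  proof (rule growth_insert_relation[OF dom S(3) HR(1) _ rel e])
    show "\<exists>n. pdeg (h ` V) n (\<lambda>w. peval (\<lambda>v. h v w) (p i))" for i
      by (rule pdeg_peval[OF p[of i], of h]) (rule exI)
  qed
  let ?Q = "\<lambda>w. peval (\<lambda>v. h v w) Q"
  define g where "g v = (if v = k then ?Q else h v)" for v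
  have "\<exists>n. pdeg (h ` insert k V) n (g v)" if "v \<in> insert k S" for v
  proof (cases "v = k")
    case True
    show ?thesis unfolding g_def using True by simp (rule pdeg_peval[OF Q(1), of h], simp, rule exI)
  next
    case False
    then have "h v \<in> h ` insert k V" using that S(1) by auto
    from pdeg_mem[OF this] show ?thesis using False unfolding g_def by auto
  qed
  then have "\<not> alg_indep \<Omega> (insert k S) g"
    using alg_indep_le_growth[OF dom gr HR(2), of "insert k S" g] fS by force
  then obtain P where P: "P \<in> polys (insert k S)" "P \<noteq> 0" "\<And>w. w \<in> \<Omega> \<Longrightarrow> peval (\<lambda>v. g v w) P = 0"
    by (rule alg_depE) (rule that)
  obtain D q j where q: "\<And>i. q i \<in> polys S" "\<And>a. peval a P = (\<Sum>i\<le>D. peval a (q i) * a k ^ i)"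
    "j \<le> D" "q j \<noteq> 0"
    by (rule poly_coeffs_nonzero[OF P(1,2) fS(1)]) (rule that)
  have qg: "peval (\<lambda>v. g v w) (q i) = peval (\<lambda>v. h v w) (q i)" for i w
    by (rule peval_cong[OF q(1)]) (use fS in \<open>auto simp: g_def\<close>)
  have qrel: "(\<Sum>i\<le>D. peval (\<lambda>v. h v w) (q i) * ?Q w ^ i) = 0" if "w \<in> \<Omega>" for w
    using P(3)[OF that] q(2)[of "\<lambda>v. g v w"] by (simp add: qg) (simp add: g_def)
  have qj: "\<exists>w\<in>\<Omega>. peval (\<lambda>v. h v w) (q j) \<noteq> 0" by (rule alg_indepD[OF S(2) q(1,4)])
  define m where "m = (LEAST i. \<exists>w\<in>\<Omega>. peval (\<lambda>v. h v w) (q i) \<noteq> 0)"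
  have m: "\<exists>w\<in>\<Omega>. peval (\<lambda>v. h v w) (q m) \<noteq> 0" unfolding m_def by (rule LeastI) (rule qj)
  have mj: "m \<le> D" using Least_le[of "\<lambda>i. \<exists>w\<in>\<Omega>. peval (\<lambda>v. h v w) (q i) \<noteq> 0", OF qj] q(3) unfolding m_def by simp
  have low: "peval (\<lambda>v. h v w) (q i) = 0" if "i < m" "w \<in> \<Omega>" for i w
    using not_less_Least[of i "\<lambda>i. \<exists>w\<in>\<Omega>. peval (\<lambda>v. h v w) (q i) \<noteq> 0"] that unfolding m_def by blast
  define c where "c i = q (i + m)" for i
  have cV: "c i \<in> polys V" for i using q(1) polys_mono[OF S(1)] unfolding c_def by blast
  have QR: "?Q \<in> R" using fring_peval[OF fdom_fring[OF dom] Q(1), of h] h by blast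
  have "(\<Sum>i\<le>D - m. peval (\<lambda>v. h v w) (c i) * ?Q w ^ i) = 0" if w: "w \<in> \<Omega>" for w
  proof (rule fdom_cancel[OF dom _ _ _ _ w])
    show "(\<lambda>w. ?Q w ^ m) \<in> R" by (rule fring_power[OF fdom_fring[OF dom] QR])
    show "(\<lambda>w. \<Sum>i\<le>D - m. peval (\<lambda>v. h v w) (c i) * ?Q w ^ i) \<in> R"
      using fring_peval[OF fdom_fring[OF dom] cV, of h] h QR
      by (intro fring_sum fring_mult fring_power fdom_fring[OF dom]) blast+
    show "\<exists>w\<in>\<Omega>. ?Q w ^ m \<noteq> 0" by (rule fdom_power_nonzero[OF Q(2)])
    fix w assume w: "w \<in> \<Omega>"
    have "?Q w ^ m * (\<Sum>i\<le>D - m. peval (\<lambda>v. h v w) (c i) * ?Q w ^ i)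
        = (\<Sum>i\<in>{m..D}. peval (\<lambda>v. h v w) (q i) * ?Q w ^ i)"
      unfolding sum_distrib_left
      by (rule sum.reindex_bij_witness[of _ "\<lambda>i. i - m" "\<lambda>i. i + m"])
         (use mj in \<open>auto simp: c_def power_add mult_ac\<close>)
    also have "\<dots> = (\<Sum>i\<le>D. peval (\<lambda>v. h v w) (q i) * ?Q w ^ i)"
      by (rule sum.mono_neutral_left) (use low w in \<open>auto simp: not_le\<close>)
    finally show "?Q w ^ m * (\<Sum>i\<le>D - m. peval (\<lambda>v. h v w) (c i) * ?Q w ^ i) = 0" using qrel[OF w] by simp
  qed
  then show thesis using that[of c "D - m"] cV m by (simp add: c_def)
qed

lemma root_exists:
  fixes c :: "nat \<Rightarrow> 'a::alg_closed_field"
  assumes "1 \<le> e" "c e \<noteq> 0"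
  obtains t where "(\<Sum>i\<le>e. c i * t ^ i) = 0"
proof -
  define p where "p = (\<Sum>i\<le>e. monom (c i) i)"
  have co: "coeff p i = (if i \<le> e then c i else 0)" for i
    by (simp add: p_def coeff_sum)
  have "degree p \<ge> e" using assms by (intro le_degree) (simp add: co)
  then obtain t where "poly p t = 0" using alg_closed_imp_poly_has_root[of p] assms(1) by auto
  then show thesis using that[of t] by (simp add: p_def poly_sum poly_monom)
qed

lemma nonroot_exists:
  fixes c :: "nat \<Rightarrow> 'a::field_char_0"
  assumes "j \<le> n" "c j \<noteq> 0"
  obtains t where "(\<Sum>i\<le>n. c i * t ^ i) \<noteq> 0"
proof -
  define p where "p = (\<Sum>i\<le>n. monom (c i) i)"
  have "coeff p j \<noteq> 0" using assms by (simp add: p_def coeff_sum)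
  then have "p \<noteq> 0" by auto
  then have "finite {t. poly p t = 0}" by (rule poly_roots_finite)
  then obtain t where "poly p t \<noteq> 0"
    using infinite_UNIV_char_0[where 'a = 'a] by (metis (mono_tags, lifting) UNIV_eq_I mem_Collect_eq)
  then show thesis using that[of t] by (simp add: p_def poly_sum poly_monom)
qed

text \<open>Either \<open>h\<^sub>k\<close> is algebraic over the other functions and its value has to be a root of the specialised
equation, or it is transcendental and every value except the roots of one polynomial will do.  The
condition \<open>Q \<noteq> 0\<close> is carried along so that the step can be iterated.\<close>

lemma extend_specialisation_one:
  fixes h :: "'v \<Rightarrow> 'w \<Rightarrow> 'a::{alg_closed_field, real_normed_field}"
  assumes dom: "function_domain \<Omega> R" and V: "finite V" "k \<notin> V" and h: "\<And>v. v \<in> insert k V \<Longrightarrow> h v \<in> R"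
    and Q: "Q \<in> polys (insert k V)" "\<exists>w\<in>\<Omega>. peval (\<lambda>v. h v w) Q \<noteq> 0"
  shows "\<exists>H\<in>polys V. (\<exists>w\<in>\<Omega>. peval (\<lambda>v. h v w) H \<noteq> 0) \<and>
    (\<forall>a. specialisation \<Omega> V h a \<longrightarrow> peval a H \<noteq> 0 \<longrightarrow>
      (\<exists>t. specialisation \<Omega> (insert k V) h (a(k := t)) \<and> peval (a(k := t)) Q \<noteq> 0))"
proof -
  define isrel where "isrel e p \<longleftrightarrow> (\<forall>i. p i \<in> polys V) \<and> (\<exists>w\<in>\<Omega>. peval (\<lambda>v. h v w) (p e) \<noteq> 0) \<and> 1 \<le> e \<and>
     (\<forall>w\<in>\<Omega>. (\<Sum>i\<le>e. peval (\<lambda>v. h v w) (p i) * h k w ^ i) = 0)" for e p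
  have upd: "peval (a(k := t)) P = peval a P" if "P \<in> polys V" for a t P
    by (rule peval_cong[OF that]) (use V in auto)
  show ?thesis
  proof (cases "\<exists>e p. isrel e p")
    case True
    define e where "e = (LEAST e. \<exists>p. isrel e p)"
    obtain p where "isrel e p" using LeastI_ex[OF True] unfolding e_def by blast
    then have p: "\<And>i. p i \<in> polys V" "\<exists>w\<in>\<Omega>. peval (\<lambda>v. h v w) (p e) \<noteq> 0" "1 \<le> e"
      "\<And>w. w \<in> \<Omega> \<Longrightarrow> (\<Sum>i\<le>e. peval (\<lambda>v. h v w) (p i) * h k w ^ i) = 0"
      by (auto simp: isrel_def)
    have min: "\<not> isrel e' g" if "e' < e" for e' g
      using not_less_Least that unfolding e_def by blast
    obtain n c where c: "\<And>i. c i \<in> polys V" "\<exists>w\<in>\<Omega>. peval (\<lambda>v. h v w) (c 0) \<noteq> 0"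
      "\<And>w. w \<in> \<Omega> \<Longrightarrow> (\<Sum>i\<le>n. peval (\<lambda>v. h v w) (c i) * peval (\<lambda>v. h v w) Q ^ i) = 0"
      by (rule norm_relation[OF dom V h p(1,4,3,2) Q]) (assumption | rule that)+
    have hV: "\<And>v. v \<in> V \<Longrightarrow> h v \<in> R" using h by blast
    show ?thesis
    proof (intro bexI[of _ "p e * c 0"] conjI allI impI)
      show "p e * c 0 \<in> polys V" using p c by (intro polys_mult)
      show "\<exists>w\<in>\<Omega>. peval (\<lambda>v. h v w) (p e * c 0) \<noteq> 0"
        using fdom_both[OF dom fring_peval[OF fdom_fring[OF dom] p(1) hV] fring_peval[OF fdom_fring[OF dom] c(1) hV] p(2) c(2)]
        by (simp add: peval_mult)
      fix a assume a: "specialisation \<Omega> V h a" "peval a (p e * c 0) \<noteq> 0"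
      then have nz: "peval a (p e) \<noteq> 0" "peval a (c 0) \<noteq> 0" by (auto simp: peval_mult)
      obtain t where t: "(\<Sum>i\<le>e. peval a (p i) * t ^ i) = 0"
        by (rule root_exists[of e "\<lambda>i. peval a (p i)"]) (use p(3) nz in auto)
      have sp: "specialisation \<Omega> (insert k V) h (a(k := t))"
      proof (rule algebraic_specialisation[OF V(2) p(1,4,3) _ a(1) nz(1) t])
        fix e' g assume "e' < e" "1 \<le> e'" "\<And>i. g i \<in> polys V" "\<exists>w\<in>\<Omega>. peval (\<lambda>v. h v w) (g e') \<noteq> 0"
          "\<And>w. w \<in> \<Omega> \<Longrightarrow> (\<Sum>i\<le>e'. peval (\<lambda>v. h v w) (g i) * h k w ^ i) = 0"
        then have "isrel e' g" unfolding isrel_def by blast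
        with min[OF \<open>e' < e\<close>] show False by blast
      qed
      moreover have "peval (a(k := t)) Q \<noteq> 0"
      proof
        assume Q0: "peval (a(k := t)) Q = 0"
        define N where "N = (\<Sum>i\<le>n. c i * Q ^ i)"
        have "Q ^ i \<in> polys (insert k V)" for i
          by (induction i) (simp add: polys_def, simp add: polys_mult Q(1))
        moreover have "c i \<in> polys (insert k V)" for i using c(1) polys_mono[of V "insert k V"] by blast
        ultimately have N: "N \<in> polys (insert k V)"
          unfolding N_def by (intro polys_sum polys_mult)
        have pw: "peval x (Q ^ i) = peval x Q ^ i" for x i
          by (induction i) (auto simp: peval_mult)
        have "peval (a(k := t)) N = 0"
          by (rule specialisationD[OF sp N]) (use c(3) in \<open>simp add: N_def peval_sum peval_mult pw\<close>)
        then have "peval a (c 0) = 0"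
          by (simp add: N_def peval_sum peval_mult pw Q0 upd[OF c(1)] power_0_left if_distrib sum.delta cong: if_cong)
        with nz show False by simp
      qed
      ultimately show "\<exists>t. specialisation \<Omega> (insert k V) h (a(k := t)) \<and> peval (a(k := t)) Q \<noteq> 0" by blast
    qed
  next
    case False
    have vanish: "peval (\<lambda>v. h v w) (g j) = 0"
      if g: "\<And>i. g i \<in> polys V" "\<And>w. w \<in> \<Omega> \<Longrightarrow> (\<Sum>i\<le>D. peval (\<lambda>v. h v w) (g i) * h k w ^ i) = 0"
        and j: "j \<le> D" "w \<in> \<Omega>" for D g j w
    proof (rule ccontr)
      assume "peval (\<lambda>v. h v w) (g j) \<noteq> 0"
      then have nz: "\<exists>w\<in>\<Omega>. peval (\<lambda>v. h v w) (g j) \<noteq> 0" using j by blast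
      show False
      proof (rule truncate_relation[where \<Omega> = \<Omega> and D = D and h = "h k" and j = j
            and c = "\<lambda>i w. peval (\<lambda>v. h v w) (g i)"])
        fix e' assume "1 \<le> e'" "e' \<le> D" "\<exists>w\<in>\<Omega>. peval (\<lambda>v. h v w) (g e') \<noteq> 0"
          "\<And>w. w \<in> \<Omega> \<Longrightarrow> (\<Sum>i\<le>e'. peval (\<lambda>v. h v w) (g i) * h k w ^ i) = 0"
        then have "isrel e' g" using g(1) by (auto simp: isrel_def)
        then show False using False by blast
      qed (use g(2) j nz in auto)
    qed
    obtain D q where q: "\<And>i. q i \<in> polys V" "\<And>a. peval a Q = (\<Sum>i\<le>D. peval a (q i) * a k ^ i)"
      by (rule poly_coeffs[OF Q(1)]) (rule that)
    have "\<exists>j\<le>D. \<exists>w\<in>\<Omega>. peval (\<lambda>v. h v w) (q j) \<noteq> 0"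
      using Q(2) unfolding q(2) by (metis (no_types, lifting) atMost_iff mult_zero_left sum.neutral)
    then obtain j where j: "j \<le> D" "\<exists>w\<in>\<Omega>. peval (\<lambda>v. h v w) (q j) \<noteq> 0" by blast
    show ?thesis
    proof (intro bexI[of _ "q j"] conjI allI impI)
      fix a assume a: "specialisation \<Omega> V h a" "peval a (q j) \<noteq> 0"
      obtain t where t: "(\<Sum>i\<le>D. peval a (q i) * t ^ i) \<noteq> 0"
        by (rule nonroot_exists[of j D "\<lambda>i. peval a (q i)"]) (use j a in auto)
      have "specialisation \<Omega> (insert k V) h (a(k := t))"
      proof (rule specialisation_fun_upd[OF V(2)])
        fix D g assume g: "\<And>i. g i \<in> polys V"
          "\<And>w. w \<in> \<Omega> \<Longrightarrow> (\<Sum>i\<le>D. peval (\<lambda>v. h v w) (g i) * h k w ^ i) = 0"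
        have "peval a (g i) = 0" if "i \<le> D" for i
          by (rule specialisationD[OF a(1) g(1)]) (rule vanish[OF g that])
        then show "(\<Sum>i\<le>D. peval a (g i) * t ^ i) = 0" by simp
      qed
      moreover have "peval (a(k := t)) Q \<noteq> 0" using t by (simp add: q(2) upd[OF q(1)])
      ultimately show "\<exists>t. specialisation \<Omega> (insert k V) h (a(k := t)) \<and> peval (a(k := t)) Q \<noteq> 0" by blast
    qed (use q j in auto)
  qed
qed

lemma extend_specialisation:
  fixes h :: "'v \<Rightarrow> 'w \<Rightarrow> 'a::{alg_closed_field, real_normed_field}"
  assumes dom: "function_domain \<Omega> R" and V: "finite V" and W: "finite W" "V \<inter> W = {}"
    and h: "\<And>v. v \<in> V \<union> W \<Longrightarrow> h v \<in> R"
    and Q: "Q \<in> polys (V \<union> W)" "\<exists>w\<in>\<Omega>. peval (\<lambda>v. h v w) Q \<noteq> 0"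
  shows "\<exists>H\<in>polys V. (\<exists>w\<in>\<Omega>. peval (\<lambda>v. h v w) H \<noteq> 0) \<and>
    (\<forall>a. specialisation \<Omega> V h a \<longrightarrow> peval a H \<noteq> 0 \<longrightarrow>
      (\<exists>b. (\<forall>v\<in>V. b v = a v) \<and> specialisation \<Omega> (V \<union> W) h b \<and> peval b Q \<noteq> 0))"
  using W h Q
proof (induction W arbitrary: Q rule: finite_induct)
  case empty
  then show ?case by (intro bexI[of _ Q]) auto
next
  case (insert k W)
  have un: "V \<union> insert k W = insert k (V \<union> W)" by auto
  have k: "k \<notin> V \<union> W" using insert by auto
  obtain H1 where H1: "H1 \<in> polys (V \<union> W)" "\<exists>w\<in>\<Omega>. peval (\<lambda>v. h v w) H1 \<noteq> 0"
    "\<And>a. specialisation \<Omega> (V \<union> W) h a \<Longrightarrow> peval a H1 \<noteq> 0 \<Longrightarrow>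
      \<exists>t. specialisation \<Omega> (insert k (V \<union> W)) h (a(k := t)) \<and> peval (a(k := t)) Q \<noteq> 0"
    using extend_specialisation_one[OF dom _ k, of h Q] insert.prems insert.hyps V unfolding un by blast
  obtain H where H: "H \<in> polys V" "\<exists>w\<in>\<Omega>. peval (\<lambda>v. h v w) H \<noteq> 0"
    "\<And>a. specialisation \<Omega> V h a \<Longrightarrow> peval a H \<noteq> 0 \<Longrightarrow>
      \<exists>b. (\<forall>v\<in>V. b v = a v) \<and> specialisation \<Omega> (V \<union> W) h b \<and> peval b H1 \<noteq> 0"
    using insert.IH[OF _ _ H1(1,2)] insert.prems by blast
  have "\<exists>b. (\<forall>v\<in>V. b v = a v) \<and> specialisation \<Omega> (insert k (V \<union> W)) h b \<and> peval b Q \<noteq> 0"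
    if a: "specialisation \<Omega> V h a" "peval a H \<noteq> 0" for a
  proof -
    obtain b where b: "\<forall>v\<in>V. b v = a v" "specialisation \<Omega> (V \<union> W) h b" "peval b H1 \<noteq> 0"
      using H(3)[OF a] by blast
    obtain t where "specialisation \<Omega> (insert k (V \<union> W)) h (b(k := t))" "peval (b(k := t)) Q \<noteq> 0"
      using H1(3)[OF b(2,3)] by blast
    moreover have "\<forall>v\<in>V. (b(k := t)) v = a v" using b(1) k by auto
    ultimately show ?thesis by blast
  qed
  then show ?case unfolding un using H(1,2) by blast
qed

section \<open>Zariski closure and dimension\<close>

lemma openin_nonvanishing:
  assumes "F \<in> polyfuns V"
  shows "openin (zariski V) {x \<in> aff V. F x \<noteq> 0}"
proof -
  obtain P where P: "P \<in> polys V" "F = (\<lambda>x. peval x P)" using assms by (rule polyfunsE)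
  then show ?thesis unfolding openin_zariski by (intro exI[of _ "{P}"]) (auto simp: zeros_def)
qed

lemma vanishes_on_closure:
  assumes X: "X \<subseteq> aff V" and F: "F \<in> polyfuns V" and z: "\<And>x. x \<in> X \<Longrightarrow> F x = 0"
    and x: "x \<in> zariski V closure_of X"
  shows "F x = 0"
proof -
  obtain P where P: "P \<in> polys V" "F = (\<lambda>x. peval x P)" using F by (rule polyfunsE)
  have "closedin (zariski V) (zeros V {P})" unfolding closedin_zariski using P by blast
  moreover have "X \<subseteq> zeros V {P}" using X z P by (auto simp: zeros_def)
  ultimately have "zariski V closure_of X \<subseteq> zeros V {P}" by (intro closure_of_minimal)
  then show ?thesis using x P by (auto simp: zeros_def)
qed

lemma subset_closure: "X \<subseteq> aff V \<Longrightarrow> X \<subseteq> zariski V closure_of X"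
  by (rule closure_of_subset) simp

text \<open>A polynomial in polynomials is a polynomial, so it vanishes on a set iff it vanishes on the closure.\<close>

lemma alg_indep_on_closure:
  assumes X: "X \<subseteq> aff {..<n}" and g: "\<And>i. i < d \<Longrightarrow> g i \<in> polys {..<n}"
  shows "alg_indep_on (zariski {..<n} closure_of X) d g \<longleftrightarrow> alg_indep X {..<d} (\<lambda>i x. peval x (g i))"
proof -
  have pm: "peval (poly_map d g x) P = peval (\<lambda>i. peval x (g i)) P" if "P \<in> polys {..<d}" for x P
    by (rule peval_cong[OF that]) (simp add: poly_map_def)
  show ?thesis
  proof
    assume L: "alg_indep_on (zariski {..<n} closure_of X) d g"
    show "alg_indep X {..<d} (\<lambda>i x. peval x (g i))"
      unfolding alg_indep_def
    proof (intro ballI impI, rule ccontr)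
      fix P :: "(nat, 'a) mpoly" assume P: "P \<in> polys {..<d}" "P \<noteq> 0" "\<not> (\<exists>w\<in>X. peval (\<lambda>v. peval w (g v)) P \<noteq> 0)"
      have "(\<lambda>x. peval (\<lambda>i. peval x (g i)) P) \<in> polyfuns {..<n}"
        using fring_peval[OF fring_polyfuns P(1), of "\<lambda>i x. peval x (g i)"] g polyfunsI by blast
      from vanishes_on_closure[OF X this] P
      have "peval (\<lambda>i. peval x (g i)) P = 0" if "x \<in> zariski {..<n} closure_of X" for x
        using that by blast
      then show False using L P(1,2) pm[OF P(1)] unfolding alg_indep_on_def by auto
    qed
  next
    assume "alg_indep X {..<d} (\<lambda>i x. peval x (g i))"
    then show "alg_indep_on (zariski {..<n} closure_of X) d g"
      using subset_closure[OF X] pm unfolding alg_indep_def alg_indep_on_def by fastforce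
  qed
qed

definition indep_sizes :: "nat \<Rightarrow> (nat \<Rightarrow> 'a::comm_ring_1) set \<Rightarrow> nat set" where
  "indep_sizes n X = {d. \<exists>g. (\<forall>i<d. g i \<in> polys {..<n}) \<and> alg_indep X {..<d} (\<lambda>i x. peval x (g i))}"

lemma model_dim_eq:
  assumes "X \<subseteq> aff {..<n}"
  shows "model_dim n X = Max (indep_sizes n X)"
  unfolding model_dim_def variety_dim_def indep_sizes_def
  using alg_indep_on_closure[OF assms] by (intro arg_cong[of _ _ Max] Collect_cong ex_cong1 conj_cong refl) auto

text \<open>This makes the maximum in the definition of the dimension meaningful.\<close>

lemma indep_sizes_bounded:
  fixes X :: "(nat \<Rightarrow> 'a::real_normed_field) set"
  assumes dom: "function_domain X (polyfuns {..<n})"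
  shows "indep_sizes n X \<subseteq> {..n}"
proof
  fix d assume "d \<in> indep_sizes n X"
  then obtain g where g: "\<And>i. i < d \<Longrightarrow> g i \<in> polys {..<n}" "alg_indep X {..<d} (\<lambda>i x. peval x (g i))"
    by (auto simp: indep_sizes_def)
  define h where "h = (\<lambda>(i::nat) (x :: nat \<Rightarrow> 'a). x i)"
  have h: "h i \<in> polyfuns {..<n}" if "i \<in> {..<n}" for i
    using polyfuns_var[OF that] by (simp add: h_def)
  obtain S where S: "S \<subseteq> {..<n}" "growth X (polyfuns {..<n}) (h ` {..<n}) (card S)"
    using independent_subfamily[OF dom, of "{..<n}" h] h by auto
  have "card {..<d} \<le> card S"
  proof (rule alg_indep_le_growth[OF dom S(2) _ _ _ g(2)])
    show "h ` {..<n} \<subseteq> polyfuns {..<n}" using h by blast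
    fix i assume "i \<in> {..<d}"
    then have "g i \<in> polys {..<n}" using g(1) by simp
    then show "\<exists>k. pdeg (h ` {..<n}) k (\<lambda>x. peval x (g i))"
      by (rule pdeg_peval[of _ _ h]) (auto simp: h_def)
  qed simp
  also have "\<dots> \<le> n" using card_mono[OF _ S(1)] by simp
  finally show "d \<in> {..n}" by simp
qed

lemma alg_indep_reindex:
  fixes h :: "'j \<Rightarrow> 'w \<Rightarrow> 'a::real_normed_field" and \<sigma> :: "'i \<Rightarrow> 'j"
  assumes ind: "alg_indep \<Omega> J h" and \<sigma>: "bij_betw \<sigma> I J" and I: "finite I"
  shows "alg_indep \<Omega> I (\<lambda>i. h (\<sigma> i))"
  unfolding alg_indep_def
proof (intro ballI impI)
  fix P :: "('i, 'a) mpoly" assume P: "P \<in> polys I" "P \<noteq> 0"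
  have "(\<lambda>a. peval (\<lambda>i. a (\<sigma> i)) P) \<in> polyfuns J"
    using \<sigma> by (intro fring_peval[OF fring_polyfuns P(1)] polyfuns_var) (auto simp: bij_betw_def)
  then obtain P' where P': "P' \<in> polys J" "\<And>a. peval (\<lambda>i. a (\<sigma> i)) P = peval a P'"
    by (auto elim!: polyfunsE dest: fun_cong)
  obtain z where "peval z P \<noteq> 0" by (rule nonzero_poly_point[OF I P])
  moreover have "peval z P = peval (\<lambda>i. (z \<circ> inv_into I \<sigma>) (\<sigma> i)) P"
    using \<sigma> by (intro peval_cong[OF P(1)]) (simp add: bij_betw_def inv_into_f_f)
  ultimately have "P' \<noteq> 0" unfolding P'(2) by auto
  then obtain w where "w \<in> \<Omega>" "peval (\<lambda>j. h j w) P' \<noteq> 0" using alg_indepD[OF ind P'(1)] by blast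
  then show "\<exists>w\<in>\<Omega>. peval (\<lambda>i. h (\<sigma> i) w) P \<noteq> 0" using P'(2)[of "\<lambda>j. h j w" for w] by auto
qed

lemma model_dim_attained:
  fixes X :: "(nat \<Rightarrow> 'a::real_normed_field) set"
  assumes X: "X \<subseteq> aff {..<n}" and dom: "function_domain X (polyfuns {..<n})"
  obtains g where "\<And>i. i < model_dim n X \<Longrightarrow> g i \<in> polys {..<n}"
    "alg_indep X {..<model_dim n X} (\<lambda>i x. peval x (g i))"
proof -
  have "finite (indep_sizes n X)" using finite_subset[OF indep_sizes_bounded[OF dom]] by simp
  moreover have "indep_sizes n X \<noteq> {}"
  proof -
    have "alg_indep X {..<0::nat} (\<lambda>i x. peval x (g i))" for g
      using independent_subfamily[OF dom, of "{..<0::nat}" "\<lambda>i x. peval x (g i)"] by auto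
    then have "0 \<in> indep_sizes n X" by (simp add: indep_sizes_def)
    then show ?thesis by auto
  qed
  ultimately have "model_dim n X \<in> indep_sizes n X" unfolding model_dim_eq[OF X] by (rule Max_in)
  then show thesis using that by (auto simp: indep_sizes_def)
qed

lemma indep_coords_le_model_dim:
  fixes X :: "(nat \<Rightarrow> 'a::real_normed_field) set"
  assumes X: "X \<subseteq> aff {..<n}" and dom: "function_domain X (polyfuns {..<n})"
    and S: "S \<subseteq> {..<n}" "alg_indep X S (\<lambda>j x. x j)"
  shows "card S \<le> model_dim n X"
proof -
  have fS: "finite S" using finite_subset[OF S(1)] by simp
  obtain \<sigma> where \<sigma>: "bij_betw \<sigma> {..<card S} S"
    using ex_bij_betw_nat_finite[OF fS] by (auto simp: atLeast0LessThan)
  have "alg_indep X {..<card S} (\<lambda>i x. peval x (Poly_Mapping.single (Poly_Mapping.single (\<sigma> i) 1) 1))"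
    using alg_indep_reindex[OF S(2) \<sigma>] by (simp add: monom_eval_single)
  moreover have "Poly_Mapping.single (Poly_Mapping.single (\<sigma> i) 1) (1::'a) \<in> polys {..<n}" if "i < card S" for i
    using \<sigma> S(1) that by (intro polys_single) (auto simp: bij_betw_def)
  ultimately have "card S \<in> indep_sizes n X"
    unfolding indep_sizes_def
    by (intro CollectI exI[of _ "\<lambda>i. Poly_Mapping.single (Poly_Mapping.single (\<sigma> i) 1) 1"]) simp
  then show ?thesis unfolding model_dim_eq[OF X]
    using finite_subset[OF indep_sizes_bounded[OF dom]] by (intro Max_ge) simp_all
qed

lemma growth_union:
  "finite V \<Longrightarrow> growth \<Omega> R H r \<Longrightarrow> growth \<Omega> R (c ` V \<union> H) (card V + r)"
  by (induction V rule: finite_induct) (auto intro: growth_insert)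

section \<open>The space of coefficients\<close>

lemma finite_monoms_le: "finite A \<Longrightarrow> finite (monoms_le A p)"
proof -
  assume A: "finite A"
  have "inj_on (\<lambda>m. restrict (Poly_Mapping.lookup m) A) (monoms_le A p)"
  proof (rule inj_onI, rule poly_mapping_eqI)
    fix m m' v assume m: "m \<in> monoms_le A p" "m' \<in> monoms_le A p"
      and eq: "restrict (Poly_Mapping.lookup m) A = restrict (Poly_Mapping.lookup m') A"
    show "Poly_Mapping.lookup m v = Poly_Mapping.lookup m' v"
    proof (cases "v \<in> A")
      case True
      then show ?thesis using fun_cong[OF eq, of v] by simp
    next
      case False
      then have "v \<notin> Poly_Mapping.keys m" "v \<notin> Poly_Mapping.keys m'" using m by (auto simp: monoms_le_def)
      then show ?thesis by (simp add: in_keys_iff)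
    qed
  qed
  moreover have "(\<lambda>m. restrict (Poly_Mapping.lookup m) A) ` monoms_le A p \<subseteq> A \<rightarrow>\<^sub>E {..p}"
  proof clarify
    fix m assume m: "m \<in> monoms_le A p"
    have "Poly_Mapping.lookup m v \<le> p" if "v \<in> A" for v
    proof -
      have "Poly_Mapping.lookup m v \<le> (\<Sum>v\<in>A. Poly_Mapping.lookup m v)"
        using that A by (intro member_le_sum) auto
      also have "\<dots> = mdeg m" using m A by (subst mdeg_superset[of A]) (auto simp: monoms_le_def)
      finally show ?thesis using m by (simp add: monoms_le_def)
    qed
    then show "restrict (Poly_Mapping.lookup m) A \<in> A \<rightarrow>\<^sub>E {..p}" by auto
  qed
  ultimately show ?thesis by (rule inj_on_finite) (use A in \<open>auto intro: finite_PiE\<close>)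
qed

lemma finite_coeff_index: "finite (coeff_index n s p)"
  by (simp add: coeff_index_def finite_monoms_le)

definition ceval :: "nat \<Rightarrow> nat \<Rightarrow> (nat \<times> (nat \<Rightarrow>\<^sub>0 nat) \<Rightarrow> 'a::comm_ring_1) \<Rightarrow> nat \<Rightarrow> (nat \<Rightarrow> 'a) \<Rightarrow> 'a" where
  "ceval n p c i x = (\<Sum>m\<in>monoms_le {..<n} p. c (i, m) * monom_eval x m)"

lemma ceval_coeff_vec:
  assumes "f \<in> {..<s} \<rightarrow>\<^sub>E polys_le {..<n} p" "i < s"
  shows "peval x (f i) = ceval n p (coeff_vec n s p f) i x"
proof -
  have "Poly_Mapping.keys (f i) \<subseteq> monoms_le {..<n} p" using assms by (auto simp: polys_le_def)
  then show ?thesis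
    using assms by (subst peval_superset[OF finite_monoms_le]) (auto simp: ceval_def coeff_vec_def coeff_index_def intro!: sum.cong)
qed

lemma poly_map_eq_iff:
  assumes "f \<in> {..<s} \<rightarrow>\<^sub>E polys_le {..<n} p"
  shows "poly_map s f y = poly_map s f x \<longleftrightarrow>
    (\<forall>i<s. ceval n p (coeff_vec n s p f) i y = ceval n p (coeff_vec n s p f) i x)"
  using ceval_coeff_vec[OF assms] unfolding poly_map_def by (auto simp: fun_eq_iff restrict_def)

lemma ceval_fring:
  assumes "function_ring R" "\<And>m. m \<in> monoms_le {..<n} p \<Longrightarrow> (\<lambda>w. c w (i, m)) \<in> R" "\<And>j. j < n \<Longrightarrow> (\<lambda>w. x w j) \<in> R"
  shows "(\<lambda>w. ceval n p (c w) i (x w)) \<in> R"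
proof -
  have "(\<lambda>w. monom_eval (x w) m) \<in> R" if "m \<in> monoms_le {..<n} p" for m
    using fring_polyfun_comp[OF assms(1) polyfuns_monom[of m "{..<n}"], of "\<lambda>j w. x w j"] that assms(3)
    by (auto simp: monoms_le_def)
  then show ?thesis unfolding ceval_def using assms(1,2) by (intro fring_sum fring_mult) auto
qed

lemma single_mem_monoms_le: "j < n \<Longrightarrow> k \<le> p \<Longrightarrow> Poly_Mapping.single j k \<in> monoms_le {..<n} p"
  by (auto simp: monoms_le_def)

section \<open>More polynomials than the dimension suffice\<close>

lemma sum_delta_mult:
  fixes g :: "'b \<Rightarrow> 'a::comm_semiring_1"
  shows "finite A \<Longrightarrow> a \<in> A \<Longrightarrow> (\<Sum>u\<in>A. (if u = a then t else 0) * g u) = t * g a"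
  by (simp add: sum.remove[of A a])

text \<open>Adding \<open>e\<close> to the coefficient \<open>(i, m)\<close> moves the point \<open>(c, f\<^sub>c(x))\<close> along a line: the \<open>i\<close>-th value changes
by \<open>e x\<^sup>m\<close>.  The relation holds along the whole line, so its derivative vanishes.\<close>

lemma differentiated_relation:
  fixes Q :: "((nat \<times> (nat \<Rightarrow>\<^sub>0 nat)) + nat, 'a::real_normed_field) mpoly"
  assumes Q: "Q \<in> polys (coeff_index n s p <+> {..<s})"
    and van: "\<And>c. peval (case_sum c (\<lambda>i. ceval n p c i x)) Q = 0"
    and im: "i < s" "m \<in> monoms_le {..<n} p"
  shows "peval (case_sum c (\<lambda>i. ceval n p c i x)) (pdiff (Inl (i, m)) Q)
      + monom_eval x m * peval (case_sum c (\<lambda>i. ceval n p c i x)) (pdiff (Inr i) Q) = 0"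
proof -
  let ?V = "coeff_index n s p" and ?h = "\<lambda>c. case_sum c (\<lambda>i. ceval n p c i x)"
  define \<delta> where "\<delta> = case_sum (\<lambda>u. if u = (i, m) then 1 else 0) (\<lambda>i'. if i' = i then monom_eval x m else 0)"
  have "peval (\<lambda>v. ?h c v + e * \<delta> v) Q = 0" for e
  proof -
    let ?c = "c((i, m) := c (i, m) + e)"
    have "ceval n p ?c i' x = ceval n p c i' x + (if i' = i then e * monom_eval x m else 0)" for i'
    proof -
      have "ceval n p ?c i' x = (\<Sum>m'\<in>monoms_le {..<n} p. c (i', m') * monom_eval x m'
          + (if m' = m then (if i' = i then e * monom_eval x m' else 0) else 0))"
        unfolding ceval_def by (intro sum.cong refl) (auto simp: distrib_right)
      then show ?thesis
        using im by (simp add: sum.distrib finite_monoms_le ceval_def)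
    qed
    then have "?h c v + e * \<delta> v = ?h ?c v" for v
      by (cases v) (auto simp: \<delta>_def)
    then show ?thesis using van[of ?c] by simp
  qed
  then have "(\<Sum>v\<in>?V <+> {..<s}. \<delta> v * peval (?h c) (pdiff v Q)) = 0"
    by (intro vanishing_derivative[OF _ Q]) (simp_all add: finite_coeff_index)
  moreover have "(\<Sum>v\<in>?V <+> {..<s}. \<delta> v * peval (?h c) (pdiff v Q)) =
      1 * peval (?h c) (pdiff (Inl (i, m)) Q) + monom_eval x m * peval (?h c) (pdiff (Inr i) Q)"
    using im sum_delta_mult[of ?V "(i, m)" 1 "\<lambda>u. peval (?h c) (pdiff (Inl u) Q)"]
      sum_delta_mult[of "{..<s}" i "monom_eval x m" "\<lambda>u. peval (?h c) (pdiff (Inr u) Q)"]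
    by (subst sum.Plus) (simp_all add: finite_coeff_index \<delta>_def comp_def, simp add: coeff_index_def)
  ultimately show ?thesis by simp
qed

text \<open>Where \<open>\<partial>Q/\<partial>t\<^sub>i\<close> does not vanish, each \<open>x\<^sub>j\<close> is a quotient of functions of \<open>(c, f\<^sub>c(x))\<close>.  The
denominator is itself a function of \<open>(c, f\<^sub>c(x))\<close>, so it takes the same nonzero value at every other point
of the fibre, and the fibre is a single point.\<close>

theorem generically_identifiable_generic:
  fixes X :: "(nat \<Rightarrow> 'a::real_normed_field) set"
  assumes X: "X \<subseteq> aff {..<n}" and dom: "function_domain X (polyfuns {..<n})"
    and p: "p \<ge> 1" and s: "s \<ge> model_dim n X + 1"
  shows "for_generic_polys n s p (\<lambda>f. generically_identifiable n X (poly_map s f))"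
proof -
  let ?V = "coeff_index n s p"
  let ?J = "?V <+> {..<s}"
  let ?\<Omega> = "(UNIV :: (nat \<times> (nat \<Rightarrow>\<^sub>0 nat) \<Rightarrow> 'a) set) \<times> X"
  define R where "R = {F :: (nat \<times> (nat \<Rightarrow>\<^sub>0 nat) \<Rightarrow> 'a) \<times> (nat \<Rightarrow> 'a) \<Rightarrow> 'a.
    (\<forall>x\<in>X. (\<lambda>c. F (c, x)) \<in> polyfuns ?V) \<and> (\<forall>c\<in>UNIV. (\<lambda>x. F (c, x)) \<in> polyfuns {..<n})}"
  have domR: "function_domain ?\<Omega> R" unfolding R_def by (rule fdom_Times[OF fdom_affine dom])
  define h where "h v w = case_sum (fst w) (\<lambda>i. ceval n p (fst w) i (snd w)) v"
    for v :: "(nat \<times> (nat \<Rightarrow>\<^sub>0 nat)) + nat" and w :: "(nat \<times> (nat \<Rightarrow>\<^sub>0 nat) \<Rightarrow> 'a) \<times> (nat \<Rightarrow> 'a)"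
  define crd where "crd = (\<lambda>j (w :: (nat \<times> (nat \<Rightarrow>\<^sub>0 nat) \<Rightarrow> 'a) \<times> (nat \<Rightarrow> 'a)). snd w j)"
  define cf where "cf = (\<lambda>v (w :: (nat \<times> (nat \<Rightarrow>\<^sub>0 nat) \<Rightarrow> 'a) \<times> (nat \<Rightarrow> 'a)). fst w v)"
  have crdR: "crd j \<in> R" if "j \<in> {..<n}" for j
    using that by (auto simp: R_def crd_def intro: fring_const[OF fring_polyfuns] polyfuns_var)
  have cfR: "cf v \<in> R" if "v \<in> ?V" for v
    using that by (auto simp: R_def cf_def intro: fring_const[OF fring_polyfuns] polyfuns_var)
  obtain S where S: "S \<subseteq> {..<n}" "alg_indep ?\<Omega> S crd" "growth ?\<Omega> R (crd ` {..<n}) (card S)"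
    using independent_subfamily[OF domR, of "{..<n}" crd] crdR by blast
  \<comment> \<open>Relations between coordinates do not involve the coefficients.\<close>
  have "alg_indep X S (\<lambda>j x. x j)" using S(2) by (auto simp: alg_indep_def crd_def)
  then have cS: "card S \<le> model_dim n X" by (rule indep_coords_le_model_dim[OF X dom S(1)])
  let ?H = "cf ` ?V \<union> crd ` {..<n}"
  have gr: "growth ?\<Omega> R ?H (card ?V + card S)" by (rule growth_union[OF finite_coeff_index S(3)])
  have "\<exists>k. pdeg ?H k (h v)" if "v \<in> ?J" for v
  proof -
    have c: "(\<lambda>w. fst w u) \<in> {f. \<exists>k. pdeg ?H k f}" if "u \<in> ?V" for u
      using pdeg_mem[of "cf u" ?H] that by (auto simp: cf_def)
    have x: "(\<lambda>w. snd w j) \<in> {f. \<exists>k. pdeg ?H k f}" if "j < n" for j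
      using pdeg_mem[of "crd j" ?H] that by (auto simp: crd_def)
    have "h v \<in> {f. \<exists>k. pdeg ?H k f}"
    proof (cases v)
      case (Inl u)
      then have "u \<in> ?V" using that by auto
      from c[OF this] show ?thesis unfolding h_def Inl by simp
    next
      case (Inr i)
      then show ?thesis unfolding h_def using that
        by simp (intro CollectD[OF ceval_fring[OF fring_pdeg c x]], auto simp: coeff_index_def)
    qed
    then show ?thesis by simp
  qed
  then have "\<not> alg_indep ?\<Omega> ?J h"
    using alg_indep_le_growth[OF domR gr _ _ _, of ?J h] cfR crdR cS s
    by (fastforce simp: card_Plus finite_coeff_index)
  then obtain P where P: "P \<in> polys ?J" "P \<noteq> 0" "\<And>w. w \<in> ?\<Omega> \<Longrightarrow> peval (\<lambda>v. h v w) P = 0"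
    by (rule alg_depE) (rule that)
  obtain Q v where Q: "Q \<in> polys ?J" "\<And>w. w \<in> ?\<Omega> \<Longrightarrow> peval (\<lambda>v. h v w) Q = 0"
    and v: "v \<in> ?J" "\<exists>w\<in>?\<Omega>. peval (\<lambda>v. h v w) (pdiff v Q) \<noteq> 0"
    by (rule minimal_relation[of ?\<Omega> P ?J h, OF fdom_ne[OF domR] P]) (assumption | rule that)+
  define G where "G v c x = peval (case_sum c (\<lambda>i. ceval n p c i x)) (pdiff v Q)" for v c x
  have dr: "G (Inl (i, m)) c x + monom_eval x m * G (Inr i) c x = 0"
    if "x \<in> X" "i < s" "m \<in> monoms_le {..<n} p" for i m c x
    unfolding G_def using Q(2)[of "(c, x)" for c] that
    by (intro differentiated_relation[OF Q(1)]) (simp_all add: h_def)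
  have "\<exists>i<s. \<exists>c. \<exists>x\<in>X. G (Inr i) c x \<noteq> 0"
  proof -
    obtain c x where cx: "x \<in> X" "G v c x \<noteq> 0" using v(2) by (auto simp: G_def h_def)
    show ?thesis
    proof (cases v)
      case (Inl u)
      obtain i m where u: "u = (i, m)" "i < s" "m \<in> monoms_le {..<n} p"
        using v(1) Inl by (auto simp: coeff_index_def)
      then have "G (Inr i) c x \<noteq> 0" using dr[OF cx(1) u(2,3), of c] cx(2) Inl by auto
      then show ?thesis using u cx by blast
    qed (use v(1) cx in auto)
  qed
  then obtain i c1 x1 where i: "i < s" and x1: "x1 \<in> X" "G (Inr i) c1 x1 \<noteq> 0" by blast
  have Gc: "(\<lambda>c. G v c x) \<in> polyfuns ?V" for v x
    unfolding G_def
  proof (rule fring_peval[OF fring_polyfuns polys_pdiff[OF Q(1)]])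
    fix u assume "u \<in> ?J"
    then show "(\<lambda>c. case_sum c (\<lambda>i. ceval n p c i x) u) \<in> polyfuns ?V"
      by (auto intro!: polyfuns_var ceval_fring[OF fring_polyfuns] fring_const[OF fring_polyfuns] simp: coeff_index_def)
  qed
  have Gx: "(\<lambda>x. G v c x) \<in> polyfuns {..<n}" for v c
    unfolding G_def
  proof (rule fring_peval[OF fring_polyfuns polys_pdiff[OF Q(1)]])
    fix u assume "u \<in> ?J"
    then show "(\<lambda>x. case_sum c (\<lambda>i. ceval n p c i x) u) \<in> polyfuns {..<n}"
      by (auto intro!: polyfuns_var ceval_fring[OF fring_polyfuns] fring_const[OF fring_polyfuns])
  qed
  let ?W = "{c \<in> aff ?V. G (Inr i) c x1 \<noteq> 0}"
  show ?thesis unfolding for_generic_polys_def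
  proof (intro exI[of _ ?W] conjI ballI impI)
    show "openin (zariski ?V) ?W" by (rule openin_nonvanishing[OF Gc])
    have "G (Inr i) (restrict c1 ?V) x1 = G (Inr i) c1 x1" by (rule polyfuns_cong[OF Gc]) simp
    then have "restrict c1 ?V \<in> ?W" using x1 by (simp add: aff_def)
    then show "?W \<noteq> {}" by blast
  next
    fix f :: "nat \<Rightarrow> (nat, 'a) mpoly"
    assume f: "f \<in> {..<s} \<rightarrow>\<^sub>E polys_le {..<n} p" and W: "coeff_vec n s p f \<in> ?W"
    define c where "c = coeff_vec n s p f"
    let ?U = "{x \<in> aff {..<n}. G (Inr i) c x \<noteq> 0} \<inter> (zariski {..<n} closure_of X)"
    show "generically_identifiable n X (poly_map s f)"
      unfolding generically_identifiable_def
    proof (intro exI[of _ ?U] conjI ballI)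
      show "openin (subtopology (zariski {..<n}) (zariski {..<n} closure_of X)) ?U"
        unfolding openin_subtopology using openin_nonvanishing[OF Gx] by blast
      have "x1 \<in> ?U" using x1 X subset_closure[OF X] W by (auto simp: c_def)
      then show "?U \<noteq> {}" by blast
      fix x assume x: "x \<in> X \<inter> ?U"
      have "y = x" if y: "y \<in> X" "poly_map s f y = poly_map s f x" for y
      proof -
        have eq: "ceval n p c i y = ceval n p c i x" if "i < s" for i
          using y(2) that unfolding poly_map_eq_iff[OF f] c_def by blast
        have Geq: "G u c y = G u c x" for u
          unfolding G_def by (rule peval_cong[OF polys_pdiff[OF Q(1)]]) (use eq in auto)
        have "y j = x j" if j: "j < n" for j
        proof -
          have mj: "Poly_Mapping.single j 1 \<in> monoms_le {..<n} p" using single_mem_monoms_le j p by blast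
          have "y j * G (Inr i) c x = x j * G (Inr i) c x"
            using dr[OF y(1) i mj, of c] dr[OF _ i mj, of x c] x
            by (simp add: Geq monom_eval_single add_eq_0_iff)
          then show ?thesis using x by simp
        qed
        moreover have "y \<in> {..<n} \<rightarrow>\<^sub>E UNIV" "x \<in> {..<n} \<rightarrow>\<^sub>E UNIV" using y(1) x X by (auto simp: aff_def)
        ultimately show ?thesis by (intro PiE_ext) auto
      qed
      then show "identifiable_at X (poly_map s f) x" using x by (auto simp: identifiable_at_def)
    qed
  qed
qed

section \<open>Models as images\<close>

lemma fdom_aff: "function_domain (aff V) (polyfuns V :: (('v \<Rightarrow> 'a::field_char_0) \<Rightarrow> 'a) set)"
  unfolding function_domain_def
proof (intro conjI ballI impI)
  fix F G :: "('v \<Rightarrow> 'a) \<Rightarrow> 'a" assume F: "F \<in> polyfuns V" and G: "G \<in> polyfuns V"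
    and "\<exists>w\<in>aff V. F w \<noteq> 0" "\<exists>w\<in>aff V. G w \<noteq> 0"
  then obtain w where "F w \<noteq> 0" "G w \<noteq> 0" using fdom_both[OF fdom_affine F G] by blast
  moreover have "F (restrict w V) = F w" "G (restrict w V) = G w"
    by (rule polyfuns_cong[OF F], simp) (rule polyfuns_cong[OF G], simp)
  ultimately show "\<exists>w\<in>aff V. F w \<noteq> 0 \<and> G w \<noteq> 0"
    by (intro bexI[of _ "restrict w V"]) (auto simp: aff_def)
qed (auto simp: fring_polyfuns aff_def PiE_eq_empty_iff)

lemma fdom_irreducible:
  fixes X :: "(nat \<Rightarrow> 'a::field) set"
  assumes "irreducible_variety n X"
  shows "function_domain X (polyfuns {..<n})"
  unfolding function_domain_def
proof (intro conjI ballI impI)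
  show "X \<noteq> {}" using assms by (simp add: irreducible_variety_def)
  fix F G :: "(nat \<Rightarrow> 'a) \<Rightarrow> 'a" assume F: "F \<in> polyfuns {..<n}" and G: "G \<in> polyfuns {..<n}"
    and nz: "\<exists>w\<in>X. F w \<noteq> 0" "\<exists>w\<in>X. G w \<noteq> 0"
  have cl: "closedin (zariski {..<n}) X" using assms by (simp add: irreducible_variety_def)
  have "closedin (zariski {..<n}) {x \<in> X. H x = 0}" if H: "H \<in> polyfuns {..<n}" for H :: "(nat \<Rightarrow> 'a) \<Rightarrow> 'a"
  proof -
    have "closedin (zariski {..<n}) (X - {x \<in> aff {..<n}. H x \<noteq> 0})"
      using cl openin_nonvanishing[OF H] by (rule closedin_diff)
    moreover have "X - {x \<in> aff {..<n}. H x \<noteq> 0} = {x \<in> X. H x = 0}"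
      using closedin_subset[OF cl] by auto
    ultimately show ?thesis by simp
  qed
  from this[OF F] this[OF G] have c: "closedin (zariski {..<n}) {x \<in> X. F x = 0}" "closedin (zariski {..<n}) {x \<in> X. G x = 0}" .
  show "\<exists>w\<in>X. F w \<noteq> 0 \<and> G w \<noteq> 0"
  proof (rule ccontr)
    assume "\<not> ?thesis"
    then have "X = {x \<in> X. F x = 0} \<union> {x \<in> X. G x = 0}" by blast
    moreover have "{x \<in> X. F x = 0} \<subset> X" "{x \<in> X. G x = 0} \<subset> X" using nz by auto
    ultimately show False using assms c unfolding irreducible_variety_def by blast
  qed
qed (rule fring_polyfuns)

text \<open>A common form of both kinds of models: an implicit model is the image of itself under the identity, an
explicit one is the image of the zero set of no equations.\<close>

lemma model_as_image:
  fixes X :: "(nat \<Rightarrow> 'a::field_char_0) set"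
  assumes "is_model n X"
  obtains l \<phi> F where "\<And>i. i < n \<Longrightarrow> \<phi> i \<in> polys {..<l::nat}" "F \<subseteq> polys {..<l}"
    "function_domain (zeros {..<l} F) (polyfuns {..<l})" "X = poly_map n \<phi> ` zeros {..<l} F"
  using assms unfolding is_model_def
proof
  assume "implicit_model n X"
  then have irr: "irreducible_variety n X" by (simp add: implicit_model_def)
  then have "closedin (zariski {..<n}) X" by (simp add: irreducible_variety_def)
  then obtain F where F: "F \<subseteq> polys {..<n}" "X = zeros {..<n} F" unfolding closedin_zariski by blast
  define \<phi> :: "nat \<Rightarrow> (nat, 'a) mpoly" where "\<phi> i = Poly_Mapping.single (Poly_Mapping.single i 1) 1" for i
  have "poly_map n \<phi> x = x" if "x \<in> X" for x
  proof -
    have "x \<in> {..<n} \<rightarrow>\<^sub>E UNIV" using that F by (simp add: zeros_def aff_def)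
    then have "restrict x {..<n} = x" by (rule PiE_restrict)
    then show ?thesis by (simp add: poly_map_def \<phi>_def monom_eval_single)
  qed
  then have "poly_map n \<phi> ` X = (\<lambda>x. x) ` X" by (intro image_cong refl)
  moreover have "\<phi> i \<in> polys {..<n}" if "i < n" for i
    unfolding \<phi>_def using that by (intro polys_single) simp
  ultimately show thesis
    using that[of \<phi> n F] F fdom_irreducible[OF irr] by simp
next
  assume "explicit_model n X"
  then obtain l \<phi> where "\<forall>i<n. \<phi> i \<in> polys {..<l::nat}" "X = poly_map n \<phi> ` aff {..<l}"
    by (auto simp: explicit_model_def)
  moreover have "zeros {..<l} {} = (aff {..<l} :: (nat \<Rightarrow> 'a) set)" by (auto simp: zeros_def)
  ultimately show thesis using that[of \<phi> l "{}"] fdom_aff[of "{..<l}"] by simp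
qed

lemma poly_map_polyfun:
  fixes \<phi> :: "nat \<Rightarrow> ('v, 'a::comm_ring_1) mpoly"
  assumes "\<And>i. i < n \<Longrightarrow> \<phi> i \<in> polys V" "i < n"
  shows "(\<lambda>x. poly_map n \<phi> x i) \<in> polyfuns V"
  using polyfunsI[OF assms(1)[OF assms(2)]] assms(2) by (simp add: poly_map_def)

lemma fdom_image:
  fixes \<phi> :: "nat \<Rightarrow> ('v, 'a::field) mpoly"
  assumes dom: "function_domain Y (polyfuns V)" and \<phi>: "\<And>i. i < n \<Longrightarrow> \<phi> i \<in> polys V"
  shows "function_domain (poly_map n \<phi> ` Y) (polyfuns {..<n})"
  unfolding function_domain_def
proof (intro conjI ballI impI)
  show "poly_map n \<phi> ` Y \<noteq> {}" using fdom_ne[OF dom] by simp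
  fix F G :: "(nat \<Rightarrow> 'a) \<Rightarrow> 'a" assume F: "F \<in> polyfuns {..<n}" and G: "G \<in> polyfuns {..<n}"
    and "\<exists>w\<in>poly_map n \<phi> ` Y. F w \<noteq> 0" "\<exists>w\<in>poly_map n \<phi> ` Y. G w \<noteq> 0"
  moreover have "(\<lambda>y. H (poly_map n \<phi> y)) \<in> polyfuns V" if "H \<in> polyfuns {..<n}" for H
    using fring_polyfun_comp[OF fring_polyfuns that, of "\<lambda>i y. poly_map n \<phi> y i"] poly_map_polyfun[of n \<phi> V] \<phi> by simp
  ultimately show "\<exists>w\<in>poly_map n \<phi> ` Y. F w \<noteq> 0 \<and> G w \<noteq> 0"
    using fdom_both[OF dom, of "\<lambda>y. F (poly_map n \<phi> y)" "\<lambda>y. G (poly_map n \<phi> y)"] by auto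
qed (rule fring_polyfuns)

lemma poly_map_aff: "poly_map n \<phi> x \<in> aff {..<n}"
  by (simp add: poly_map_def aff_def)

section \<open>At most as many polynomials as the dimension do not suffice\<close>

lemma nonconstant_coordinate:
  fixes X :: "(nat \<Rightarrow> 'a::real_normed_field) set"
  assumes X: "X \<subseteq> aff {..<n}" and dom: "function_domain X (polyfuns {..<n})" and d: "model_dim n X > 0"
  shows "\<exists>j<n. \<exists>x\<in>X. \<exists>y\<in>X. x j \<noteq> y j"
proof (rule ccontr)
  assume neg: "\<not> ?thesis"
  obtain x0 where x0: "x0 \<in> X" using fdom_ne[OF dom] by blast
  have "x = x0" if x: "x \<in> X" for x
    using neg x0 x X unfolding aff_def by (intro PiE_ext[of x "{..<n}" "\<lambda>_. UNIV" x0]) blast+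
  obtain g where g: "alg_indep X {..<model_dim n X} (\<lambda>i x. peval x (g i))"
    by (rule model_dim_attained[OF X dom])
  define P :: "(nat, 'a) mpoly" where "P = Poly_Mapping.single (Poly_Mapping.single 0 1) 1 + Poly_Mapping.single 0 (- peval x0 (g 0))"
  have ev: "peval z P = z 0 - peval x0 (g 0)" for z :: "nat \<Rightarrow> 'a"
    by (simp add: P_def peval_add monom_eval_single) (simp add: monom_eval_def)
  have "P \<in> polys {..<model_dim n X}" unfolding P_def using d by (intro polys_add polys_single) auto
  moreover have "P \<noteq> 0" using ev[of "\<lambda>_. peval x0 (g 0) + 1"] by auto
  ultimately obtain x where "x \<in> X" "peval (\<lambda>i. peval x (g i)) P \<noteq> 0" using alg_indepD[OF g] by blast
  then show False using \<open>\<And>x. x \<in> X \<Longrightarrow> x = x0\<close> by (auto simp: ev)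
qed

lemma growth_union_rational:
  assumes dom: "function_domain \<Omega> R" and gr: "growth \<Omega> R H r" and K: "finite K"
    and rat: "\<And>k. k \<in> K \<Longrightarrow> \<exists>q a D. q \<in> R \<and> (\<exists>w\<in>\<Omega>. q w \<noteq> 0) \<and> pdeg H D q \<and> pdeg H D a \<and> (\<forall>w\<in>\<Omega>. q w * h k w = a w)"
  shows "growth \<Omega> R (h ` K \<union> H) r"
  using K rat
proof (induction K rule: finite_induct)
  case (insert k K)
  obtain q a D where q: "q \<in> R" "\<exists>w\<in>\<Omega>. q w \<noteq> 0" "pdeg H D q" "pdeg H D a" "\<forall>w\<in>\<Omega>. q w * h k w = a w"
    using insert.prems[of k] by auto
  have "growth \<Omega> R (insert (h k) (h ` K \<union> H)) r"
    by (rule growth_insert_rational[OF dom _ q(1,2) pdeg_subset[OF q(3)] pdeg_subset[OF q(4)]])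
       (use insert q in auto)
  then show ?case by simp
qed (use gr in simp)

text \<open>A nonzero polynomial stays nonzero when the variables in \<open>V\<close> are given suitable constant values.\<close>

lemma alg_indep_Plus:
  fixes g :: "'i \<Rightarrow> 'x \<Rightarrow> 'a::real_normed_field"
  assumes g: "alg_indep X I g" and fin: "finite V" "finite I"
  shows "alg_indep (UNIV \<times> X) (V <+> I) (\<lambda>v w. case_sum (fst w) (\<lambda>i. g i (snd w)) v)"
  unfolding alg_indep_def
proof (intro ballI impI)
  fix P :: "('b + 'i, 'a) mpoly" assume P: "P \<in> polys (V <+> I)" "P \<noteq> 0"
  obtain z where z: "peval z P \<noteq> 0" by (rule nonzero_poly_point[OF _ P]) (use fin in auto)
  have "(\<lambda>t. peval (\<lambda>v. case_sum (\<lambda>u. z (Inl u)) t v) P) \<in> polyfuns I"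
    by (rule fring_peval[OF fring_polyfuns P(1)]) (auto intro: fring_const[OF fring_polyfuns] polyfuns_var)
  then obtain P' where P': "P' \<in> polys I" "(\<lambda>t. peval (case_sum (\<lambda>u. z (Inl u)) t) P) = (\<lambda>t. peval t P')"
    by (rule polyfunsE)
  have "peval (\<lambda>i. z (Inr i)) P' = peval z P"
    unfolding fun_cong[OF P'(2), symmetric] by (rule peval_cong[OF P(1)]) auto
  then have "P' \<noteq> 0" using z by auto
  then obtain y where y: "y \<in> X" "peval (\<lambda>i. g i y) P' \<noteq> 0" using alg_indepD[OF g P'(1)] by blast
  then have "peval (\<lambda>v. case_sum (\<lambda>u. z (Inl u)) (\<lambda>i. g i y) v) P \<noteq> 0"
    using fun_cong[OF P'(2), of "\<lambda>i. g i y"] by simp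
  then show "\<exists>w\<in>UNIV \<times> X. peval (\<lambda>v. case_sum (fst w) (\<lambda>i. g i (snd w)) v) P \<noteq> 0"
    using y(1) by (intro bexI[of _ "(\<lambda>u. z (Inl u), y)"]) (simp_all only: fst_conv snd_conv, simp_all)
qed

text \<open>The condition that the \<open>i\<close>-th polynomials take the same value at \<open>x\<close> and \<open>y\<close> is one linear equation
\<open>\<Sum>\<^sub>m c\<^sub>i\<^sub>m (x\<^sup>m - y\<^sup>m) = 0\<close> for the coefficients.  It is solved for the coefficient of the variable \<open>j\<close>; the
parameters \<open>b\<close> are scaled by \<open>x\<^sub>j - y\<^sub>j\<close> to keep the solution polynomial.\<close>

definition collide :: "nat \<Rightarrow> nat \<Rightarrow> nat \<Rightarrow> (nat \<times> (nat \<Rightarrow>\<^sub>0 nat) \<Rightarrow> 'a::comm_ring_1) \<Rightarrow> (nat \<Rightarrow> 'a) \<Rightarrow> (nat \<Rightarrow> 'a)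
    \<Rightarrow> nat \<times> (nat \<Rightarrow>\<^sub>0 nat) \<Rightarrow> 'a" where
  "collide n p j b x y = (\<lambda>(i, m). if m = Poly_Mapping.single j 1
     then - (\<Sum>m'\<in>monoms_le {..<n} p - {Poly_Mapping.single j 1}. b (i, m') * (monom_eval x m' - monom_eval y m'))
     else (x j - y j) * b (i, m))"

lemma ceval_collide:
  assumes "j < n" "p \<ge> 1"
  shows "ceval n p (collide n p j b x y) i x = ceval n p (collide n p j b x y) i y"
proof -
  let ?M = "monoms_le {..<n} p" and ?e = "Poly_Mapping.single j (1::nat)" and ?c = "collide n p j b x y"
  let ?d = "\<lambda>m. monom_eval x m - monom_eval y m"
  have e: "?e \<in> ?M" using single_mem_monoms_le assms by blast
  have "ceval n p ?c i x - ceval n p ?c i y = (\<Sum>m\<in>?M. ?c (i, m) * ?d m)"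
    by (simp add: ceval_def sum_subtractf right_diff_distrib)
  also have "\<dots> = ?c (i, ?e) * ?d ?e + (\<Sum>m\<in>?M - {?e}. ?c (i, m) * ?d m)"
    using e by (simp add: sum.remove finite_monoms_le)
  also have "(\<Sum>m\<in>?M - {?e}. ?c (i, m) * ?d m) = (x j - y j) * (\<Sum>m\<in>?M - {?e}. b (i, m) * ?d m)"
    unfolding sum_distrib_left by (intro sum.cong refl) (auto simp: collide_def mult_ac)
  also have "?c (i, ?e) * ?d ?e = - ((x j - y j) * (\<Sum>m\<in>?M - {?e}. b (i, m) * ?d m))"
    by (simp add: collide_def monom_eval_single mult.commute)
  finally show ?thesis by simp
qed

lemma collide_fring:
  assumes R: "function_ring R" and b: "\<And>m'. m' \<in> monoms_le {..<n} p \<Longrightarrow> (\<lambda>w. b w (i, m')) \<in> R"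
    and x: "\<And>k. k < n \<Longrightarrow> (\<lambda>w. x w k) \<in> R" and y: "\<And>k. k < n \<Longrightarrow> (\<lambda>w. y w k) \<in> R"
    and jm: "j < n" "m \<in> monoms_le {..<n} p"
  shows "(\<lambda>w. collide n p j (b w) (x w) (y w) (i, m)) \<in> R"
proof -
  have mx: "(\<lambda>w. monom_eval (x w) m) \<in> R" "(\<lambda>w. monom_eval (y w) m) \<in> R" if "m \<in> monoms_le {..<n} p" for m
    using fring_polyfun_comp[OF R polyfuns_monom[of m "{..<n}"], of "\<lambda>j w. x w j"]
      fring_polyfun_comp[OF R polyfuns_monom[of m "{..<n}"], of "\<lambda>j w. y w j"] that x y
    by (auto simp: monoms_le_def)
  show ?thesis
  proof (cases "m = Poly_Mapping.single j 1")
    case True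
    then show ?thesis unfolding collide_def using b mx
      by simp (intro fring_uminus[OF R] fring_sum[OF R] fring_mult[OF R] fring_diff[OF R], auto)
  next
    case False
    then show ?thesis unfolding collide_def using b x y jm
      by simp (intro fring_mult[OF R] fring_diff[OF R], auto)
  qed
qed

text \<open>The parameter \<open>b(i, m)\<close> enters only the coefficients of \<open>m\<close> and of the variable \<open>j\<close> in the \<open>i\<close>-th
polynomial, and linearly.\<close>

lemma collide_derivative:
  fixes Q :: "(nat \<times> (nat \<Rightarrow>\<^sub>0 nat), 'a::real_normed_field) mpoly"
  assumes Q: "Q \<in> polys (coeff_index n s p)" and van: "\<And>b. peval (collide n p j b x y) Q = 0"
    and im: "i < s" "m \<in> monoms_le {..<n} p" and j: "j < n" "p \<ge> 1"
  shows "(x j - y j) * peval (collide n p j b x y) (pdiff (i, m) Q) =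
    (monom_eval x m - monom_eval y m) * peval (collide n p j b x y) (pdiff (i, Poly_Mapping.single j 1) Q)"
proof (cases "m = Poly_Mapping.single j 1")
  case False
  let ?e = "Poly_Mapping.single j (1::nat)" and ?V = "coeff_index n s p" and ?C = "\<lambda>b. collide n p j b x y"
  let ?d = "\<lambda>m. monom_eval x m - monom_eval y m"
  define \<delta> where "\<delta> v = (if v = (i, m) then x j - y j else 0) + (if v = (i, ?e) then - ?d m else 0)" for v
  have V: "(i, m) \<in> ?V" "(i, ?e) \<in> ?V"
    using im single_mem_monoms_le[OF j] by (auto simp: coeff_index_def)
  have "peval (\<lambda>v. ?C b v + t * \<delta> v) Q = 0" for t
  proof -
    let ?b = "b((i, m) := b (i, m) + t)"
    have "?C b v + t * \<delta> v = ?C ?b v" for v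
    proof -
      obtain i' m' where v: "v = (i', m')" by force
      have "(\<Sum>m'\<in>monoms_le {..<n} p - {?e}. ?b (i', m') * ?d m')
          = (\<Sum>m'\<in>monoms_le {..<n} p - {?e}. b (i', m') * ?d m' + (if m' = m then (if i' = i then t * ?d m' else 0) else 0))"
        by (intro sum.cong refl) (auto simp: distrib_right)
      also have "\<dots> = (\<Sum>m'\<in>monoms_le {..<n} p - {?e}. b (i', m') * ?d m') + (if i' = i then t * ?d m else 0)"
        using im False by (simp add: sum.distrib finite_monoms_le)
      finally show ?thesis using False
        by (auto simp: v collide_def \<delta>_def algebra_simps simp del: fun_upd_apply) (auto simp: algebra_simps)
    qed
    then show ?thesis using van[of ?b] by simp
  qed
  then have "(\<Sum>v\<in>?V. \<delta> v * peval (?C b) (pdiff v Q)) = 0"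
    by (rule vanishing_derivative[OF finite_coeff_index Q])
  moreover have "(\<Sum>v\<in>?V. \<delta> v * peval (?C b) (pdiff v Q)) =
      (x j - y j) * peval (?C b) (pdiff (i, m) Q) + (- ?d m) * peval (?C b) (pdiff (i, ?e) Q)"
    unfolding \<delta>_def distrib_right sum.distrib
    by (simp only: sum_delta_mult[OF finite_coeff_index V(1)] sum_delta_mult[OF finite_coeff_index V(2)])
  ultimately show ?thesis by (simp add: algebra_simps)
qed (simp add: monom_eval_single)

text \<open>Suppose the coefficients of \<open>collide\<close>, as functions of \<open>(b, y)\<close> for fixed \<open>x\<close>, satisfy a relation \<open>Q\<close>.
By \<open>collide_derivative\<close> its gradient in the coefficients of a single polynomial is proportional to the
vector of all \<open>x\<^sup>m - y\<^sup>m\<close>, and by \<open>minimal_relation\<close> one of these gradients can be assumed nonzero.  As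
\<open>p \<ge> 2\<close>, it determines \<open>y\<close> when \<open>x\<close> is given.  So \<open>y\<close>, and with it \<open>b\<close>, is rational over the coefficients.  The
coefficients then have growth of order less than their number \<open>N\<close>, but \<open>N - s\<close> parameters together with
\<open>d\<close> independent functions of \<open>y\<close> are independent.\<close>

lemma collide_independent:
  fixes X :: "(nat \<Rightarrow> 'a::real_normed_field) set"
  assumes X: "X \<subseteq> aff {..<n}" and dom: "function_domain X (polyfuns {..<n})"
    and p: "p \<ge> 2" and s: "s \<le> model_dim n X" and j: "j < n" and nc: "\<exists>y\<in>X. y j \<noteq> x j"
  shows "alg_indep (UNIV \<times> X) (coeff_index n s p) (\<lambda>v w. collide n p j (fst w) x (snd w) v)"
proof (rule ccontr)
  let ?V = "coeff_index n s p" and ?M = "monoms_le {..<n} p" and ?e = "Poly_Mapping.single j (1::nat)"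
  let ?\<Omega> = "(UNIV :: (nat \<times> (nat \<Rightarrow>\<^sub>0 nat) \<Rightarrow> 'a) set) \<times> X"
  define C where "C v w = collide n p j (fst w) x (snd w) v"
    for v and w :: "(nat \<times> (nat \<Rightarrow>\<^sub>0 nat) \<Rightarrow> 'a) \<times> (nat \<Rightarrow> 'a)"
  assume "\<not> alg_indep ?\<Omega> ?V (\<lambda>v w. collide n p j (fst w) x (snd w) v)"
  then have dep: "\<not> alg_indep ?\<Omega> ?V C" by (simp add: C_def[abs_def])
  define R where "R = {F :: (nat \<times> (nat \<Rightarrow>\<^sub>0 nat) \<Rightarrow> 'a) \<times> (nat \<Rightarrow> 'a) \<Rightarrow> 'a.
    (\<forall>x\<in>X. (\<lambda>c. F (c, x)) \<in> polyfuns ?V) \<and> (\<forall>c\<in>UNIV. (\<lambda>x. F (c, x)) \<in> polyfuns {..<n})}"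
  have domR: "function_domain ?\<Omega> R" unfolding R_def by (rule fdom_Times[OF fdom_affine dom])
  note fR = fdom_fring[OF domR]
  define crd where "crd = (\<lambda>j (w :: (nat \<times> (nat \<Rightarrow>\<^sub>0 nat) \<Rightarrow> 'a) \<times> (nat \<Rightarrow> 'a)). snd w j)"
  define cf where "cf = (\<lambda>v (w :: (nat \<times> (nat \<Rightarrow>\<^sub>0 nat) \<Rightarrow> 'a) \<times> (nat \<Rightarrow> 'a)). fst w v)"
  have crdR: "crd k \<in> R" if "k < n" for k
    using that by (auto simp: R_def crd_def intro: fring_const[OF fring_polyfuns] polyfuns_var)
  have cfR: "cf v \<in> R" if "v \<in> ?V" for v
    using that by (auto simp: R_def cf_def intro: fring_const[OF fring_polyfuns] polyfuns_var)
  have CR: "C v \<in> R" if "v \<in> ?V" for v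
  proof -
    obtain i m where v: "v = (i, m)" "i < s" "m \<in> ?M" using \<open>v \<in> ?V\<close> by (auto simp: coeff_index_def)
    have "(\<lambda>w. fst w (i, m')) \<in> R" if "m' \<in> ?M" for m'
      using cfR[of "(i, m')"] that v by (auto simp: cf_def coeff_index_def)
    moreover have "(\<lambda>w. snd w k) \<in> R" if "k < n" for k using crdR[OF that] by (simp add: crd_def)
    ultimately show ?thesis unfolding C_def v by (intro collide_fring[OF fR] fring_const[OF fR] j v(3))
  qed
  obtain P where P: "P \<in> polys ?V" "P \<noteq> 0" "\<And>w. w \<in> ?\<Omega> \<Longrightarrow> peval (\<lambda>v. C v w) P = 0"
    by (rule alg_depE[OF dep]) (rule that)
  obtain Q u where Q: "Q \<in> polys ?V" "\<And>w. w \<in> ?\<Omega> \<Longrightarrow> peval (\<lambda>v. C v w) Q = 0"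
    and u: "u \<in> ?V" "\<exists>w\<in>?\<Omega>. peval (\<lambda>v. C v w) (pdiff u Q) \<noteq> 0"
    by (rule minimal_relation[of ?\<Omega> P ?V C, OF fdom_ne[OF domR] P]) (assumption | rule that)+
  define G where "G v w = peval (\<lambda>v. C v w) (pdiff v Q)" for v w
  define \<Delta> where "\<Delta> w = x j - crd j w" for w
  have GR: "G v \<in> R" for v
    unfolding G_def by (rule fring_peval[OF fR polys_pdiff[OF Q(1)] CR])
  have \<Delta>R: "\<Delta> \<in> R" unfolding \<Delta>_def using crdR[OF j] by (intro fring_diff[OF fR] fring_const[OF fR])
  have \<Delta>nz: "\<exists>w\<in>?\<Omega>. \<Delta> w \<noteq> 0" using nc by (force simp: \<Delta>_def crd_def)
  have der: "\<Delta> w * G (i, m) w = (monom_eval x m - monom_eval (snd w) m) * G (i, ?e) w"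
    if "i < s" "m \<in> ?M" "w \<in> ?\<Omega>" for i m w
    using collide_derivative[of Q n s p j x "snd w" i m "fst w"] Q that j p
    by (auto simp: \<Delta>_def G_def C_def crd_def)
  obtain i m0 where i: "i < s" "m0 \<in> ?M" "\<exists>w\<in>?\<Omega>. G (i, m0) w \<noteq> 0"
    using u by (auto simp: G_def coeff_index_def)
  define B where "B = G (i, ?e)"
  have Bnz: "\<exists>w\<in>?\<Omega>. B w \<noteq> 0"
  proof (rule ccontr)
    assume "\<not> ?thesis"
    then have "\<Delta> w * G (i, m0) w = 0" if "w \<in> ?\<Omega>" for w using der[OF i(1,2) that] that by (auto simp: B_def)
    then have "G (i, m0) w = 0" if "w \<in> ?\<Omega>" for w
      using fdom_cancel[OF domR \<Delta>R GR \<Delta>nz _ that] by blast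
    then show False using i(3) by blast
  qed
  have BR: "B \<in> R" unfolding B_def by (rule GR)
  \<comment> \<open>\<open>x\<^sub>j\<^sup>2 - y\<^sub>j\<^sup>2\<close> is divisible by \<open>x\<^sub>j - y\<^sub>j\<close> with quotient \<open>x\<^sub>j + y\<^sub>j\<close>, so the square of the
    coordinate gives \<open>y\<^sub>j\<close> itself; monomials of degree one only give ratios of differences.\<close>
  let ?e2 = "Poly_Mapping.single j (2::nat)"
  have quad: "B w * crd j w = G (i, ?e2) w - x j * B w" if w: "w \<in> ?\<Omega>" for w
  proof -
    have "G (i, ?e2) w - (x j + crd j w) * B w = 0"
    proof (rule fdom_cancel[OF domR \<Delta>R _ \<Delta>nz _ w])
      show "(\<lambda>w. G (i, ?e2) w - (x j + crd j w) * B w) \<in> R"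
        by (intro fring_diff[OF fR] fring_mult[OF fR] fring_add[OF fR] fring_const[OF fR] GR BR crdR j)
      fix w assume w: "w \<in> ?\<Omega>"
      have "?e2 \<in> ?M" using single_mem_monoms_le j p by blast
      from der[OF i(1) this w] show "\<Delta> w * (G (i, ?e2) w - (x j + crd j w) * B w) = 0"
        by (simp add: B_def \<Delta>_def crd_def monom_eval_single algebra_simps power2_eq_square)
    qed
    then show ?thesis by (simp add: algebra_simps)
  qed
  have lin: "B w * crd k w = x k * B w - \<Delta> w * G (i, Poly_Mapping.single k 1) w" if "k < n" "w \<in> ?\<Omega>" for k w
  proof -
    have "Poly_Mapping.single k 1 \<in> ?M" using single_mem_monoms_le that p by force
    from der[OF i(1) this that(2)] show ?thesis
      by (simp add: B_def crd_def monom_eval_single algebra_simps)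
  qed
  have "\<exists>S\<subseteq>?V. alg_indep ?\<Omega> S C \<and> growth ?\<Omega> R (C ` ?V) (card S)"
    by (rule independent_subfamily[OF domR finite_coeff_index CR])
  then obtain S where S: "S \<subseteq> ?V" "alg_indep ?\<Omega> S C" "growth ?\<Omega> R (C ` ?V) (card S)" by blast
  have "S \<noteq> ?V"
  proof
    assume "S = ?V"
    with S(2) dep show False by simp
  qed
  then have cS: "card S < card ?V" using S(1) finite_coeff_index by (intro psubset_card_mono) auto
  let ?r = "card S"
  define H1 where "H1 = insert (crd j) (C ` ?V)"
  have Gdeg: "\<exists>D. pdeg (C ` ?V) D (G v)" for v
    unfolding G_def by (rule pdeg_peval[OF polys_pdiff[OF Q(1)], of C v]) (rule exI)
  have fin2: "\<exists>D. pdeg H D f \<and> pdeg H D g" if f: "\<exists>D. pdeg H D f" and g: "\<exists>D. pdeg H D g"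
    for H and f g :: "(nat \<times> (nat \<Rightarrow>\<^sub>0 nat) \<Rightarrow> 'a) \<times> (nat \<Rightarrow> 'a) \<Rightarrow> 'a"
  proof -
    obtain D D' where "pdeg H D f" "pdeg H D' g" using f g by blast
    then have "pdeg H (max D D') f" "pdeg H (max D D') g"
      using pdeg_mono[of H D f "max D D'"] pdeg_mono[of H D' g "max D D'"] by simp_all
    then show ?thesis by blast
  qed
  let ?poly = "\<lambda>H. {f. \<exists>D. pdeg H D f}"
  have up: "f \<in> ?poly H'" if "\<exists>D. pdeg H D f" "H \<subseteq> H'" for f :: "(nat \<times> (nat \<Rightarrow>\<^sub>0 nat) \<Rightarrow> 'a) \<times> (nat \<Rightarrow> 'a) \<Rightarrow> 'a" and H H'
    using that pdeg_subset by blast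
  have gr1: "growth ?\<Omega> R H1 ?r"
  proof -
    have "(\<lambda>w. G (i, ?e2) w - x j * B w) \<in> ?poly (C ` ?V)"
      using Gdeg unfolding B_def
      by (intro fring_diff[OF fring_pdeg] fring_mult[OF fring_pdeg] fring_const[OF fring_pdeg]) auto
    then obtain D where "pdeg (C ` ?V) D B" "pdeg (C ` ?V) D (\<lambda>w. G (i, ?e2) w - x j * B w)"
      using fin2[of "C ` ?V" B "\<lambda>w. G (i, ?e2) w - x j * B w"] Gdeg unfolding B_def by blast
    from growth_insert_rational[OF domR S(3) BR Bnz this quad] show ?thesis by (simp add: H1_def)
  qed
  define H2 where "H2 = crd ` {..<n} \<union> H1"
  have gr2: "growth ?\<Omega> R H2 ?r"
    unfolding H2_def
  proof (rule growth_union_rational[OF domR gr1])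
    fix k assume k: "k \<in> {..<n}"
    have "crd j \<in> ?poly H1" using pdeg_mem[of "crd j" H1] by (auto simp: H1_def)
    moreover have G1: "G v \<in> ?poly H1" for v using up[OF Gdeg[of v], of H1] by (simp add: H1_def subset_insertI)
    ultimately have "(\<lambda>w. x k * B w - \<Delta> w * G (i, Poly_Mapping.single k 1) w) \<in> ?poly H1"
      unfolding B_def \<Delta>_def
      by (intro fring_diff[OF fring_pdeg] fring_mult[OF fring_pdeg] fring_const[OF fring_pdeg])
    then obtain D where "pdeg H1 D B" "pdeg H1 D (\<lambda>w. x k * B w - \<Delta> w * G (i, Poly_Mapping.single k 1) w)"
      using fin2[of H1 B] G1 unfolding B_def by blast
    then show "\<exists>q a D. q \<in> R \<and> (\<exists>w\<in>?\<Omega>. q w \<noteq> 0) \<and> pdeg H1 D q \<and> pdeg H1 D a \<and> (\<forall>w\<in>?\<Omega>. q w * crd k w = a w)"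
      using BR Bnz lin k by blast
  qed simp
  let ?V' = "{..<s} \<times> (?M - {?e})"
  define H3 where "H3 = cf ` ?V' \<union> H2"
  have gr3: "growth ?\<Omega> R H3 ?r"
    unfolding H3_def
  proof (rule growth_union_rational[OF domR gr2])
    fix v assume v: "v \<in> ?V'"
    then have vV: "v \<in> ?V" by (auto simp: coeff_index_def)
    have "crd j \<in> ?poly H2" using pdeg_mem[of "crd j" H2] by (auto simp: H2_def H1_def)
    then have "\<Delta> \<in> ?poly H2"
      unfolding \<Delta>_def by (intro fring_diff[OF fring_pdeg] fring_const[OF fring_pdeg])
    moreover have "C v \<in> ?poly H2" using pdeg_mem[of "C v" H2] vV by (auto simp: H2_def H1_def)
    ultimately obtain D where "pdeg H2 D \<Delta>" "pdeg H2 D (C v)" using fin2[of H2 \<Delta> "C v"] by blast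
    moreover have "\<forall>w\<in>?\<Omega>. \<Delta> w * cf v w = C v w"
      using v by (auto simp: \<Delta>_def cf_def C_def crd_def collide_def)
    ultimately show "\<exists>q a D. q \<in> R \<and> (\<exists>w\<in>?\<Omega>. q w \<noteq> 0) \<and> pdeg H2 D q \<and> pdeg H2 D a \<and> (\<forall>w\<in>?\<Omega>. q w * cf v w = a w)"
      using \<Delta>R \<Delta>nz by blast
  qed (simp add: finite_monoms_le)
  obtain g where g: "\<And>i. i < model_dim n X \<Longrightarrow> g i \<in> polys {..<n}"
    "alg_indep X {..<model_dim n X} (\<lambda>i x. peval x (g i))"
    by (rule model_dim_attained[OF X dom]) (rule that)
  have "card (?V' <+> {..<model_dim n X}) \<le> ?r"
  proof (rule alg_indep_le_growth[OF domR gr3])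
    have "?V' \<subseteq> ?V" by (auto simp: coeff_index_def)
    then show "H3 \<subseteq> R" unfolding H3_def H2_def H1_def using crdR cfR CR j by blast
    show fin: "finite (?V' <+> {..<model_dim n X})" by (simp add: finite_monoms_le)
    show "alg_indep ?\<Omega> (?V' <+> {..<model_dim n X}) (\<lambda>v w. case_sum (fst w) (\<lambda>i. peval (snd w) (g i)) v)"
      by (rule alg_indep_Plus[OF g(2)]) (simp_all add: finite_monoms_le)
    fix v assume v: "v \<in> ?V' <+> {..<model_dim n X}"
    show "\<exists>k. pdeg H3 k (\<lambda>w. case_sum (fst w) (\<lambda>i. peval (snd w) (g i)) v)"
    proof (cases v)
      case (Inl u)
      then have "cf u \<in> H3" using v by (auto simp: H3_def)
      from pdeg_mem[OF this] show ?thesis by (auto simp: Inl cf_def)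
    next
      case (Inr k)
      then have "g k \<in> polys {..<n}" using g(1) v by auto
      then have "(\<lambda>w. peval (\<lambda>j. crd j w) (g k)) \<in> ?poly H3"
      proof (rule fring_peval[OF fring_pdeg])
        fix j assume "j \<in> {..<n}"
        then have "crd j \<in> H3" by (auto simp: H3_def H2_def)
        from pdeg_mem[OF this] show "crd j \<in> ?poly H3" by blast
      qed
      then show ?thesis by (simp add: Inr crd_def)
    qed
  qed
  moreover have "card (?V' <+> {..<model_dim n X}) = card ?V' + model_dim n X"
    by (subst card_Plus) (simp_all add: finite_monoms_le del: card_Diff_insert)
  moreover have "card ?V = card ?V' + s"
  proof -
    have "?e \<in> ?M" by (rule single_mem_monoms_le[OF j]) (use p in simp)
    from card_Suc_Diff1[OF finite_monoms_le[OF finite_lessThan] this]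
    have M: "card ?M = Suc (card (?M - {?e}))" by (rule sym)
    show ?thesis unfolding coeff_index_def card_cartesian_product M
      by (subst mult_Suc_right) (subst card_lessThan, subst add.commute, rule refl)
  qed
  ultimately show False using cS s by linarith
qed

lemma specialisation_polyfun:
  assumes "specialisation \<Omega> V h a" "F \<in> polyfuns V" "\<And>w. w \<in> \<Omega> \<Longrightarrow> F (\<lambda>v. h v w) = 0"
  shows "F a = 0"
  using assms(2)
proof (rule polyfunsE)
  fix P assume "P \<in> polys V" "F = (\<lambda>x. peval x P)"
  then show ?thesis using specialisationD[OF assms(1), of P] assms(3) by simp
qed

text \<open>Let \<open>X\<close> be the image of \<open>Y\<close> under \<open>\<phi>\<close>.  The functions considered on \<open>K\<^sup>N \<times> Y \<times> Y\<close> are the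
coefficients \<open>c\<close> of \<open>collide\<close> at \<open>x = \<phi>(u)\<close> and \<open>y = \<phi>(v)\<close>, the coordinates of \<open>x\<close>, and those of \<open>v\<close>.
Extending a specialisation from \<open>(c, x)\<close> to \<open>(c, x, v)\<close> preserves the equations of \<open>Y\<close> and the equation
\<open>f\<^sub>c(x) = f\<^sub>c(\<phi>(v))\<close>.  Using \<open>v\<close>, not \<open>y\<close>, puts the second point of the fibre in \<open>X\<close> itself and not only in
its closure.\<close>

theorem not_identifiable_generic:
  fixes X :: "(nat \<Rightarrow> 'a::{alg_closed_field, real_normed_field}) set"
  assumes model: "is_model n X" and d: "model_dim n X > 0" and p: "p \<ge> 2" and s: "s \<le> model_dim n X"
  shows "for_generic_polys n s p (\<lambda>f. \<not> generically_identifiable n X (poly_map s f))"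
proof -
  obtain l \<phi> F where \<phi>: "\<And>i. i < n \<Longrightarrow> \<phi> i \<in> polys {..<l::nat}" and F: "F \<subseteq> polys {..<l}"
    and domY: "function_domain (zeros {..<l} F) (polyfuns {..<l})" and XY: "X = poly_map n \<phi> ` zeros {..<l} F"
    by (rule model_as_image[OF model]) (rule that)
  define Y where "Y = zeros {..<l} F"
  define pm where "pm = poly_map n \<phi>"
  have XY: "X = pm ` Y" by (simp add: XY Y_def pm_def)
  have domY: "function_domain Y (polyfuns {..<l})" using domY by (simp add: Y_def)
  have X: "X \<subseteq> aff {..<n}" unfolding XY pm_def using poly_map_aff by blast
  have dom: "function_domain X (polyfuns {..<n})" unfolding XY pm_def by (rule fdom_image[OF domY \<phi>])
  obtain j x0 y0 where j: "j < n" and xy0: "x0 \<in> X" "y0 \<in> X" "x0 j \<noteq> y0 j"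
    using nonconstant_coordinate[OF X dom d] by blast
  have nc: "\<exists>y\<in>X. y j \<noteq> x j" for x using xy0 by metis
  have p1: "p \<ge> 1" using p by simp
  let ?V = "coeff_index n s p"
  let ?\<Omega> = "(UNIV :: (nat \<times> (nat \<Rightarrow>\<^sub>0 nat) \<Rightarrow> 'a) set) \<times> (Y \<times> Y)"
  define R2 where "R2 = {F :: (nat \<Rightarrow> 'a) \<times> (nat \<Rightarrow> 'a) \<Rightarrow> 'a.
    (\<forall>y\<in>Y. (\<lambda>x. F (x, y)) \<in> polyfuns {..<l}) \<and> (\<forall>x\<in>Y. (\<lambda>y. F (x, y)) \<in> polyfuns {..<l})}"
  define R where "R = {F :: (nat \<times> (nat \<Rightarrow>\<^sub>0 nat) \<Rightarrow> 'a) \<times> ((nat \<Rightarrow> 'a) \<times> (nat \<Rightarrow> 'a)) \<Rightarrow> 'a.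
    (\<forall>y\<in>Y \<times> Y. (\<lambda>x. F (x, y)) \<in> polyfuns ?V) \<and> (\<forall>x\<in>UNIV. (\<lambda>y. F (x, y)) \<in> R2)}"
  have dom2: "function_domain (Y \<times> Y) R2" unfolding R2_def by (rule fdom_Times[OF domY domY])
  have domR: "function_domain ?\<Omega> R" unfolding R_def by (rule fdom_Times[OF fdom_affine dom2])
  note fR = fdom_fring[OF domR] and fR2 = fdom_fring[OF dom2]
  define u where "u w = fst (snd w)"
    for w :: "(nat \<times> (nat \<Rightarrow>\<^sub>0 nat) \<Rightarrow> 'a) \<times> ((nat \<Rightarrow> 'a) \<times> (nat \<Rightarrow> 'a))"
  define v where "v w = snd (snd w)"
    for w :: "(nat \<times> (nat \<Rightarrow>\<^sub>0 nat) \<Rightarrow> 'a) \<times> ((nat \<Rightarrow> 'a) \<times> (nat \<Rightarrow> 'a))"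
  define C where "C w = collide n p j (fst w) (pm (u w)) (pm (v w))" for w
  define h where "h i w = case_sum (case_sum (C w) (pm (u w))) (v w) i"
    for i :: "((nat \<times> (nat \<Rightarrow>\<^sub>0 nat)) + nat) + nat" and w
  let ?I = "Inl ` (?V <+> {..<n}) :: (((nat \<times> (nat \<Rightarrow>\<^sub>0 nat)) + nat) + nat) set"
  let ?W = "Inr ` {..<l} :: (((nat \<times> (nat \<Rightarrow>\<^sub>0 nat)) + nat) + nat) set"
  have bR: "(\<lambda>w. fst w t) \<in> R" if "t \<in> ?V" for t
    using that by (auto simp: R_def intro: polyfuns_var fring_const[OF fR2])
  have u2R: "(\<lambda>z. fst z k) \<in> R2" "(\<lambda>z. snd z k) \<in> R2" if "k \<in> {..<l}" for k
    using that by (auto simp: R2_def intro: polyfuns_var fring_const[OF fring_polyfuns])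
  have uR: "(\<lambda>w. u w k) \<in> R" "(\<lambda>w. v w k) \<in> R" if "k \<in> {..<l}" for k
    using u2R[OF that] by (auto simp: R_def u_def v_def intro: fring_const[OF fring_polyfuns])
  have pmR: "(\<lambda>w. pm (u w) k) \<in> R" "(\<lambda>w. pm (v w) k) \<in> R" if "k < n" for k
    using fring_polyfun_comp[OF fR poly_map_polyfun[of n \<phi> "{..<l}" k], of "\<lambda>k w. u w k"]
      fring_polyfun_comp[OF fR poly_map_polyfun[of n \<phi> "{..<l}" k], of "\<lambda>k w. v w k"] uR \<phi> that
    by (auto simp: pm_def)
  have CR: "(\<lambda>w. C w t) \<in> R" if t: "t \<in> ?V" for t
  proof -
    obtain i m where im: "t = (i, m)" "i < s" "m \<in> monoms_le {..<n} p" using t by (auto simp: coeff_index_def)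
    have "(\<lambda>w. fst w (i, m')) \<in> R" if "m' \<in> monoms_le {..<n} p" for m'
      using that im by (intro bR) (auto simp: coeff_index_def)
    then show ?thesis unfolding C_def im by (intro collide_fring[OF fR] pmR j im(3))
  qed
  have hR: "h i \<in> R" if i: "i \<in> ?I \<union> ?W" for i
  proof -
    consider t where "i = Inl (Inl t)" "t \<in> ?V" | k where "i = Inl (Inr k)" "k < n" | k where "i = Inr k" "k \<in> {..<l}"
      using i by auto
    then show ?thesis
    proof cases
      case 1 then show ?thesis using CR by (simp add: h_def[abs_def])
    next
      case 2 then show ?thesis using pmR by (simp add: h_def[abs_def])
    next
      case 3 then show ?thesis using uR by (simp add: h_def[abs_def])
    qed
  qed
  have pmext: "(\<lambda>z. poly_map n \<phi> (\<lambda>k. z (Inr k)) i) \<in> polyfuns (?I \<union> ?W)" if "i < n" for i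
    by (rule fring_polyfun_comp[OF fring_polyfuns poly_map_polyfun[of n \<phi> "{..<l}" i]])
       (use \<phi> that in \<open>auto intro: polyfuns_var\<close>)
  have "(\<lambda>z. z (Inl (Inr j)) - poly_map n \<phi> (\<lambda>k. z (Inr k)) j) \<in> polyfuns (?I \<union> ?W)"
    using j by (intro fring_diff[OF fring_polyfuns] pmext polyfuns_var) auto
  then obtain Q where Q: "Q \<in> polys (?I \<union> ?W)"
    and Qeq: "(\<lambda>z. z (Inl (Inr j)) - poly_map n \<phi> (\<lambda>k. z (Inr k)) j) = (\<lambda>z. peval z Q)"
    by (rule polyfunsE)
  have Qnz: "\<exists>w\<in>?\<Omega>. peval (\<lambda>i. h i w) Q \<noteq> 0"
  proof -
    obtain a b where "a \<in> Y" "b \<in> Y" "x0 = pm a" "y0 = pm b" using xy0 XY by auto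
    then have "peval (\<lambda>i. h i (\<lambda>_. 0, (a, b))) Q \<noteq> 0" "(\<lambda>_. 0, (a, b)) \<in> ?\<Omega>"
      unfolding fun_cong[OF Qeq, symmetric] using xy0(3) by (simp_all add: h_def u_def v_def pm_def)
    then show ?thesis by blast
  qed
  have finI: "finite ?I" by (simp add: finite_coeff_index)
  have finW: "finite ?W" and disj: "?I \<inter> ?W = {}" by auto
  obtain H where H: "H \<in> polys ?I" and Hnz: "\<exists>w\<in>?\<Omega>. peval (\<lambda>i. h i w) H \<noteq> 0"
    and Hext: "\<And>a. specialisation ?\<Omega> ?I h a \<Longrightarrow> peval a H \<noteq> 0 \<Longrightarrow>
      \<exists>b. (\<forall>i\<in>?I. b i = a i) \<and> specialisation ?\<Omega> (?I \<union> ?W) h b \<and> peval b Q \<noteq> 0"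
    using extend_specialisation[OF domR finI finW disj hR Q Qnz] by blast
  define pt where "pt c x = (case_sum (case_sum c x) (\<lambda>_. 0) :: ((nat \<times> (nat \<Rightarrow>\<^sub>0 nat)) + nat) + nat \<Rightarrow> 'a)"
    for c :: "nat \<times> (nat \<Rightarrow>\<^sub>0 nat) \<Rightarrow> 'a" and x :: "nat \<Rightarrow> 'a"
  have pth: "peval (\<lambda>i. h i w) P = peval (pt (C w) (pm (u w))) P" if "P \<in> polys ?I" for P w
    by (rule peval_cong[OF that]) (auto simp: h_def pt_def)
  have ptc: "(\<lambda>c. peval (pt c x) P) \<in> polyfuns ?V" if "P \<in> polys ?I" for P x
    by (rule fring_peval[OF fring_polyfuns that])
       (auto simp: pt_def intro: polyfuns_var fring_const[OF fring_polyfuns])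
  have ptx: "(\<lambda>x. peval (pt c x) P) \<in> polyfuns {..<n}" if "P \<in> polys ?I" for P c
    by (rule fring_peval[OF fring_polyfuns that])
       (auto simp: pt_def intro: polyfuns_var fring_const[OF fring_polyfuns])
  obtain c1 x1 where x1: "x1 \<in> X" "peval (pt c1 x1) H \<noteq> 0"
    using Hnz pth[OF H] XY by (auto simp: u_def)
  let ?O = "{c \<in> aff ?V. peval (pt c x1) H \<noteq> 0}"
  show ?thesis unfolding for_generic_polys_def
  proof (intro exI[of _ ?O] conjI ballI impI)
    show "openin (zariski ?V) ?O" by (rule openin_nonvanishing[OF ptc[OF H]])
    have "peval (pt (restrict c1 ?V) x1) H = peval (pt c1 x1) H" by (rule polyfuns_cong[OF ptc[OF H]]) simp
    then have "restrict c1 ?V \<in> ?O" using x1 by (simp add: aff_def)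
    then show "?O \<noteq> {}" by blast
  next
    fix f :: "nat \<Rightarrow> (nat, 'a) mpoly"
    assume f: "f \<in> {..<s} \<rightarrow>\<^sub>E polys_le {..<n} p" and O: "coeff_vec n s p f \<in> ?O"
    define c where "c = coeff_vec n s p f"
    show "\<not> generically_identifiable n X (poly_map s f)"
    proof
      assume "generically_identifiable n X (poly_map s f)"
      then obtain U where U: "openin (subtopology (zariski {..<n}) (zariski {..<n} closure_of X)) U" "U \<noteq> {}"
        and idf: "\<And>x. x \<in> X \<inter> U \<Longrightarrow> identifiable_at X (poly_map s f) x"
        unfolding generically_identifiable_def by blast
      obtain T where T: "openin (zariski {..<n}) T" "U = T \<inter> zariski {..<n} closure_of X"
        using U(1) unfolding openin_subtopology by blast
      obtain E where E: "E \<subseteq> polys {..<n}" "T = aff {..<n} - zeros {..<n} E"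
        using T(1) unfolding openin_zariski by blast
      obtain z where z: "z \<in> U" using U(2) by blast
      then obtain P where P: "P \<in> E" "peval z P \<noteq> 0" using T E by (auto simp: zeros_def)
      have Pf: "(\<lambda>x. peval x P) \<in> polyfuns {..<n}" using P E by (intro polyfunsI) blast
      have "\<exists>x\<in>X. peval x P \<noteq> 0"
        using vanishes_on_closure[OF X Pf, of z] P z T(2) by blast
      moreover have "\<exists>x\<in>X. peval (pt c x) H \<noteq> 0" using O x1(1) by (auto simp: c_def)
      ultimately obtain x where x: "x \<in> X" "peval x P \<noteq> 0" "peval (pt c x) H \<noteq> 0"
        using fdom_both[OF dom Pf ptx[OF H]] by blast
      have xU: "x \<in> U" unfolding T(2) E(2) using x P X subset_closure[OF X] by (auto simp: zeros_def)
      \<comment> \<open>By density of the colliding coefficients for this \<open>x\<close>, no relation restricts \<open>(c, x)\<close>.\<close>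
      have spec: "specialisation ?\<Omega> ?I h (pt c x)"
        unfolding specialisation_def
      proof (intro ballI impI)
        fix P assume P: "P \<in> polys ?I" "\<forall>w\<in>?\<Omega>. peval (\<lambda>v. h v w) P = 0"
        obtain P' where P': "P' \<in> polys ?V" "(\<lambda>c. peval (pt c x) P) = (\<lambda>c. peval c P')"
          using ptc[OF P(1), of x] by (rule polyfunsE)
        have "P' = 0"
        proof (rule ccontr)
          assume "P' \<noteq> 0"
          then obtain w where w: "w \<in> UNIV \<times> X" "peval (\<lambda>t. collide n p j (fst w) x (snd w) t) P' \<noteq> 0"
            using alg_indepD[OF collide_independent[where x = x and j = j, OF X dom p s j nc[of x]] P'(1)] by blast
          obtain a b where ab: "a \<in> Y" "b \<in> Y" "x = pm a" "snd w = pm b" using x(1) w(1) XY by auto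
          have "(fst w, (a, b)) \<in> ?\<Omega>" using ab by simp
          with P have "peval (pt (C (fst w, (a, b))) (pm a)) P = 0" by (auto simp: pth[OF P(1)] u_def)
          then have "peval (C (fst w, (a, b))) P' = 0"
            using fun_cong[OF P'(2), of "C (fst w, (a, b))"] ab(3) by simp
          then show False using w(2) ab by (simp add: C_def u_def v_def)
        qed
        then show "peval (pt c x) P = 0" using fun_cong[OF P'(2), of c] by simp
      qed
      obtain b where b: "\<And>i. i \<in> ?I \<Longrightarrow> b i = pt c x i" and sb: "specialisation ?\<Omega> (?I \<union> ?W) h b" and bQ: "peval b Q \<noteq> 0"
        using Hext[OF spec x(3)] by blast
      have bc: "b (Inl (Inl t)) = c t" if "t \<in> ?V" for t using b[OF imageI[OF InlI[OF that]]] by (simp add: pt_def)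
      have bx: "b (Inl (Inr k)) = x k" if "k < n" for k using b[OF imageI[OF InrI[of k "{..<n}"]]] that by (simp add: pt_def)
      define w where "w = restrict (\<lambda>k. b (Inr k)) {..<l}"
      define y where "y = poly_map n \<phi> w"
      have pmw: "poly_map n \<phi> (\<lambda>k. b (Inr k)) i = y i" if "i < n" for i
        unfolding y_def w_def by (rule polyfuns_cong[OF poly_map_polyfun[of n \<phi> "{..<l}" i]]) (use \<phi> that in auto)
      have "peval w P = 0" if P: "P \<in> F" for P
      proof -
        have Pl: "P \<in> polys {..<l}" using P F by blast
        have "(\<lambda>z. peval (\<lambda>k. z (Inr k)) P) \<in> polyfuns (?I \<union> ?W)"
          by (rule fring_peval[OF fring_polyfuns Pl]) (auto intro: polyfuns_var)
        then have "peval (\<lambda>k. b (Inr k)) P = 0"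
        proof (rule specialisation_polyfun[OF sb])
          fix w assume "w \<in> ?\<Omega>"
          then have "v w \<in> Y" by (auto simp: v_def)
          then show "peval (\<lambda>k. h (Inr k) w) P = 0" using P by (simp add: h_def Y_def zeros_def)
        qed
        moreover have "peval w P = peval (\<lambda>k. b (Inr k)) P" by (rule peval_cong[OF Pl]) (simp add: w_def)
        ultimately show ?thesis by simp
      qed
      then have "w \<in> Y" by (auto simp: Y_def zeros_def w_def aff_def)
      then have yX: "y \<in> X" by (auto simp: XY y_def pm_def)
      have "ceval n p c i x = ceval n p c i y" if i: "i < s" for i
      proof -
        let ?D = "\<lambda>z. ceval n p (\<lambda>t. z (Inl (Inl t))) i (\<lambda>k. z (Inl (Inr k)))
          - ceval n p (\<lambda>t. z (Inl (Inl t))) i (\<lambda>k. poly_map n \<phi> (\<lambda>k. z (Inr k)) k)"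
        have "?D \<in> polyfuns (?I \<union> ?W)"
          by (intro fring_diff[OF fring_polyfuns] ceval_fring[OF fring_polyfuns] pmext polyfuns_var)
             (use i in \<open>auto simp: coeff_index_def\<close>)
        then have "?D b = 0"
        proof (rule specialisation_polyfun[OF sb])
          fix w
          show "?D (\<lambda>i. h i w) = 0"
            using ceval_collide[OF j p1, of "fst w" "pm (u w)" "pm (v w)" i] by (simp add: h_def C_def pm_def)
        qed
        moreover have "ceval n p (\<lambda>t. b (Inl (Inl t))) i z = ceval n p c i z" for z
          unfolding ceval_def using i by (intro sum.cong refl) (simp add: bc coeff_index_def)
        moreover have "ceval n p c i z = ceval n p c i z'" if "\<And>k. k < n \<Longrightarrow> z k = z' k" for z z'
        proof -
          have "(\<lambda>z. ceval n p c i z) \<in> polyfuns {..<n}"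
            by (intro ceval_fring[OF fring_polyfuns] polyfuns_var fring_const[OF fring_polyfuns]) auto
          then show ?thesis by (rule polyfuns_cong) (use that in auto)
        qed
        from this[of "\<lambda>k. b (Inl (Inr k))" x] this[of "\<lambda>k. poly_map n \<phi> (\<lambda>k. b (Inr k)) k" y]
        have "ceval n p c i (\<lambda>k. b (Inl (Inr k))) = ceval n p c i x"
          "ceval n p c i (\<lambda>k. poly_map n \<phi> (\<lambda>k. b (Inr k)) k) = ceval n p c i y"
          using pmw by (simp_all add: bx)
        ultimately show ?thesis by simp
      qed
      then have "poly_map s f y = poly_map s f x" unfolding poly_map_eq_iff[OF f] c_def by simp
      moreover have "identifiable_at X (poly_map s f) x" using idf x(1) xU by blast
      ultimately have "y = x" using yX unfolding identifiable_at_def by blast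
      moreover have "x j \<noteq> y j"
        using bQ unfolding fun_cong[OF Qeq, symmetric] using j by (simp add: pmw bx)
      ultimately show False by simp
    qed
  qed
qed

lemma model_function_domain:
  fixes X :: "(nat \<Rightarrow> 'a::field_char_0) set"
  assumes "is_model n X"
  shows "X \<subseteq> aff {..<n}" "function_domain X (polyfuns {..<n})"
proof -
  obtain l \<phi> F where \<phi>: "\<And>i. i < n \<Longrightarrow> \<phi> i \<in> polys {..<l::nat}" and "F \<subseteq> polys {..<l}"
    and dom: "function_domain (zeros {..<l} F) (polyfuns {..<l})" and X: "X = poly_map n \<phi> ` zeros {..<l} F"
    by (rule model_as_image[OF assms]) (rule that)
  show "X \<subseteq> aff {..<n}" unfolding X using poly_map_aff by blast
  show "function_domain X (polyfuns {..<n})" unfolding X by (rule fdom_image[OF dom \<phi>])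
qed

lemma for_generic_polys_mono:
  assumes "for_generic_polys n s p Q" "\<And>f. Q f \<Longrightarrow> Q' f"
  shows "for_generic_polys n s p Q'"
  using assms unfolding for_generic_polys_def by meson

lemma for_generic_polys_all:
  assumes "\<And>f. Q f"
  shows "for_generic_polys n s p Q"
  unfolding for_generic_polys_def using assms
  by (intro exI[of _ "topspace (zariski (coeff_index n s p))"] conjI openin_topspace)
     (auto simp: aff_def PiE_eq_empty_iff)

theorem mainTheorem9:
  fixes n s p :: nat
  assumes "s \<ge> 1" and "p \<ge> 1"
  shows "(\<forall>X :: (nat \<Rightarrow> real) set. is_model n X \<longrightarrow> s \<ge> model_dim n X + 1 \<longrightarrow>
            for_generic_polys n s p (\<lambda>f. generically_identifiable n X (poly_map s f))) \<and>
         (\<forall>X :: (nat \<Rightarrow> complex) set. is_model n X \<longrightarrow> s \<ge> model_dim n X + 1 \<longrightarrow>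
            for_generic_polys n s p (\<lambda>f. generically_identifiable n X (poly_map s f))) \<and>
         (\<forall>X :: (nat \<Rightarrow> complex) set. is_model n X \<longrightarrow> model_dim n X > 0 \<longrightarrow> p > 1 \<longrightarrow>
            for_generic_polys n s p
              (\<lambda>f. generically_identifiable n X (poly_map s f) \<longrightarrow> s \<ge> model_dim n X + 1))"
proof (intro conjI allI impI)
  fix X :: "(nat \<Rightarrow> real) set" assume "is_model n X" "s \<ge> model_dim n X + 1"
  then show "for_generic_polys n s p (\<lambda>f. generically_identifiable n X (poly_map s f))"
    using generically_identifiable_generic model_function_domain assms(2) by blast
next
  fix X :: "(nat \<Rightarrow> complex) set" assume "is_model n X" "s \<ge> model_dim n X + 1"
  then show "for_generic_polys n s p (\<lambda>f. generically_identifiable n X (poly_map s f))"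
    using generically_identifiable_generic model_function_domain assms(2) by blast
next
  fix X :: "(nat \<Rightarrow> complex) set" assume X: "is_model n X" "model_dim n X > 0" and p: "p > 1"
  show "for_generic_polys n s p
    (\<lambda>f. generically_identifiable n X (poly_map s f) \<longrightarrow> s \<ge> model_dim n X + 1)"
  proof (cases "s \<ge> model_dim n X + 1")
    case True
    then show ?thesis by (intro for_generic_polys_all) simp
  next
    case False
    then have "for_generic_polys n s p (\<lambda>f. \<not> generically_identifiable n X (poly_map s f))"
      using X p by (intro not_identifiable_generic) auto
    then show ?thesis by (rule for_generic_polys_mono) simp
  qed
qed

end
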